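(* For any index ${\bf k}=(k_1,\ldots,k_r)$ with $r\ge2$, we have \begin{align*} \omega_{\mathcal{A}}({{\bf k}}) = (-1)^{k_r} \zeta_{\mathcal{A}}(x_0^{k_r} (y_{k_1}\mathbin{\sqcup\!\sqcup} \cdots \mathbin{\sqcup\!\sqcup} y_{k_{r-1}})),\\ \omega_{\mathcal{S}}({{\bf k}}) = (-1)^{k_r} \zeta_{\mathcal{S}}(x_0^{k_r} (y_{k_1}\mathbin{\sqcup\!\sqcup} \cdots \mathbin{\sqcup\!\sqcup} y_{k_{r-1}})). \end{align*}
   Context: An index is a tuple ${\bf k}=(k_1,\ldots,k_r)$ of positive integers. Let $\mathcal{A}=(\prod_p \mathbb{F}_p)/(\bigoplus_p \mathbb{F}_p)$ ($p$ over all primes), a $\mathbb{Q}$-algebra. For $n\in\mathbb{N}$ set $H_n({\bf k})=\sum_{n>m_1>\cdots>m_r>0}\prod_a m_a^{-k_a}$ and $\omega_n({\bf k})=\sum_{m_1+\cdots+m_r=n,\ m_a>0}\prod_a m_a^{-k_a}$; define $\zeta_{\mathcal{A}}({\bf k})=(H_p({\bf k})\bmod p)_p\in\mathcal{A}$ and, for $r\ge2$, $\omega_{\mathcal{A}}({\bf k})=(\omega_p({\bf k})\bmod p)_p\in\mathcal{A}$. Let $\mathfrak{h}=\mathbb{Q}\langle x_0,x_1\rangle$, $\mathfrak{h}^1=\mathbb{Q}+\mathfrak{h}x_1$, $\mathfrak{h}^0=\mathbb{Q}+x_0\mathfrak{h}x_1$, $y_k=x_0^{k-1}x_1$, $y_{\bf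 k}=y_{k_1}\cdots y_{k_r}$. The shuffle product $\mathbin{\sqcup\!\sqcup}$ on $\mathfrak{h}$ is defined by $uw\mathbin{\sqcup\!\sqcup} vw'=u(w\mathbin{\sqcup\!\sqcup} vw')+v(uw\mathbin{\sqcup\!\sqcup} w')$ for $u,v\in\{x_0,x_1\}$, $w,w'\in\mathfrak{h}$, and $1\mathbin{\sqcup\!\sqcup} w=w\mathbin{\sqcup\!\sqcup} 1=w$. Let $\mathcal{Z}$ be the $\mathbb{Q}$-span of multiple zeta values $\zeta({\bf k})=\sum_{m_1>\cdots>m_r>0}\prod_a m_a^{-k_a}$ ($k_1\ge2$), and $\zeta^{\mathbin{\sqcup\!\sqcup}}:\mathfrak{h}^1\to\mathbb{R}$ the unique shuffle-algebra homomorphism extending $\zeta(y_{\bf k})=\zeta({\bf k})$ on $\mathfrak{h}^0$ with $\zeta^{\mathbin{\sqcup\!\sqcup}}(x_1)=0$; write $\zeta^{\mathbin{\sqcup\!\sqcup}}({\bf k})=\zeta^{\mathbin{\sqcup\!\sqcup}}(y_{\bf k})$. Set $\zeta^{\mathbin{\sqcup\!\sqcup}}_{\mathcal{S}}({\bf k})=\sum_{a=0}^r(-1)^{k_1+\cdots+k_a}\zeta^{\mathbin{\sqcup\!\sqcup}}(k_a,\ldots,k_1)\zeta^{\mathbin{\sqcup\!\sqcup}}(k_{a+1},\ldots,k_r)$ and $\zeta_{\mathcal{S}}({\bf k})=\zeta^{\mathbin{\sqcup\!\sqcup}}_{\mathcal{S}}({\bf k})\bmod \zeta(2)\mathcal{Z}$.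 For $\bullet\in\{\mathcal{A},\mathcal{S}\}$, $\zeta_\bullet$ is extended $\mathbb{Q}$-linearly to $\mathfrak{h}^1$ via $\zeta_\bullet(y_{\bf k})=\zeta_\bullet({\bf k})$. With $[m]=(1-q^m)/(1-q)$ and $\omega_n({\bf k};q)=\sum_{m_1+\cdots+m_r=n,\,m_a>0}\prod_a q^{(k_a-1)m_a}/[m_a]^{k_a}$, for $r\ge2$ the limit $\Omega({\bf k})=\lim_{n\to\infty}\omega_n({\bf k};e^{2\pi i/n})$ exists and lies in $\mathcal{Z}$; set $\omega_{\mathcal{S}}({\bf k})=\Omega({\bf k})\bmod\zeta(2)\mathcal{Z}$. *)

theory Defs
  imports
    "HOL-Analysis.Analysis"
    "HOL-Library.Poly_Mapping"
    "HOL-Number_Theory.Number_Theory"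
begin

section \<open>Indices and finite sums\<close>

definition is_index :: "nat list \<Rightarrow> bool" where
  "is_index k \<longleftrightarrow> (\<forall>a\<in>set k. 0 < a)"

definition decreasing_tuples :: "nat \<Rightarrow> nat list set" where
  "decreasing_tuples r = {m. length m = r \<and> sorted_wrt (>) m \<and> (\<forall>a\<in>set m. 0 < a)}"

definition compositions :: "nat \<Rightarrow> nat \<Rightarrow> nat list set" where
  "compositions n r = {m. length m = r \<and> sum_list m = n \<and> (\<forall>a\<in>set m. 0 < a)}"

definition inv_powers :: "nat list \<Rightarrow> nat list \<Rightarrow> 'a::field" where
  "inv_powers k m = (\<Prod>a<length k. 1 / of_nat (m ! a) ^ (k ! a))"

definition mhs :: "nat \<Rightarrow> nat list \<Rightarrow> rat" where
  "mhs n k = (\<Sum>m \<in> {m \<in> decreasing_tuples (length k). \<forall>a\<in>set m. a < n}. inv_powers k m)"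

definition omega_sum :: "nat \<Rightarrow> nat list \<Rightarrow> rat" where
  "omega_sum n k = (\<Sum>m \<in> compositions n (length k). inv_powers k m)"


section \<open>The ring \<open>\<A>\<close>\<close>

text \<open>
  An element of \<open>\<Prod>\<^sub>p \<int>/p\<int>\<close> is represented by a family of integers; only the residue modulo \<open>p\<close>
  of its value at a prime \<open>p\<close> matters, and its values at non-primes are irrelevant.
  Dividing out \<open>\<Oplus>\<^sub>p \<int>/p\<int>\<close> identifies families that agree at all but finitely many primes.
\<close>

definition almost_all_cong :: "(nat \<Rightarrow> int) \<Rightarrow> (nat \<Rightarrow> int) \<Rightarrow> bool" where
  "almost_all_cong f g \<longleftrightarrow> finite {p. prime p \<and> \<not> [f p = g p] (mod int p)}"

lemma almost_all_congI:
  assumes "finite B" and "\<And>p. prime p \<Longrightarrow> p \<notin> B \<Longrightarrow> [f p = g p] (mod int p)"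
  shows "almost_all_cong f g"
  unfolding almost_all_cong_def by (rule finite_subset[OF _ assms(1)]) (use assms(2) in blast)

lemma almost_all_congE:
  assumes "almost_all_cong f g"
  obtains B where "finite B" and "\<And>p. prime p \<Longrightarrow> p \<notin> B \<Longrightarrow> [f p = g p] (mod int p)"
  using assms unfolding almost_all_cong_def by blast

lemma equivp_almost_all_cong: "equivp almost_all_cong"
proof (rule equivpI)
  show "reflp almost_all_cong"
    by (auto simp: reflp_def almost_all_cong_def)
  show "symp almost_all_cong"
    by (auto simp: symp_def almost_all_cong_def cong_sym_eq)
  show "transp almost_all_cong"
  proof (rule transpI)
    fix f g h assume "almost_all_cong f g" "almost_all_cong g h"
    then obtain B C where "finite B" "\<And>p. prime p \<Longrightarrow> p \<notin> B \<Longrightarrow> [f p = g p] (mod int p)"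
      "finite C" "\<And>p. prime p \<Longrightarrow> p \<notin> C \<Longrightarrow> [g p = h p] (mod int p)"
      by (metis almost_all_congE)
    then show "almost_all_cong f h"
      by (intro almost_all_congI[of "B \<union> C"]) (auto intro: cong_trans)
  qed
qed

quotient_type ring_A = "nat \<Rightarrow> int" / almost_all_cong
  by (rule equivp_almost_all_cong)

instantiation ring_A :: comm_ring_1
begin

lift_definition zero_ring_A :: ring_A is "\<lambda>p. 0" .

lift_definition one_ring_A :: ring_A is "\<lambda>p. 1" .

lift_definition plus_ring_A :: "ring_A \<Rightarrow> ring_A \<Rightarrow> ring_A" is "\<lambda>f g p. f p + g p"
  by (elim almost_all_congE, rule_tac B = "B \<union> Ba" in almost_all_congI) (auto intro: cong_add)

lift_definition times_ring_A :: "ring_A \<Rightarrow> ring_A \<Rightarrow> ring_A" is "\<lambda>f g p. f p * g p"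
  by (elim almost_all_congE, rule_tac B = "B \<union> Ba" in almost_all_congI) (auto intro: cong_mult)

lift_definition minus_ring_A :: "ring_A \<Rightarrow> ring_A \<Rightarrow> ring_A" is "\<lambda>f g p. f p - g p"
  by (elim almost_all_congE, rule_tac B = "B \<union> Ba" in almost_all_congI) (auto intro: cong_diff)

lift_definition uminus_ring_A :: "ring_A \<Rightarrow> ring_A" is "\<lambda>f p. - f p"
  by (elim almost_all_congE, rule_tac B = "B" in almost_all_congI) (auto simp: cong_minus_minus_iff)

instance
proof
  show "(0::ring_A) \<noteq> 1"
  proof transfer
    have "{p::nat. prime p \<and> \<not> [0 = 1] (mod int p)} = {p. prime p}"
      by (auto simp: cong_0_1_nat cong_iff_dvd_diff)
    then show "\<not> almost_all_cong (\<lambda>p. 0) (\<lambda>p. 1)"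
      using primes_infinite by (simp add: almost_all_cong_def)
  qed
qed (transfer; auto intro!: almost_all_congI[of "{}"] simp: algebra_simps)+

end

text \<open>The reduction modulo \<open>p\<close> of a rational number; meaningful when \<open>p\<close> does not divide its denominator.\<close>

definition rat_mod :: "nat \<Rightarrow> rat \<Rightarrow> int" where
  "rat_mod p x = fst (quotient_of x) * modular_inverse (int p) (snd (quotient_of x))"

lift_definition scale_A :: "rat \<Rightarrow> ring_A \<Rightarrow> ring_A" is "\<lambda>c f p. rat_mod p c * f p"
  by (elim almost_all_congE, rule_tac B = "B" in almost_all_congI) (auto intro: cong_scalar_left)

lemma rat_mod_unique:
  assumes "prime p" "\<not> int p dvd b" "x = of_int a / of_int b"
  shows "[b * rat_mod p x = a] (mod int p)"
proof -
  obtain c d where cd: "quotient_of x = (c, d)" by force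
  have d: "d > 0" "coprime c d" "x = of_int c / of_int d"
    using quotient_of_denom_pos[OF cd] quotient_of_coprime[OF cd] quotient_of_div[OF cd] by auto
  have b: "b \<noteq> 0" using assms by auto
  have "(of_int c :: rat) * of_int b = of_int a * of_int d"
    using d b assms(3) by (simp add: field_simps)
  then have eq: "c * b = a * d" by (simp flip: of_int_mult)
  then have "d dvd b"
    using d(2) by (metis coprime_commute coprime_dvd_mult_right_iff dvd_triv_right)
  then have "\<not> int p dvd d" using assms(2) dvd_trans by blast
  then have cop: "coprime (int p) d"
    using assms(1) by (simp add: prime_imp_coprime)
  have "[b * rat_mod p x = b * (c * modular_inverse (int p) d)] (mod int p)"
    by (simp add: rat_mod_def cd)
  also have "b * (c * modular_inverse (int p) d) = a * (d * modular_inverse (int p) d)"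
    using eq by (simp add: algebra_simps)
  also have "[\<dots> = a * 1] (mod int p)"
    using cop by (intro cong_scalar_left cong_modular_inverse1) (simp add: coprime_commute)
  finally show ?thesis by simp
qed

lemma rat_mod_unique':
  assumes "prime p" "\<not> int p dvd b" "x = of_int a / of_int b" "[b * y = a] (mod int p)"
  shows "[rat_mod p x = y] (mod int p)"
proof -
  have "[b * rat_mod p x = b * y] (mod int p)"
    using rat_mod_unique[OF assms(1-3)] assms(4) cong_sym cong_trans by blast
  moreover have "coprime b (int p)"
    using assms(1,2) prime_imp_coprime[of "int p" b] by (simp add: coprime_commute)
  ultimately show ?thesis by (simp add: cong_mult_lcancel)
qed

lemma finite_bad_primes: "b \<noteq> 0 \<Longrightarrow> finite {p::nat. int p dvd b}"
  by (rule finite_subset[OF _ finite_atMost[of "nat \<bar>b\<bar>"]])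
     (auto dest: dvd_imp_le_int)

lemma rat_mod_add: "almost_all_cong (\<lambda>p. rat_mod p (x + y)) (\<lambda>p. rat_mod p x + rat_mod p y)"
  and rat_mod_mult: "almost_all_cong (\<lambda>p. rat_mod p (x * y)) (\<lambda>p. rat_mod p x * rat_mod p y)"
proof -
  obtain a b where x: "x = of_int a / of_int b" "b > 0"
    by (metis quotient_of_denom_pos quotient_of_div surj_pair)
  obtain c d where y: "y = of_int c / of_int d" "d > 0"
    by (metis quotient_of_denom_pos quotient_of_div surj_pair)
  let ?B = "{p::nat. int p dvd b} \<union> {p. int p dvd d}"
  have B: "finite ?B" using x y by (auto intro: finite_bad_primes)
  have *: "\<not> int p dvd b * d" if "prime p" "p \<notin> ?B" for p
    using that by (auto simp: prime_dvd_mult_iff)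
  have xb: "[b * rat_mod p x = a] (mod int p)" and yd: "[d * rat_mod p y = c] (mod int p)"
    if "prime p" "p \<notin> ?B" for p
    using that x y by (auto intro: rat_mod_unique)
  show "almost_all_cong (\<lambda>p. rat_mod p (x + y)) (\<lambda>p. rat_mod p x + rat_mod p y)"
  proof (rule almost_all_congI[OF B])
    fix p assume p: "prime p" "p \<notin> ?B"
    show "[rat_mod p (x + y) = rat_mod p x + rat_mod p y] (mod int p)"
    proof (rule rat_mod_unique'[OF p(1) *[OF p]])
      show "x + y = of_int (a * d + c * b) / of_int (b * d)"
        using x y by (simp add: field_simps)
      have "[(b * rat_mod p x) * d + (d * rat_mod p y) * b = a * d + c * b] (mod int p)"
        using xb[OF p] yd[OF p] by (intro cong_add cong_scalar_right)
      then show "[b * d * (rat_mod p x + rat_mod p y) = a * d + c * b] (mod int p)"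
        by (simp add: algebra_simps)
    qed
  qed
  show "almost_all_cong (\<lambda>p. rat_mod p (x * y)) (\<lambda>p. rat_mod p x * rat_mod p y)"
  proof (rule almost_all_congI[OF B])
    fix p assume p: "prime p" "p \<notin> ?B"
    show "[rat_mod p (x * y) = rat_mod p x * rat_mod p y] (mod int p)"
    proof (rule rat_mod_unique'[OF p(1) *[OF p]])
      show "x * y = of_int (a * c) / of_int (b * d)"
        using x y by (simp add: field_simps)
      have "[(b * rat_mod p x) * (d * rat_mod p y) = a * c] (mod int p)"
        using xb[OF p] yd[OF p] by (intro cong_mult)
      then show "[b * d * (rat_mod p x * rat_mod p y) = a * c] (mod int p)"
        by (simp add: algebra_simps)
    qed
  qed
qed

lemma almost_all_cong_sym: "almost_all_cong f g \<Longrightarrow> almost_all_cong g f"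
  by (simp add: almost_all_cong_def cong_sym_eq)

lemma almost_all_cong_mult_right:
  "almost_all_cong f g \<Longrightarrow> almost_all_cong (\<lambda>p. f p * x p) (\<lambda>p. g p * x p)"
  by (elim almost_all_congE, rule_tac B = "B" in almost_all_congI) (auto intro: cong_scalar_right)

lemma vector_space_scale_A: "vector_space scale_A"
proof
  fix a b :: rat and x y :: ring_A
  show "scale_A a (x + y) = scale_A a x + scale_A a y"
    by transfer (auto intro!: almost_all_congI[of "{}"] simp: algebra_simps)
  show "scale_A (a + b) x = scale_A a x + scale_A b x"
    by transfer (simp only: distrib_right[symmetric] almost_all_cong_mult_right[OF rat_mod_add])
  show "scale_A a (scale_A b x) = scale_A (a * b) x"
    by transfer (simp only: mult.assoc[symmetric]
      almost_all_cong_mult_right[OF almost_all_cong_sym[OF rat_mod_mult]])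
  have "almost_all_cong (\<lambda>p. rat_mod p 1) (\<lambda>p. 1)"
    by (rule almost_all_congI[of "{}"], simp, rule rat_mod_unique'[of _ 1 1 1]) auto
  from almost_all_cong_mult_right[OF this] show "scale_A 1 x = x"
    by transfer simp
qed

definition zeta_A_index :: "nat list \<Rightarrow> ring_A" where
  "zeta_A_index k = abs_ring_A (\<lambda>p. rat_mod p (mhs p k))"

definition omega_A :: "nat list \<Rightarrow> ring_A" where
  "omega_A k = abs_ring_A (\<lambda>p. rat_mod p (omega_sum p k))"


section \<open>The algebra \<open>\<hh> = \<rat>\<langle>x\<^sub>0, x\<^sub>1\<rangle>\<close>\<close>

text \<open>
  Words under concatenation form the free monoid, so the convolution product of
  finitely supported functions on words is the product of the free associative algebra.
\<close>

instantiation list :: (type) monoid_add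
begin

definition zero_list :: "'a list" where "zero_list = []"

definition plus_list :: "'a list \<Rightarrow> 'a list \<Rightarrow> 'a list" where "plus_list = (@)"

instance
  by standard (simp_all add: zero_list_def plus_list_def)

end

datatype letter = L0 | L1

type_synonym hoffman = "letter list \<Rightarrow>\<^sub>0 rat"

definition word :: "letter list \<Rightarrow> hoffman" where
  "word w = Poly_Mapping.single w 1"

definition scale_h :: "rat \<Rightarrow> hoffman \<Rightarrow> hoffman" where
  "scale_h c u = Poly_Mapping.single [] c * u"

abbreviation x\<^sub>0 :: hoffman where "x\<^sub>0 \<equiv> word [L0]"

abbreviation x\<^sub>1 :: hoffman where "x\<^sub>1 \<equiv> word [L1]"

definition hoffman1 :: "hoffman set" where
  "hoffman1 = {scale_h c 1 + u * x\<^sub>1 | c u. True}"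

definition y_gen :: "nat \<Rightarrow> hoffman" where
  "y_gen k = x\<^sub>0 ^ (k - 1) * x\<^sub>1"

definition y_index :: "nat list \<Rightarrow> hoffman" where
  "y_index k = prod_list (map y_gen k)"

definition y_word :: "nat list \<Rightarrow> letter list" where
  "y_word k = concat (map (\<lambda>a. replicate (a - 1) L0 @ [L1]) k)"

lemma word_append: "word (v @ w) = word v * word w"
  by (simp add: word_def mult_single plus_list_def)

lemma word_Nil: "word [] = 1"
  by (simp only: word_def zero_list_def[symmetric] single_one)

lemma y_index_eq_word: "y_index k = word (y_word k)"
proof -
  have "word (replicate n L0) = x\<^sub>0 ^ n" for n
  proof (induction n)
    case (Suc n)
    then show ?case using word_append[of "[L0]" "replicate n L0"] by simp
  qed (simp add: word_Nil)
  then have "word (replicate (a - 1) L0 @ [L1]) = y_gen a" for a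
    by (simp add: y_gen_def word_append)
  then show ?thesis
    unfolding y_index_def y_word_def
    by (induction k) (simp_all only: list.map concat.simps prod_list.Nil prod_list.Cons word_Nil word_append)
qed

lemma inj_on_y_word: "inj_on y_word {k. is_index k}"
proof (rule inj_onI; unfold mem_Collect_eq)
  fix k l :: "nat list"
  assume "is_index k" "is_index l" "y_word k = y_word l"
  then show "k = l"
  proof (induction k arbitrary: l)
    case Nil
    then show ?case by (cases l) (auto simp: y_word_def)
  next
    case (Cons a k)
    obtain b l' where l: "l = b # l'"
      using Cons.prems by (cases l) (auto simp: y_word_def)
    have eq: "replicate (a - 1) L0 @ L1 # y_word k = replicate (b - 1) L0 @ L1 # y_word l'"
      using Cons.prems l by (simp add: y_word_def)
    have len: "length (takeWhile (\<lambda>x. x = L0) (replicate n L0 @ L1 # w)) = n" for n w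
      by (induction n) auto
    have ab: "a - 1 = b - 1"
      using arg_cong[OF eq, of "\<lambda>w. length (takeWhile (\<lambda>x. x = L0) w)"] by (simp only: len)
    then have "y_word k = y_word l'" using eq by simp
    then have "k = l'"
      using Cons.prems(1,2) l by (intro Cons.IH) (simp_all add: is_index_def)
    moreover have "a = b"
      using ab Cons.prems(1,2) l by (auto simp: is_index_def)
    ultimately show ?case using l by simp
  qed
qed

fun shuffle_word :: "letter list \<Rightarrow> letter list \<Rightarrow> hoffman" where
  "shuffle_word [] w = word w"
| "shuffle_word w [] = word w"
| "shuffle_word (u # w) (v # w') =
     word [u] * shuffle_word w (v # w') + word [v] * shuffle_word (u # w) w'"

definition shuffle :: "hoffman \<Rightarrow> hoffman \<Rightarrow> hoffman" (infixr \<open>\<squnion>\<squnion>\<close> 70) where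
  "f \<squnion>\<squnion> g = (\<Sum>v\<in>Poly_Mapping.keys f. \<Sum>w\<in>Poly_Mapping.keys g.
     scale_h (Poly_Mapping.lookup f v * Poly_Mapping.lookup g w) (shuffle_word v w))"

definition shuffle_list :: "hoffman list \<Rightarrow> hoffman" where
  "shuffle_list us = foldr (\<squnion>\<squnion>) us 1"

text \<open>
  The \<open>\<rat>\<close>-linear map on \<open>\<hh>\<^sup>1\<close> with \<open>y\<^sub>k \<mapsto> f k\<close>, the \<open>y\<^sub>k\<close> being a \<open>\<rat>\<close>-basis of \<open>\<hh>\<^sup>1\<close>;
  words ending in \<open>x\<^sub>0\<close>, which do not occur in elements of \<open>\<hh>\<^sup>1\<close>, are ignored.
\<close>

definition linear_extension ::
    "(rat \<Rightarrow> 'b \<Rightarrow> 'b) \<Rightarrow> (nat list \<Rightarrow> 'b) \<Rightarrow> hoffman \<Rightarrow> 'b::comm_monoid_add" where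
  "linear_extension sc f u =
     (\<Sum>k | is_index k \<and> y_word k \<in> Poly_Mapping.keys u. sc (Poly_Mapping.lookup u (y_word k)) (f k))"

lemma linear_extension_y_index:
  assumes "vector_space sc" "is_index k"
  shows "linear_extension sc f (y_index k) = f k"
proof -
  have "{l. is_index l \<and> y_word l \<in> Poly_Mapping.keys (y_index k)} = {k}"
    using assms(2) inj_on_eq_iff[OF inj_on_y_word, of _ k]
    by (auto simp: y_index_eq_word word_def)
  then show ?thesis
    using vector_space.vector_space_assms(4)[OF assms(1)]
    by (simp add: linear_extension_def y_index_eq_word word_def)
qed

definition zeta_A :: "hoffman \<Rightarrow> ring_A" where
  "zeta_A = linear_extension scale_A zeta_A_index"


section \<open>Multiple zeta values and their shuffle regularization\<close>

text \<open>The empty index is admissible, with \<open>\<zeta>(\<emptyset>) = 1\<close>.\<close>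

definition admissible :: "nat list \<Rightarrow> bool" where
  "admissible k \<longleftrightarrow> is_index k \<and> (k \<noteq> [] \<longrightarrow> 2 \<le> hd k)"

definition mzv :: "nat list \<Rightarrow> real" where
  "mzv k = (\<Sum>\<^sub>\<infinity>m \<in> decreasing_tuples (length k). inv_powers k m)"

global_interpretation rat_real: vector_space "\<lambda>(c::rat) (x::real). of_rat c * x"
  by standard (simp_all add: algebra_simps of_rat_add of_rat_mult)

definition mzv_space :: "real set" where
  "mzv_space = rat_real.span {mzv k | k. admissible k}"

text \<open>
  On \<open>\<hh>\<^sup>0 = \<rat> + x\<^sub>0 \<hh> x\<^sub>1\<close>, which has the \<open>y\<^sub>k\<close> with \<open>k\<close> admissible as a basis, the map is prescribed
  by the multiple zeta values. Functions on \<open>\<hh>\<^sup>1\<close> are made unique as total functions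
  by \<open>extensional\<close>.
\<close>

definition is_shuffle_regularization :: "(hoffman \<Rightarrow> real) \<Rightarrow> bool" where
  "is_shuffle_regularization Z \<longleftrightarrow>
     Z \<in> extensional hoffman1 \<and>
     (\<forall>u\<in>hoffman1. \<forall>v\<in>hoffman1. Z (u + v) = Z u + Z v) \<and>
     (\<forall>c. \<forall>u\<in>hoffman1. Z (scale_h c u) = of_rat c * Z u) \<and>
     Z 1 = 1 \<and>
     (\<forall>u\<in>hoffman1. \<forall>v\<in>hoffman1. Z (u \<squnion>\<squnion> v) = Z u * Z v) \<and>
     (\<forall>k. admissible k \<longrightarrow> Z (y_index k) = mzv k) \<and>
     Z x\<^sub>1 = 0"

definition zeta_sh :: "hoffman \<Rightarrow> real" where
  "zeta_sh = (THE Z. is_shuffle_regularization Z)"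

definition zeta_S_sh :: "nat list \<Rightarrow> real" where
  "zeta_S_sh k = (\<Sum>a\<le>length k. (- 1) ^ sum_list (take a k) *
     zeta_sh (y_index (rev (take a k))) * zeta_sh (y_index (drop a k)))"


section \<open>Residue classes modulo \<open>\<zeta>(2)\<Z>\<close>\<close>

text \<open>
  Since \<open>\<Omega>(k)\<close> is introduced as a limit of complex numbers, residue classes are taken
  in \<open>\<complex> / \<zeta>(2)\<Z>\<close>, which contains \<open>\<Z> / \<zeta>(2)\<Z>\<close>.
\<close>

definition zeta2_mzv :: "complex set" where
  "zeta2_mzv = {complex_of_real (mzv [2] * z) | z. z \<in> mzv_space}"

lemma zeta2_mzv_0: "0 \<in> zeta2_mzv"
  unfolding zeta2_mzv_def mzv_space_def by (force intro: rat_real.span_zero)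

lemma zeta2_mzv_add: "x \<in> zeta2_mzv \<Longrightarrow> y \<in> zeta2_mzv \<Longrightarrow> x + y \<in> zeta2_mzv"
proof -
  assume "x \<in> zeta2_mzv" "y \<in> zeta2_mzv"
  then obtain z z' where z: "z \<in> mzv_space" "x = complex_of_real (mzv [2] * z)"
    and z': "z' \<in> mzv_space" "y = complex_of_real (mzv [2] * z')"
    unfolding zeta2_mzv_def by blast
  have "z + z' \<in> mzv_space"
    using z(1) z'(1) unfolding mzv_space_def by (rule rat_real.span_add)
  moreover have "x + y = complex_of_real (mzv [2] * (z + z'))"
    unfolding z(2) z'(2) by (simp add: distrib_left)
  ultimately show ?thesis
    unfolding zeta2_mzv_def by blast
qed

lemma zeta2_mzv_scale: "x \<in> zeta2_mzv \<Longrightarrow> of_rat c * x \<in> zeta2_mzv"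
proof -
  assume "x \<in> zeta2_mzv"
  then obtain z where z: "z \<in> mzv_space" "x = complex_of_real (mzv [2] * z)"
    unfolding zeta2_mzv_def by blast
  have "of_rat c * z \<in> mzv_space"
    using z(1) unfolding mzv_space_def by (rule rat_real.span_scale)
  moreover have "of_rat c * x = complex_of_real (mzv [2] * (of_rat c * z))"
    unfolding z(2) by (cases c) (simp add: of_rat_rat)
  ultimately show ?thesis
    unfolding zeta2_mzv_def by blast
qed

lemma zeta2_mzv_uminus: "x \<in> zeta2_mzv \<Longrightarrow> - x \<in> zeta2_mzv"
  using zeta2_mzv_scale[of x "-1"] by simp

definition cong_zeta2 :: "complex \<Rightarrow> complex \<Rightarrow> bool" where
  "cong_zeta2 a b \<longleftrightarrow> a - b \<in> zeta2_mzv"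

quotient_type quot_S = complex / cong_zeta2
proof (rule equivpI)
  show "reflp cong_zeta2"
    by (simp add: reflp_def cong_zeta2_def zeta2_mzv_0)
  show "symp cong_zeta2"
    by (rule sympI, unfold cong_zeta2_def) (metis minus_diff_eq zeta2_mzv_uminus)
  show "transp cong_zeta2"
    by (rule transpI, unfold cong_zeta2_def) (metis diff_add_cancel add_diff_eq zeta2_mzv_add)
qed

instantiation quot_S :: ab_group_add
begin

lift_definition zero_quot_S :: quot_S is 0 .

lift_definition plus_quot_S :: "quot_S \<Rightarrow> quot_S \<Rightarrow> quot_S" is "(+)"
  unfolding cong_zeta2_def by (metis add_diff_add zeta2_mzv_add)

lift_definition uminus_quot_S :: "quot_S \<Rightarrow> quot_S" is uminus
  unfolding cong_zeta2_def by (metis minus_diff_minus zeta2_mzv_uminus)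

definition minus_quot_S :: "quot_S \<Rightarrow> quot_S \<Rightarrow> quot_S" where
  "minus_quot_S a b = a + - b"

instance
  by standard
    (simp add: minus_quot_S_def | transfer, simp add: cong_zeta2_def zeta2_mzv_0 algebra_simps)+

end

lift_definition scale_S :: "rat \<Rightarrow> quot_S \<Rightarrow> quot_S" is "\<lambda>c a. of_rat c * a"
  unfolding cong_zeta2_def by (simp flip: right_diff_distrib add: zeta2_mzv_scale)

lemma vector_space_scale_S: "vector_space scale_S"
  by standard
    (transfer, simp add: cong_zeta2_def zeta2_mzv_0 algebra_simps of_rat_add of_rat_mult)+

definition zeta_S_index :: "nat list \<Rightarrow> quot_S" where
  "zeta_S_index k = abs_quot_S (complex_of_real (zeta_S_sh k))"

definition zeta_S :: "hoffman \<Rightarrow> quot_S" where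
  "zeta_S = linear_extension scale_S zeta_S_index"


section \<open>The values \<open>\<Omega>(k)\<close>\<close>

definition q_int :: "complex \<Rightarrow> nat \<Rightarrow> complex" where
  "q_int q m = (1 - q ^ m) / (1 - q)"

definition omega_q :: "nat \<Rightarrow> nat list \<Rightarrow> complex \<Rightarrow> complex" where
  "omega_q n k q = (\<Sum>m \<in> compositions n (length k).
     \<Prod>a<length k. q ^ ((k ! a - 1) * m ! a) / q_int q (m ! a) ^ (k ! a))"

definition Omega :: "nat list \<Rightarrow> complex" where
  "Omega k = lim (\<lambda>n. omega_q n k (exp (2 * of_real pi * \<i> / of_nat n)))"

definition omega_S :: "nat list \<Rightarrow> quot_S" where
  "omega_S k = abs_quot_S (Omega k)"

end

theory Submission
  imports Defs "HOL-Real_Asymp.Real_Asymp"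
begin

text \<open>
  Attach to a word \<open>w\<close> the multiple polylogarithm \<open>Li w\<close> as a formal power series; it turns the shuffle
  product into the product of power series. The \<open>M\<close>-th coefficient of \<open>Li\<close> at
  \<open>x\<^sub>0\<^bsup>k\<^esup> (y\<^bsub>k\<^sub>1\<^esub> \<squnion>\<squnion> \<dots> \<squnion>\<squnion> y\<^bsub>k\<^sub>s\<^esub>)\<close> is the sum of \<open>M\<^sup>-\<^sup>k \<Prod> m\<^sub>a\<^bsup>- k\<^sub>a\<^esup>\<close> over the compositions
  \<open>m\<^sub>1 + \<dots> + m\<^sub>s = M\<close>. The first identity follows by eliminating \<open>m\<^sub>r = p - M\<close>
  modulo \<open>p\<close>.

  In a composition of \<open>n\<close> at most one part exceeds \<open>n / 2\<close>. Dominated convergence, applied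
  for each choice of the large part, gives
  \<open>\<Omega>(k) = \<Sum>\<^sub>a (-1)\<^bsup>k\<^sub>a\<^esup> \<zeta>(x\<^sub>0\<^bsup>k\<^sub>a\<^esup> \<squnion>\<squnion>\<^bsub>b \<noteq> a\<^esub> y\<^bsub>k\<^sub>b\<^esub>)\<close>. On the other side, \<open>\<zeta>\<^sub>\<S>\<close> is a signed sum over
  the ways to cut a word at a letter \<open>x\<^sub>1\<close>; for shuffles of the \<open>y\<^sub>k\<close> this sum telescopes in the
  shuffle algebra to the same expression, so that the second identity even holds for real
  numbers, before reducing modulo \<open>\<zeta>(2)\<Z>\<close>.
\<close>

text \<open>Both halves rest on one reflection: \<open>p - M\<close> is \<open>- M\<close> modulo
  \<open>p\<close>, and for \<open>q ^ n = 1\<close> the q-integer of \<open>n - M\<close> is that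
  of \<open>M\<close> up to the factor \<open>- q ^ (- M)\<close>; this is the source of the signs.
  Modulo \<open>p\<close> the reflection applies to the last part whatever its size. In the limit it
  is needed for the part that exceeds \<open>n / 2\<close>, since the lower bound of q-integers by a
  multiple of \<open>m\<close> is available only for \<open>m\<close> up to \<open>n / 2\<close>; so
  every part gets its turn and the result is a sum over \<open>a\<close>. Formal power series serve
  both worlds: sums truncated at \<open>p\<close> need coefficients only, and the limit needs
  convergence on h^0 only. \<open>zeta_sh\<close> is a definite description, so the regularization
  must first be shown to exist and to be unique. The halves of a cut word need not be admissible, so
  regularized values cannot be avoided in \<open>zeta_S\<close>; after telescoping only elements of
  h^0 remain, where \<open>zeta_sh\<close> is the convergent series.\<close>

lemma lookup_scale_h: "Poly_Mapping.lookup (scale_h c u) w = c * Poly_Mapping.lookup u w"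
  unfolding scale_h_def zero_list_def[symmetric] mult_map_scale_conv_mult[symmetric]
  by (simp add: Poly_Mapping.map.rep_eq when_def)

lemma vector_space_scale_h: "vector_space scale_h"
  by standard (rule poly_mapping_eqI, simp add: lookup_scale_h lookup_add algebra_simps)+

interpretation scale_h: vector_space scale_h
  by (rule vector_space_scale_h)

lemma scale_h_mult_left: "scale_h c u * v = scale_h c (u * v)"
  by (simp add: scale_h_def mult.assoc)

lemma scale_h_word: "scale_h c (word w) = Poly_Mapping.single w c"
  by (simp add: scale_h_def word_def mult_single plus_list_def)

text \<open>Linear statements need to be checked on multiples of words only; zero is covered as 0
  times the empty word.\<close>

lemma hoffman_induct [case_names word add]:
  assumes "\<And>c w. P (scale_h c (word w))" and "\<And>u v. P u \<Longrightarrow> P v \<Longrightarrow> P (u + v)"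
  shows "P u"
proof (induction u rule: update_induct)
  case const
  then show ?case using assms(1)[of 0 "[]"] by simp
next
  case (update u w c)
  have "Poly_Mapping.update w c u = u + scale_h c (word w)"
    using update.hyps by (intro poly_mapping_eqI)
      (auto simp: lookup_update lookup_add scale_h_word lookup_single in_keys_iff)
  then show ?case using assms update by metis
qed

text \<open>Scalars are central because they sit on the empty word, whereas \<open>scale_h\<close>
  is defined as multiplication from the left.\<close>

lemma scale_h_mult_right: "u * scale_h c v = scale_h c (u * v)"
proof (induction u rule: hoffman_induct)
  case (word d w)
  have "scale_h d (word w) * scale_h c v = Poly_Mapping.single w (d * c) * v"
    by (simp add: scale_h_word) (simp add: scale_h_def mult.assoc[symmetric] mult_single plus_list_def)
  also have "\<dots> = scale_h c (scale_h d (word w) * v)"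
    by (simp add: scale_h_word) (simp add: scale_h_def mult.assoc[symmetric] mult_single plus_list_def mult.commute)
  finally show ?case .
next
  case (add u v)
  then show ?case by (simp add: distrib_right scale_h.scale_right_distrib)
qed

text \<open>The scalar multiplication of the target is a parameter because such maps go into h
  itself, into power series and into both quotients.\<close>

definition lin :: "(rat \<Rightarrow> 'b \<Rightarrow> 'b) \<Rightarrow> (letter list \<Rightarrow> 'b) \<Rightarrow> hoffman \<Rightarrow> 'b::ab_group_add" where
  "lin sc f u = (\<Sum>w\<in>Poly_Mapping.keys u. sc (Poly_Mapping.lookup u w) (f w))"

context
  fixes sc :: "rat \<Rightarrow> 'b \<Rightarrow> 'b::ab_group_add"
  assumes sc: "vector_space sc"
begin

lemma lin_superset:
  assumes "finite A" "Poly_Mapping.keys u \<subseteq> A"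
  shows "lin sc f u = (\<Sum>w\<in>A. sc (Poly_Mapping.lookup u w) (f w))"
proof -
  interpret vector_space sc by (rule sc)
  show ?thesis
    unfolding lin_def using assms by (intro sum.mono_neutral_left) (auto simp: in_keys_iff)
qed

lemma lin_add: "lin sc f (u + v) = lin sc f u + lin sc f v"
proof -
  interpret vector_space sc by (rule sc)
  let ?A = "Poly_Mapping.keys u \<union> Poly_Mapping.keys v"
  have "lin sc f w = (\<Sum>x\<in>?A. sc (Poly_Mapping.lookup w x) (f x))" if "w \<in> {u, v, u + v}" for w
    using that Poly_Mapping.keys_add[of u v] by (intro lin_superset) auto
  then show ?thesis
    by (simp add: lookup_add scale_left_distrib sum.distrib)
qed

lemma lin_scale: "lin sc f (scale_h c u) = sc c (lin sc f u)"
proof -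
  interpret vector_space sc by (rule sc)
  have "lin sc f (scale_h c u) = (\<Sum>x\<in>Poly_Mapping.keys u. sc (Poly_Mapping.lookup (scale_h c u) x) (f x))"
    by (intro lin_superset) (auto simp: in_keys_iff lookup_scale_h)
  then show ?thesis
    by (simp add: lookup_scale_h lin_def scale_sum_right)
qed

lemma lin_word: "lin sc f (word w) = f w"
proof -
  interpret vector_space sc by (rule sc)
  show ?thesis by (simp add: lin_def word_def)
qed

lemma lin_0: "lin sc f 0 = 0"
  by (simp add: lin_def)

lemma lin_uminus: "lin sc f (- u) = - lin sc f u"
  by (metis lin_0 lin_add add.right_inverse minus_unique)

lemma lin_diff: "lin sc f (u - v) = lin sc f u - lin sc f v"
  using lin_add[of f u "- v"] by (simp add: lin_uminus)

lemma lin_sum: "lin sc f (sum g A) = (\<Sum>a\<in>A. lin sc f (g a))"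
  by (induction A rule: infinite_finite_induct) (simp_all add: lin_0 lin_add)

text \<open>Gives linearity of \<open>zeta_A\<close> and \<open>zeta_S\<close>: by injectivity of
  \<open>y_word\<close> the sum over indices becomes one over words, where words ending in x_0 have
  value 0.\<close>

lemma linear_extension_eq_lin:
  "linear_extension sc f = lin sc (\<lambda>w. if w \<in> y_word ` {k. is_index k} then f (inv_into {k. is_index k} y_word w) else 0)"
proof
  interpret vector_space sc by (rule sc)
  fix u
  let ?g = "\<lambda>w. f (inv_into {k. is_index k} y_word w)"
  have "lin sc (\<lambda>w. if w \<in> y_word ` {k. is_index k} then ?g w else 0) u
      = (\<Sum>w\<in>Poly_Mapping.keys u. if w \<in> y_word ` {k. is_index k} then sc (Poly_Mapping.lookup u w) (?g w) else 0)"
    unfolding lin_def by (intro sum.cong) auto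
  also have "\<dots> = (\<Sum>w\<in>y_word ` {k. is_index k \<and> y_word k \<in> Poly_Mapping.keys u}. sc (Poly_Mapping.lookup u w) (?g w))"
    by (subst sum.If_cases) (auto intro!: sum.cong)
  also have "\<dots> = linear_extension sc f u"
    unfolding linear_extension_def
    by (subst sum.reindex) (auto intro: inj_on_subset[OF inj_on_y_word] intro!: sum.cong simp: inv_into_f_f[OF inj_on_y_word])
  finally show "linear_extension sc f u = lin sc (\<lambda>w. if w \<in> y_word ` {k. is_index k} then ?g w else 0) u" ..
qed

end

section \<open>The shuffle product\<close>

lemmas lin_h = lin_add[OF vector_space_scale_h] lin_scale[OF vector_space_scale_h]
  lin_word[OF vector_space_scale_h] lin_0[OF vector_space_scale_h]
  lin_diff[OF vector_space_scale_h] lin_uminus[OF vector_space_scale_h]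
  lin_sum[OF vector_space_scale_h]

lemma shuffle_eq_lin: "f \<squnion>\<squnion> g = lin scale_h (\<lambda>v. lin scale_h (shuffle_word v) g) f"
  by (simp add: shuffle_def lin_def scale_h.scale_sum_right)

lemma shuffle_add_left: "(f + g) \<squnion>\<squnion> h = (f \<squnion>\<squnion> h) + (g \<squnion>\<squnion> h)"
  and shuffle_scale_left: "scale_h c f \<squnion>\<squnion> h = scale_h c (f \<squnion>\<squnion> h)"
  and shuffle_word_word: "word v \<squnion>\<squnion> word w = shuffle_word v w"
  by (simp_all add: shuffle_eq_lin lin_h)

lemma shuffle_add_right: "h \<squnion>\<squnion> (f + g) = (h \<squnion>\<squnion> f) + (h \<squnion>\<squnion> g)"
  by (induction h rule: hoffman_induct)
    (simp_all add: shuffle_add_left shuffle_scale_left, simp add: shuffle_eq_lin lin_h scale_h.scale_right_distrib)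

lemma shuffle_scale_right: "h \<squnion>\<squnion> scale_h c f = scale_h c (h \<squnion>\<squnion> f)"
  by (induction h rule: hoffman_induct)
    (simp_all add: shuffle_add_left shuffle_scale_left scale_h.scale_right_distrib, simp add: shuffle_eq_lin lin_h mult.commute)

lemma word_Cons: "word (a # w) = word [a] * word w"
  by (simp flip: word_append)

lemma shuffle_0: "0 \<squnion>\<squnion> f = 0" "f \<squnion>\<squnion> 0 = 0"
  using shuffle_scale_left[of 0 0 f] shuffle_scale_right[of f 0 0] by simp_all

lemma shuffle_word_Nil_right: "shuffle_word w [] = word w"
  by (cases w) auto

lemma shuffle_word_commute: "shuffle_word v w = shuffle_word w v"
  by (induction v w rule: shuffle_word.induct) (simp_all add: shuffle_word_Nil_right add.commute)

lemma shuffle_commute: "f \<squnion>\<squnion> g = g \<squnion>\<squnion> f"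
proof (induction f rule: hoffman_induct)
  case (word c v)
  have "word v \<squnion>\<squnion> g = g \<squnion>\<squnion> word v"
    by (induction g rule: hoffman_induct)
      (simp_all add: shuffle_add_right shuffle_add_left shuffle_scale_left shuffle_scale_right
        shuffle_word_word shuffle_word_commute[of v])
  then show ?case by (simp add: shuffle_scale_left shuffle_scale_right)
qed (simp add: shuffle_add_right shuffle_add_left)

lemma shuffle_1_left: "1 \<squnion>\<squnion> f = f"
  by (induction f rule: hoffman_induct)
    (simp_all add: shuffle_add_right shuffle_scale_right shuffle_word_word flip: word_Nil)

lemma shuffle_Cons_Cons:
  "(word [a] * f) \<squnion>\<squnion> (word [b] * g) = word [a] * (f \<squnion>\<squnion> (word [b] * g)) + word [b] * ((word [a] * f) \<squnion>\<squnion> g)"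
proof (induction f rule: hoffman_induct)
  case (word c v)
  have "(word [a] * word v) \<squnion>\<squnion> (word [b] * g) =
      word [a] * (word v \<squnion>\<squnion> (word [b] * g)) + word [b] * ((word [a] * word v) \<squnion>\<squnion> g)"
    by (induction g rule: hoffman_induct)
      (simp_all add: shuffle_add_right shuffle_scale_right scale_h_mult_right
        shuffle_word_word distrib_left scale_h.scale_right_distrib flip: word_append)
  then show ?case
    by (simp add: scale_h_mult_right shuffle_scale_left scale_h.scale_right_distrib)
qed (simp add: shuffle_add_left distrib_left)

lemma shuffle_assoc: "(f \<squnion>\<squnion> g) \<squnion>\<squnion> h = f \<squnion>\<squnion> (g \<squnion>\<squnion> h)"
proof -
  have words: "(word u \<squnion>\<squnion> word v) \<squnion>\<squnion> word w = word u \<squnion>\<squnion> (word v \<squnion>\<squnion> word w)" for u v w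
  proof (induction "length u + length v + length w" arbitrary: u v w rule: less_induct)
    case less
    show ?case
    proof (cases "u = [] \<or> v = [] \<or> w = []")
      case True
      then show ?thesis by (auto simp: word_Nil shuffle_1_left shuffle_commute[of _ 1])
    next
      case False
      then obtain a u' b v' c w' where eq: "u = a # u'" "v = b # v'" "w = c # w'"
        by (metis list.exhaust)
      \<comment> \<open>Both sides have one term for each first letter: the two terms starting with
        \<open>c\<close> on the left merge, as do the two starting with \<open>a\<close> on the
        right.\<close>
      show ?thesis
        using less[of u' v w] less[of u v' w] less[of u v w'] unfolding eq
        by (simp add: word_Cons[of _ u'] word_Cons[of _ v'] word_Cons[of _ w'] shuffle_Cons_Cons
            shuffle_add_left shuffle_add_right distrib_left add_ac)
          (simp flip: distrib_left)
    qed
  qed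
  have words2: "(word u \<squnion>\<squnion> word v) \<squnion>\<squnion> h = word u \<squnion>\<squnion> (word v \<squnion>\<squnion> h)" for u v
    by (induction h rule: hoffman_induct) (simp_all add: shuffle_add_right shuffle_scale_right words)
  have words1: "(word u \<squnion>\<squnion> g) \<squnion>\<squnion> h = word u \<squnion>\<squnion> (g \<squnion>\<squnion> h)" for u
    by (induction g rule: hoffman_induct)
      (simp_all add: shuffle_add_right shuffle_scale_right shuffle_add_left shuffle_scale_left words2)
  show ?thesis
    by (induction f rule: hoffman_induct) (simp_all add: shuffle_add_left shuffle_scale_left words1)
qed

interpretation shuffle: Groups.comm_monoid shuffle 1
  by standard (auto simp: shuffle_assoc shuffle_1_left shuffle_commute[of _ 1] intro: shuffle_commute)

section \<open>The subalgebra \<open>\<hh>\<^sup>1\<close>\<close>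

text \<open>The left ideal h x_1, which is h^1 without constants. It is stable under left
  multiplication by any element, while h^1 is not: x_0 itself is outside h^1.\<close>

definition hoffman1_pos :: "hoffman set" where
  "hoffman1_pos = range (\<lambda>u. u * x\<^sub>1)"

lemma hoffman1_pos_add: "u \<in> hoffman1_pos \<Longrightarrow> v \<in> hoffman1_pos \<Longrightarrow> u + v \<in> hoffman1_pos"
  unfolding hoffman1_pos_def by (auto simp flip: distrib_right)

lemma hoffman1_pos_mult: "u \<in> hoffman1_pos \<Longrightarrow> v * u \<in> hoffman1_pos"
  unfolding hoffman1_pos_def by (auto simp flip: mult.assoc)

lemma hoffman1_pos_scale: "u \<in> hoffman1_pos \<Longrightarrow> scale_h c u \<in> hoffman1_pos"
  unfolding scale_h_def by (rule hoffman1_pos_mult)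

lemma hoffman1_pos_word: "w \<noteq> [] \<Longrightarrow> last w = L1 \<Longrightarrow> word w \<in> hoffman1_pos"
  unfolding hoffman1_pos_def 
  by (rule range_eqI[of _ _ "word (butlast w)"]) (simp flip: word_append, metis append_butlast_last_id)

lemma hoffman1_eq: "hoffman1 = {scale_h c 1 + u | c u. u \<in> hoffman1_pos}"
  unfolding hoffman1_def hoffman1_pos_def by auto

lemma hoffman1_pos_subset: "u \<in> hoffman1_pos \<Longrightarrow> u \<in> hoffman1"
  unfolding hoffman1_eq by (rule CollectI, rule exI[of _ 0]) auto

lemma hoffman1_one: "1 \<in> hoffman1"
  unfolding hoffman1_def by (rule CollectI, rule exI[of _ 1], rule exI[of _ 0]) simp

lemma hoffman1_add: "u \<in> hoffman1 \<Longrightarrow> v \<in> hoffman1 \<Longrightarrow> u + v \<in> hoffman1"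
proof -
  assume "u \<in> hoffman1" "v \<in> hoffman1"
  then obtain c u' d v' where "u = scale_h c 1 + u'" "v = scale_h d 1 + v'"
    "u' \<in> hoffman1_pos" "v' \<in> hoffman1_pos" unfolding hoffman1_eq by blast
  then have "u + v = scale_h (c + d) 1 + (u' + v')" "u' + v' \<in> hoffman1_pos"
    by (simp_all add: scale_h.scale_left_distrib algebra_simps hoffman1_pos_add)
  then show ?thesis unfolding hoffman1_eq by (intro CollectI exI conjI)
qed

lemma hoffman1_scale: "u \<in> hoffman1 \<Longrightarrow> scale_h d u \<in> hoffman1"
proof -
  assume "u \<in> hoffman1"
  then obtain c u' where "u = scale_h c 1 + u'" "u' \<in> hoffman1_pos"
    unfolding hoffman1_eq by blast
  then have "scale_h d u = scale_h (d * c) 1 + scale_h d u'" "scale_h d u' \<in> hoffman1_pos"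
    by (simp_all add: scale_h.scale_right_distrib hoffman1_pos_scale)
  then show ?thesis unfolding hoffman1_eq by (intro CollectI exI conjI)
qed

lemma hoffman1_0: "0 \<in> hoffman1"
  using hoffman1_scale[OF hoffman1_one, of 0] by simp

lemma hoffman1_uminus: "u \<in> hoffman1 \<Longrightarrow> - u \<in> hoffman1"
  using hoffman1_scale[of u "-1"] by simp

lemma hoffman1_diff: "u \<in> hoffman1 \<Longrightarrow> v \<in> hoffman1 \<Longrightarrow> u - v \<in> hoffman1"
  using hoffman1_add[of u "- v"] by (simp add: hoffman1_uminus)

lemma hoffman1_sum: "(\<And>a. a \<in> A \<Longrightarrow> f a \<in> hoffman1) \<Longrightarrow> sum f A \<in> hoffman1"
  by (induction A rule: infinite_finite_induct) (auto simp: hoffman1_0 hoffman1_add)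

definition word1 :: "letter list \<Rightarrow> bool" where
  "word1 w \<longleftrightarrow> w = [] \<or> last w = L1"

lemma word1_ConsD: "word1 (a # w) \<Longrightarrow> word1 w"
  by (auto simp: word1_def split: if_splits)

lemma hoffman1_word: "word1 w \<Longrightarrow> word w \<in> hoffman1"
  by (cases "w = []") (auto simp: word1_def word_Nil hoffman1_one intro: hoffman1_pos_subset hoffman1_pos_word)

text \<open>The step for sums keeps membership, because \<open>zeta_sh\<close> and similar maps are
  known to be additive on h^1 only.\<close>

lemma hoffman1_induct [consumes 1, case_names word add]:
  assumes "u \<in> hoffman1" "\<And>c w. word1 w \<Longrightarrow> P (scale_h c (word w))"
    and add: "\<And>u v. u \<in> hoffman1 \<Longrightarrow> v \<in> hoffman1 \<Longrightarrow> P u \<Longrightarrow> P v \<Longrightarrow> P (u + v)"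
  shows "P u"
proof -
  obtain c v where u: "u = scale_h c 1 + v * x\<^sub>1"
    using assms(1) unfolding hoffman1_def by auto
  have 1: "v * x\<^sub>1 \<in> hoffman1" for v
    by (simp add: hoffman1_pos_def hoffman1_pos_subset)
  have "P (v * x\<^sub>1)"
    by (induction v rule: hoffman_induct)
      (simp_all add: scale_h_mult_left distrib_right add 1 assms(2) word1_def flip: word_append)
  moreover have "P (scale_h c 1)"
    using assms(2)[of "[]" c] by (simp add: word1_def word_Nil)
  ultimately show ?thesis
    unfolding u by (intro add) (auto simp: 1 hoffman1_scale hoffman1_one)
qed

text \<open>Every word in a shuffle ends with the last letter of one of the factors.\<close>

lemma shuffle_word_pos:
  assumes "word1 v" "word1 w" "v \<noteq> [] \<or> w \<noteq> []"
  shows "shuffle_word v w \<in> hoffman1_pos"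
  using assms
proof (induction v w rule: shuffle_word.induct)
  case (3 a v b w)
  then show ?case
    by (auto intro!: hoffman1_pos_add hoffman1_pos_mult dest: word1_ConsD)
qed (auto simp: word1_def intro: hoffman1_pos_word)

lemma hoffman1_shuffle:
  assumes "u \<in> hoffman1" "v \<in> hoffman1"
  shows "u \<squnion>\<squnion> v \<in> hoffman1"
  using assms(1)
proof (induction u rule: hoffman1_induct)
  case (word c x)
  from assms(2) show ?case
  proof (induction v rule: hoffman1_induct)
    case (word d y)
    have "shuffle_word x y \<in> hoffman1"
    proof (cases "x = [] \<and> y = []")
      case True
      then show ?thesis by (simp add: word_Nil hoffman1_one)
    next
      case False
      then show ?thesis
        using shuffle_word_pos \<open>word1 x\<close> \<open>word1 y\<close> by (intro hoffman1_pos_subset) auto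
    qed
    then show ?case
      by (simp add: shuffle_scale_left shuffle_scale_right shuffle_word_word hoffman1_scale)
  qed (simp add: shuffle_add_right hoffman1_add)
qed (simp add: shuffle_add_left hoffman1_add)

section \<open>Words ending in x_1 and indices\<close>

lemma word1_y_word: "word1 (y_word k)"
  by (induction k) (auto simp: y_word_def word1_def)

lemma y_word_Nil: "y_word [] = []"
  by (simp add: y_word_def)

lemma y_word_Cons: "y_word (a # k) = replicate (a - 1) L0 @ L1 # y_word k"
  by (simp add: y_word_def)

lemma y_index_hoffman1: "y_index k \<in> hoffman1"
  by (simp add: y_index_eq_word hoffman1_word word1_y_word)

lemma word1_obtain_index:
  assumes "word1 w"
  obtains k where "is_index k" "w = y_word k"
proof -
  have "\<exists>k. is_index k \<and> w = y_word k" using assms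
  proof (induction w)
    case Nil
    then show ?case by (intro exI[of _ "[]"]) (simp add: is_index_def y_word_Nil)
  next
    case (Cons a w)
    then obtain k where k: "is_index k" "w = y_word k"
      using word1_ConsD by blast
    show ?case
    proof (cases a)
      case L1
      then show ?thesis
        using k by (intro exI[of _ "1 # k"]) (simp add: is_index_def y_word_Cons)
    next
      case L0
      then obtain b l where l: "k = b # l"
        using k Cons.prems by (cases k) (auto simp: word1_def y_word_Nil)
      then have "L0 # w = y_word (Suc b # l)"
        using k by (cases b) (auto simp: y_word_Cons is_index_def)
      moreover have "is_index (Suc b # l)"
        using k l by (simp add: is_index_def)
      ultimately show ?thesis using L0 by blast
    qed
  qed
  then show ?thesis using that by blast
qed

section \<open>Left derivatives\<close>

definition dl :: "letter \<Rightarrow> hoffman \<Rightarrow> hoffman" where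
  "dl a = lin scale_h (\<lambda>w. case w of [] \<Rightarrow> 0 | b # v \<Rightarrow> if b = a then word v else 0)"

lemma dl_linear:
  "dl a (u + v) = dl a u + dl a v" "dl a (scale_h c u) = scale_h c (dl a u)" "dl a 0 = 0"
  "dl a (u - v) = dl a u - dl a v" "dl a (- u) = - dl a u" "dl a (sum f A) = (\<Sum>x\<in>A. dl a (f x))"
  by (simp_all add: dl_def lin_h)

lemma dl_word: "dl a (word (b # w)) = (if b = a then word w else 0)" "dl a (word []) = 0" "dl a 1 = 0"
  by (simp_all add: dl_def lin_h flip: word_Nil)

lemma dl_mult: "dl a (word [b] * u) = (if b = a then u else 0)"
  by (induction u rule: hoffman_induct)
    (simp_all add: scale_h_mult_right distrib_left dl_linear dl_word flip: word_Cons)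

text \<open>The first letter of a shuffle comes from exactly one of the two factors. So
  \<open>dl a\<close> is a derivation for the shuffle product, although under concatenation it sees
  only the first letter.\<close>

lemma dl_shuffle: "dl a (u \<squnion>\<squnion> v) = (dl a u \<squnion>\<squnion> v) + (u \<squnion>\<squnion> dl a v)"
proof (induction u rule: hoffman_induct)
  case (word c x)
  show ?case
  proof (induction v rule: hoffman_induct)
    case (word d y)
    have "dl a (word x \<squnion>\<squnion> word y) = (dl a (word x) \<squnion>\<squnion> word y) + (word x \<squnion>\<squnion> dl a (word y))"
    proof (cases "x = [] \<or> y = []")
      case True
      then show ?thesis
        by (auto simp: word_Nil dl_word shuffle_0 shuffle_1_left)
    next
      case False
      then obtain b x' c y' where "x = b # x'" "y = c # y'" by (metis list.exhaust)
      then show ?thesis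
        by (simp add: word_Cons[of _ x'] word_Cons[of _ y'] shuffle_Cons_Cons dl_linear dl_mult shuffle_0)
    qed
    then show ?case
      by (simp add: shuffle_scale_left shuffle_scale_right dl_linear scale_h.scale_right_distrib)
  qed (simp add: shuffle_add_right dl_linear)
qed (simp add: shuffle_add_left dl_linear)

lemma dl_hoffman1: "u \<in> hoffman1 \<Longrightarrow> dl a u \<in> hoffman1"
proof (induction u rule: hoffman1_induct)
  case (word c w)
  then show ?case
    by (cases w) (auto simp: dl_linear dl_word hoffman1_0 dest: word1_ConsD intro: hoffman1_scale hoffman1_word)
qed (simp add: dl_linear hoffman1_add)

lemma hoffman_decomp:
  obtains c where "u = scale_h c 1 + x\<^sub>0 * dl L0 u + x\<^sub>1 * dl L1 u"
proof -
  have "\<exists>c. u = scale_h c 1 + x\<^sub>0 * dl L0 u + x\<^sub>1 * dl L1 u"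
  proof (induction u rule: hoffman_induct)
    case (word c w)
    show ?case
    proof (cases w)
      case Nil
      then show ?thesis by (intro exI[of _ c]) (simp add: dl_linear dl_word word_Nil)
    next
      case (Cons a v)
      then show ?thesis
        by (intro exI[of _ 0], cases a)
          (simp_all add: dl_linear dl_mult scale_h_mult_right word_Cons[of _ v])
    qed
  next
    case (add u v)
    then obtain c d where c: "u = scale_h c 1 + x\<^sub>0 * dl L0 u + x\<^sub>1 * dl L1 u"
      and d: "v = scale_h d 1 + x\<^sub>0 * dl L0 v + x\<^sub>1 * dl L1 v" by blast
    show ?case
      \<comment> \<open>\<open>u\<close> and \<open>v\<close> occur on both sides of these
        equations, so they are applied once by transitivity and not as rewrite rules.\<close>
      by (rule exI[of _ "c + d"], rule trans[OF arg_cong2[OF c d, of "(+)"]])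
        (simp add: dl_linear distrib_left scale_h.scale_left_distrib)
  qed
  then show ?thesis using that by blast
qed

section \<open>Shuffle regularization\<close>

lemma shuffle_sum_left: "sum f A \<squnion>\<squnion> g = (\<Sum>a\<in>A. f a \<squnion>\<squnion> g)"
  by (induction A rule: infinite_finite_induct) (simp_all add: shuffle_0 shuffle_add_left)

lemma shuffle_sum_right: "g \<squnion>\<squnion> sum f A = (\<Sum>a\<in>A. g \<squnion>\<squnion> f a)"
  by (induction A rule: infinite_finite_induct) (simp_all add: shuffle_0 shuffle_add_right)

abbreviation x1_pow :: "nat \<Rightarrow> hoffman" where
  "x1_pow n \<equiv> word (replicate n L1)"

lemma x1_pow_hoffman1: "x1_pow n \<in> hoffman1"
  by (rule hoffman1_word) (cases n; simp add: word1_def last_replicate)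

lemma x1_pow_Suc: "x1_pow (Suc n) = x\<^sub>1 * x1_pow n"
  by (simp add: word_Cons[of _ "replicate n L1"])

text \<open>The words in x_1 alone are the divided powers of x_1 for the shuffle product; the
  binomial coefficient counts the positions taken by the left factor.\<close>

lemma x1_pow_shuffle: "x1_pow m \<squnion>\<squnion> x1_pow n = scale_h (of_nat (m + n choose m)) (x1_pow (m + n))"
proof (induction "m + n" arbitrary: m n)
  case 0
  then show ?case by (simp add: word_Nil)
next
  case (Suc s)
  show ?case
  proof (cases "m = 0 \<or> n = 0")
    case True
    then show ?thesis by (auto simp: word_Nil)
  next
    case False
    then obtain m' n' where mn: "m = Suc m'" "n = Suc n'"
      by (metis not0_implies_Suc)
    have "x1_pow m \<squnion>\<squnion> x1_pow n = x\<^sub>1 * (x1_pow m' \<squnion>\<squnion> x1_pow n) + x\<^sub>1 * (x1_pow m \<squnion>\<squnion> x1_pow n')"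
      unfolding mn x1_pow_Suc by (rule shuffle_Cons_Cons)
    also have "\<dots> = scale_h (of_nat (m' + n choose m') + of_nat (m + n' choose m)) (x\<^sub>1 * x1_pow (m' + n))"
      using Suc.hyps(1)[of m' n] Suc.hyps(1)[of m n'] Suc.hyps(2) mn
      by (simp add: scale_h_mult_right scale_h.scale_left_distrib distrib_left)
    also have "\<dots> = scale_h (of_nat (m + n choose m)) (x1_pow (m + n))"
      using mn by (simp flip: word_Cons)
    finally show ?thesis .
  qed
qed

abbreviation dl1_pow :: "nat \<Rightarrow> hoffman \<Rightarrow> hoffman" where
  "dl1_pow n \<equiv> dl L1 ^^ n"

lemma dl1_pow_linear:
  "dl1_pow n (u + v) = dl1_pow n u + dl1_pow n v" "dl1_pow n (scale_h c u) = scale_h c (dl1_pow n u)"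
  "dl1_pow n 0 = 0"
  by (induction n) (simp_all add: dl_linear)

lemma dl1_pow_hoffman1: "u \<in> hoffman1 \<Longrightarrow> dl1_pow n u \<in> hoffman1"
  by (induction n) (simp_all add: dl_hoffman1)

lemma dl1_pow_word: "length w < n \<Longrightarrow> dl1_pow n (word w) = 0"
proof (induction w arbitrary: n)
  case Nil
  then show ?case by (cases n) (simp_all add: dl_word dl1_pow_linear funpow_Suc_right del: funpow.simps)
next
  case (Cons a w)
  then show ?case by (cases n) (simp_all add: dl_word dl1_pow_linear funpow_Suc_right del: funpow.simps)
qed

lemma dl1_pow_shuffle:
  "dl1_pow n (u \<squnion>\<squnion> v) = (\<Sum>i\<le>n. scale_h (of_nat (n choose i)) (dl1_pow i u \<squnion>\<squnion> dl1_pow (n - i) v))"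
proof (induction n)
  case 0
  then show ?case by simp
next
  case (Suc n)
  let ?f = "\<lambda>i j. dl1_pow i u \<squnion>\<squnion> dl1_pow j v"
  have "dl1_pow (Suc n) (u \<squnion>\<squnion> v) =
      (\<Sum>i\<le>n. scale_h (of_nat (n choose i)) (?f (Suc i) (n - i))) +
      (\<Sum>i\<le>n. scale_h (of_nat (n choose i)) (?f i (Suc (n - i))))"
    by (simp add: Suc dl_linear dl_shuffle scale_h.scale_right_distrib sum.distrib)
  \<comment> \<open>The added term \<open>i = Suc n\<close> has binomial coefficient 0; with it the
    two sums combine by Pascal's rule after an index shift.\<close>
  also have "(\<Sum>i\<le>n. scale_h (of_nat (n choose i)) (?f i (Suc (n - i)))) =
      (\<Sum>i\<le>Suc n. scale_h (of_nat (n choose i)) (?f i (Suc n - i)))"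
    by (simp add: Suc_diff_le binomial_eq_0)
  also have "\<dots> = ?f 0 (Suc n) + (\<Sum>i\<le>n. scale_h (of_nat (n choose Suc i)) (?f (Suc i) (n - i)))"
    by (subst sum.atMost_Suc_shift) simp
  also have "(\<Sum>i\<le>n. scale_h (of_nat (n choose i)) (?f (Suc i) (n - i))) + \<dots> =
      ?f 0 (Suc n) + (\<Sum>i\<le>n. scale_h (of_nat (Suc n choose Suc i)) (?f (Suc i) (n - i)))"
    by (simp add: scale_h.scale_left_distrib sum.distrib)
  also have "\<dots> = (\<Sum>i\<le>Suc n. scale_h (of_nat (Suc n choose i)) (?f i (Suc n - i)))"
    by (subst sum.atMost_Suc_shift[of _ n]) simp
  finally show ?case .
qed

text \<open>The \<open>n\<close>-th term of an exponential series. The division by the factorial is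
  built in, \<open>x1_pow n\<close> being a divided power.\<close>

definition reg_part :: "nat \<Rightarrow> hoffman \<Rightarrow> hoffman" where
  "reg_part n u = scale_h ((-1) ^ n) (x1_pow n \<squnion>\<squnion> dl1_pow n u)"

lemma reg_part_linear:
  "reg_part n (u + v) = reg_part n u + reg_part n v" "reg_part n (scale_h c u) = scale_h c (reg_part n u)"
  by (simp_all add: reg_part_def dl1_pow_linear shuffle_add_right shuffle_scale_right
    scale_h.scale_right_distrib mult.commute)

text \<open>
  With \<open>\<partial>\<close> the derivation removing a leading \<open>x\<^sub>1\<close>, this is \<open>exp (- x\<^sub>1 \<partial>)\<close>; it is a
  homomorphism because \<open>\<partial>\<close> is a derivation, and it maps to the kernel of \<open>\<partial>\<close> because \<open>\<partial> x\<^sub>1 = 1\<close>.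
\<close>

definition reg :: "hoffman \<Rightarrow> hoffman" where
  "reg = lin scale_h (\<lambda>w. \<Sum>n\<le>length w. reg_part n (word w))"

lemma reg_linear:
  "reg (u + v) = reg u + reg v" "reg (scale_h c u) = scale_h c (reg u)"
  by (simp_all add: reg_def lin_h)

text \<open>The derivation is locally nilpotent, so the series may be cut off anywhere beyond a
  bound. This gives two elements a common cutoff although words of different lengths come with
  different ones.\<close>

lemma reg_eq_sum:
  obtains N where "\<And>n. n > N \<Longrightarrow> dl1_pow n u = 0" "\<And>M. M \<ge> N \<Longrightarrow> reg u = (\<Sum>n\<le>M. reg_part n u)"
proof -
  have "\<exists>N. (\<forall>n>N. dl1_pow n u = 0) \<and> (\<forall>M\<ge>N. reg u = (\<Sum>n\<le>M. reg_part n u))"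
  proof (induction u rule: hoffman_induct)
    case (word c w)
    have "(\<Sum>n\<le>length w. reg_part n (word w)) = (\<Sum>n\<le>M. reg_part n (word w))" if "M \<ge> length w" for M
      using that by (intro sum.mono_neutral_left) (auto simp: reg_part_def dl1_pow_word shuffle_0)
    then show ?case
      by (intro exI[of _ "length w"])
        (auto simp: dl1_pow_linear dl1_pow_word reg_def lin_h reg_part_linear simp flip: scale_h.scale_sum_right)
  next
    case (add u v)
    then obtain A B where "\<And>n. n > A \<Longrightarrow> dl1_pow n u = 0" "\<And>M. M \<ge> A \<Longrightarrow> reg u = (\<Sum>n\<le>M. reg_part n u)"
      "\<And>n. n > B \<Longrightarrow> dl1_pow n v = 0" "\<And>M. M \<ge> B \<Longrightarrow> reg v = (\<Sum>n\<le>M. reg_part n v)" by metis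
    then show ?case
      by (intro exI[of _ "max A B"]) (auto simp: dl1_pow_linear reg_part_linear reg_linear sum.distrib)
  qed
  then show ?thesis using that by blast
qed

lemma reg_hoffman1: "u \<in> hoffman1 \<Longrightarrow> reg u \<in> hoffman1"
  using reg_eq_sum[of u]
  by (metis reg_part_def hoffman1_sum hoffman1_scale hoffman1_shuffle x1_pow_hoffman1 dl1_pow_hoffman1 order_refl)

lemma dl_reg: "dl L1 (reg u) = 0"
proof -
  obtain N where N: "\<And>n. n > N \<Longrightarrow> dl1_pow n u = 0" "\<And>M. M \<ge> N \<Longrightarrow> reg u = (\<Sum>n\<le>M. reg_part n u)"
    by (rule reg_eq_sum[of u]) blast
  \<comment> \<open>The derivative of a partial sum telescopes to its last term, which vanishes at
    the nilpotency bound.\<close>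
  have "dl L1 (\<Sum>n\<le>M. reg_part n u) = scale_h ((-1) ^ M) (x1_pow M \<squnion>\<squnion> dl1_pow (Suc M) u)" for M
  proof (induction M)
    case 0
    then show ?case by (simp add: reg_part_def word_Nil)
  next
    case (Suc M)
    have "dl L1 (x1_pow (Suc M)) = x1_pow M"
      by (simp add: dl_word)
    then show ?case
      using Suc by (simp add: dl_linear reg_part_def dl_shuffle scale_h.scale_right_distrib del: replicate.simps)
  qed
  from this[of N] show ?thesis using N(1)[of "Suc N"] N(2)[of N] by (simp add: shuffle_0)
qed

lemma reg_eq_self: "dl L1 u = 0 \<Longrightarrow> reg u = u"
proof -
  assume u: "dl L1 u = 0"
  obtain N where N: "\<And>M. M \<ge> N \<Longrightarrow> reg u = (\<Sum>n\<le>M. reg_part n u)"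
    by (rule reg_eq_sum[of u]) blast
  have "dl1_pow (Suc n) u = 0" for n
    by (simp only: funpow_Suc_right o_def u dl1_pow_linear)
  then have "reg_part n u = (if n = 0 then u else 0)" for n
    by (cases n) (simp_all only: reg_part_def, simp_all add: word_Nil shuffle_0)
  then show ?thesis using N[of N] by simp
qed

lemma reg_x1: "reg x\<^sub>1 = 0"
  by (simp add: reg_def lin_h reg_part_def dl_word word_Nil)

lemma reg_shuffle: "reg (u \<squnion>\<squnion> v) = reg u \<squnion>\<squnion> reg v"
proof -
  obtain A where A: "\<And>n. n > A \<Longrightarrow> dl1_pow n u = 0" "\<And>M. M \<ge> A \<Longrightarrow> reg u = (\<Sum>n\<le>M. reg_part n u)"
    by (rule reg_eq_sum[of u]) blast
  obtain B where B: "\<And>n. n > B \<Longrightarrow> dl1_pow n v = 0" "\<And>M. M \<ge> B \<Longrightarrow> reg v = (\<Sum>n\<le>M. reg_part n v)"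
    by (rule reg_eq_sum[of v]) blast
  obtain N where N: "\<And>M. M \<ge> N \<Longrightarrow> reg (u \<squnion>\<squnion> v) = (\<Sum>n\<le>M. reg_part n (u \<squnion>\<squnion> v))"
    by (rule reg_eq_sum[of "u \<squnion>\<squnion> v"]) blast
  let ?f = "\<lambda>i j. reg_part i u \<squnion>\<squnion> reg_part j v"
  \<comment> \<open>Large enough for the triangle \<open>i + j \<le> M\<close> to contain the
    rectangle given by \<open>A\<close> and \<open>B\<close>, outside of which all terms
    vanish.\<close>
  define M where "M = N + A + B"
  have part: "reg_part n (u \<squnion>\<squnion> v) = (\<Sum>i\<le>n. ?f i (n - i))" for n
  proof -
    have "reg_part n (u \<squnion>\<squnion> v) = (\<Sum>i\<le>n. scale_h ((-1) ^ n)
        (scale_h (of_nat (n choose i)) (x1_pow n) \<squnion>\<squnion> (dl1_pow i u \<squnion>\<squnion> dl1_pow (n - i) v)))"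
      by (simp add: reg_part_def dl1_pow_shuffle shuffle_sum_right shuffle_scale_right shuffle_scale_left scale_h.scale_sum_right)
    also have "\<dots> = (\<Sum>i\<le>n. ?f i (n - i))"
    proof (rule sum.cong[OF refl])
      fix i assume i: "i \<in> {..n}"
      \<comment> \<open>The binomial coefficient of the Leibniz rule is exactly what turns
        \<open>x1_pow n\<close> into a product of two divided powers.\<close>
      then have s: "(-1 :: rat) ^ n = (-1) ^ i * (-1) ^ (n - i)" "scale_h (of_nat (n choose i)) (x1_pow n) = x1_pow i \<squnion>\<squnion> x1_pow (n - i)"
        by (simp_all add: x1_pow_shuffle flip: power_add)
      show "scale_h ((-1) ^ n) (scale_h (of_nat (n choose i)) (x1_pow n) \<squnion>\<squnion> (dl1_pow i u \<squnion>\<squnion> dl1_pow (n - i) v)) = ?f i (n - i)"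
        unfolding s by (simp add: reg_part_def shuffle_scale_left shuffle_scale_right shuffle.assoc shuffle.left_commute)
    qed
    finally show ?thesis .
  qed
  have "reg (u \<squnion>\<squnion> v) = (\<Sum>n\<le>M. \<Sum>i\<le>n. ?f i (n - i))"
    using N[of M] by (simp add: M_def part)
  also have "\<dots> = (\<Sum>(i, j) \<in> {(i, j). i + j \<le> M}. ?f i j)"
    by (rule sum.triangle_reindex_eq[symmetric])
  also have "\<dots> = (\<Sum>(i, j) \<in> {..A} \<times> {..B}. ?f i j)"
  proof (rule sum.mono_neutral_right)
    show "finite {(i, j). i + j \<le> M}"
      by (rule finite_subset[of _ "{..M} \<times> {..M}"]) auto
    show "\<forall>x\<in>{(i, j). i + j \<le> M} - {..A} \<times> {..B}. (case x of (i, j) \<Rightarrow> ?f i j) = 0"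
    proof (intro ballI, unfold split_paired_all prod.case)
      fix i j assume "(i, j) \<in> {(i, j). i + j \<le> M} - {..A} \<times> {..B}"
      then consider "i > A" | "j > B" by fastforce
      then show "?f i j = 0" by cases (simp_all add: reg_part_def A(1) B(1) shuffle_0)
    qed
  qed (auto simp: M_def)
  also have "\<dots> = reg u \<squnion>\<squnion> reg v"
    unfolding A(2)[OF order_refl] B(2)[OF order_refl] shuffle_sum_left
    by (simp only: shuffle_sum_right sum.cartesian_product)
  finally show ?thesis .
qed

definition word0 :: "letter list \<Rightarrow> bool" where
  "word0 w \<longleftrightarrow> word1 w \<and> (w \<noteq> [] \<longrightarrow> hd w = L0)"

text \<open>Subtracting \<open>x\<^sub>1 * dl L1 v\<close> from \<open>v\<close> discards the words
  that begin with x_1. Induction over h^1 applies to this projection, which fixes \<open>u\<close>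
  because \<open>dl L1 u = 0\<close>.\<close>

lemma hoffman0_induct [consumes 2, case_names word add]:
  assumes "u \<in> hoffman1" "dl L1 u = 0" and word: "\<And>c w. word0 w \<Longrightarrow> P (scale_h c (word w))"
    and add: "\<And>u v. u \<in> hoffman1 \<Longrightarrow> v \<in> hoffman1 \<Longrightarrow> dl L1 u = 0 \<Longrightarrow> dl L1 v = 0 \<Longrightarrow> P u \<Longrightarrow> P v \<Longrightarrow> P (u + v)"
  shows "P u"
proof -
  have "P (v - x\<^sub>1 * dl L1 v) \<and> v - x\<^sub>1 * dl L1 v \<in> hoffman1" if "v \<in> hoffman1" for v
    using that
  proof (induction v rule: hoffman1_induct)
    case (word c w)
    show ?case
    proof (cases "word0 w")
      case True
      then have "dl L1 (word w) = 0"
        by (cases w) (auto simp: word0_def dl_word)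
      then show ?thesis
        using True word assms(3) by (simp add: dl_linear hoffman1_scale hoffman1_word)
    next
      case False
      then obtain v where "w = L1 # v"
        using word by (cases w) (auto simp: word0_def intro: letter.exhaust)
      then have "scale_h c (word w) - x\<^sub>1 * dl L1 (scale_h c (word w)) = scale_h 0 (word [])"
        by (simp add: dl_linear dl_mult scale_h_mult_right word_Cons[of _ v])
      then show ?thesis
        using assms(3)[of "[]" 0] by (simp add: word0_def word1_def hoffman1_0)
    qed
  next
    case (add u v)
    then have "P ((u - x\<^sub>1 * dl L1 u) + (v - x\<^sub>1 * dl L1 v))"
      by (intro assms(4)) (auto simp: dl_linear dl_mult)
    moreover have "(u - x\<^sub>1 * dl L1 u) + (v - x\<^sub>1 * dl L1 v) \<in> hoffman1"
      using add by (auto intro: hoffman1_add)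
    moreover have "(u - x\<^sub>1 * dl L1 u) + (v - x\<^sub>1 * dl L1 v) = (u + v) - x\<^sub>1 * dl L1 (u + v)"
      by (simp add: dl_linear distrib_left)
    ultimately show ?case by simp
  qed
  from this[OF assms(1)] show ?thesis using assms(2) by simp
qed

lemma word0_obtain_index:
  assumes "word0 w"
  obtains k where "admissible k" "w = y_word k"
proof -
  obtain k where k: "is_index k" "w = y_word k"
    using assms word1_obtain_index unfolding word0_def by metis
  have "2 \<le> hd k" if "k \<noteq> []"
  proof -
    obtain a l where al: "k = a # l" using \<open>k \<noteq> []\<close> by (cases k) auto
    then have "a - 1 \<noteq> 0" "a > 0"
      using assms k by (auto simp: word0_def y_word_Cons is_index_def)
    then show ?thesis using al by simp
  qed
  then have "admissible k" using k by (simp add: admissible_def)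
  then show ?thesis using k that by blast
qed

section \<open>Shuffle products of the generators\<close>

definition sh :: "nat list \<Rightarrow> hoffman" where
  "sh l = shuffle_list (map y_gen l)"

definition omit :: "nat \<Rightarrow> nat list \<Rightarrow> nat list" where
  "omit a l = take a l @ drop (Suc a) l"

definition omit_sum :: "(nat \<Rightarrow> hoffman \<Rightarrow> hoffman) \<Rightarrow> nat list \<Rightarrow> hoffman" where
  "omit_sum G l = (\<Sum>a<length l. G (l ! a) (sh (omit a l)))"

lemma sh_simps: "sh [] = 1" "sh (k # l) = y_gen k \<squnion>\<squnion> sh l"
  by (simp_all add: sh_def shuffle_list_def)

lemma omit_sum_Nil: "omit_sum G [] = 0"
  by (simp add: omit_sum_def)

text \<open>A new factor multiplies all remaining shuffles in the old sum. This changes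
  \<open>G\<close>, so inductions over the list have to be general in \<open>G\<close>.\<close>

lemma omit_sum_Cons:
  "omit_sum G (k # l) = G k (sh l) + omit_sum (\<lambda>k' Y. G k' (y_gen k \<squnion>\<squnion> Y)) l"
  by (simp add: omit_sum_def sum.lessThan_Suc_shift omit_def sh_simps del: sum.lessThan_Suc)

lemma omit_sum_add: "omit_sum (\<lambda>k Y. G k Y + H k Y) l = omit_sum G l + omit_sum H l"
  by (simp add: omit_sum_def sum.distrib)

lemma omit_sum_diff: "omit_sum (\<lambda>k Y. G k Y - H k Y) l = omit_sum G l - omit_sum H l"
  by (simp add: omit_sum_def sum_subtractf)

lemma omit_sum_0: "omit_sum (\<lambda>k Y. 0) l = 0"
  by (simp add: omit_sum_def)

lemma omit_sum_cong:
  "(\<And>k Y. k \<in> set l \<Longrightarrow> G k Y = H k Y) \<Longrightarrow> omit_sum G l = omit_sum H l"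
  by (simp add: omit_sum_def)

lemma y_gen_eq_word: "y_gen k = word (replicate (k - 1) L0 @ [L1])"
  using y_index_eq_word[of "[k]"] by (simp add: y_index_def y_word_def)

lemma y_gen_hoffman1: "y_gen k \<in> hoffman1"
  by (simp add: y_gen_eq_word hoffman1_word word1_def)

lemma sh_hoffman1: "sh l \<in> hoffman1"
  by (induction l) (simp_all add: sh_simps hoffman1_one hoffman1_shuffle y_gen_hoffman1)

lemma dl_y_gen:
  "k > 0 \<Longrightarrow> dl L0 (y_gen k) = (if k \<ge> 2 then y_gen (k - 1) else 0)"
  "k > 0 \<Longrightarrow> dl L1 (y_gen k) = (if k = 1 then 1 else 0)"
  unfolding y_gen_eq_word
  by (cases "k - 1"; cases "k - 2"; auto simp: dl_word word_Nil numeral_2_eq_2)+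

text \<open>Lists the products in the x_0-derivative of \<open>sh l\<close>. An entry 1 is not
  lowered, since y_1 does not begin with x_0.\<close>

fun lower :: "nat list \<Rightarrow> nat list list" where
  "lower [] = []"
| "lower (k # l) = (if k \<ge> 2 then [(k - 1) # l] else []) @ map ((#) k) (lower l)"

text \<open>The same for x_1: among the generators only y_1 begins with x_1, and its derivative is
  1.\<close>

fun remove_ones :: "nat list \<Rightarrow> nat list list" where
  "remove_ones [] = []"
| "remove_ones (k # l) = (if k = 1 then [l] else []) @ map ((#) k) (remove_ones l)"

lemma sum_list_shuffle_right: "(\<Sum>x\<leftarrow>xs. g \<squnion>\<squnion> f x) = g \<squnion>\<squnion> (\<Sum>x\<leftarrow>xs. f x)"
  by (induction xs) (simp_all add: shuffle_0 shuffle_add_right)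

lemma dl_sh:
  assumes "is_index l"
  shows "dl L0 (sh l) = (\<Sum>l'\<leftarrow>lower l. sh l')" and "dl L1 (sh l) = (\<Sum>l'\<leftarrow>remove_ones l. sh l')"
  using assms
  by (induction l)
    (auto simp: sh_simps dl_word dl_shuffle dl_y_gen is_index_def shuffle_0 o_def sum_list_shuffle_right)

lemma lower_index: "is_index l \<Longrightarrow> l' \<in> set (lower l) \<Longrightarrow> is_index l' \<and> sum_list l' < sum_list l"
  by (induction l arbitrary: l') (auto simp: is_index_def split: if_splits)

lemma remove_ones_index: "is_index l \<Longrightarrow> l' \<in> set (remove_ones l) \<Longrightarrow> is_index l' \<and> sum_list l' < sum_list l"
  by (induction l arbitrary: l') (auto simp: is_index_def split: if_splits)

lemma sum_list_additive:
  fixes G :: "hoffman \<Rightarrow> hoffman"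
  assumes "\<And>Y Y'. G (Y + Y') = G Y + G Y'"
  shows "(\<Sum>x\<leftarrow>xs. G (f x)) = G (\<Sum>x\<leftarrow>xs. f x)"
proof -
  have "G 0 = 0" using assms[of 0 0] by simp
  then show ?thesis by (induction xs) (simp_all add: assms)
qed

text \<open>The lowered entry is either the one singled out by \<open>omit_sum\<close>, which gives
  the first sum, or one of the others, which by the Leibniz rule gives
  \<open>dl L0 Y\<close>.\<close>

lemma sum_list_omit_sum_lower:
  assumes "is_index l" "\<And>k Y Y'. G k (Y + Y') = G k Y + G k Y'"
  shows "(\<Sum>l'\<leftarrow>lower l. omit_sum G l') =
    omit_sum (\<lambda>k Y. if k \<ge> 2 then G (k - 1) Y else 0) l + omit_sum (\<lambda>k Y. G k (dl L0 Y)) l"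
  using assms
proof (induction l arbitrary: G)
  case Nil
  then show ?case by (simp add: omit_sum_Nil)
next
  case (Cons k l)
  have G0: "G k' 0 = 0" for k' using Cons.prems(2)[of k' 0 0] by simp
  have l: "is_index l" "k > 0" using Cons.prems by (auto simp: is_index_def)
  have IH: "(\<Sum>l'\<leftarrow>lower l. omit_sum (\<lambda>k' Y. G k' (y_gen k \<squnion>\<squnion> Y)) l') =
      omit_sum (\<lambda>k' Y. if k' \<ge> 2 then G (k' - 1) (y_gen k \<squnion>\<squnion> Y) else 0) l +
      omit_sum (\<lambda>k' Y. G k' (y_gen k \<squnion>\<squnion> dl L0 Y)) l"
    using Cons.prems l by (intro Cons.IH) (simp_all add: shuffle_add_right)
  have D: "omit_sum (\<lambda>k' Y. G k' (dl L0 (y_gen k \<squnion>\<squnion> Y))) l =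
      (if k \<ge> 2 then omit_sum (\<lambda>k' Y. G k' (y_gen (k - 1) \<squnion>\<squnion> Y)) l else 0) +
      omit_sum (\<lambda>k' Y. G k' (y_gen k \<squnion>\<squnion> dl L0 Y)) l"
    using l by (simp add: dl_shuffle dl_y_gen Cons.prems(2) omit_sum_add shuffle_0 G0 omit_sum_0)
  have "(\<Sum>l'\<leftarrow>lower (k # l). omit_sum G l') =
      (if k \<ge> 2 then G (k - 1) (sh l) + omit_sum (\<lambda>k' Y. G k' (y_gen (k - 1) \<squnion>\<squnion> Y)) l else 0) +
      G k (dl L0 (sh l)) + (\<Sum>l'\<leftarrow>lower l. omit_sum (\<lambda>k' Y. G k' (y_gen k \<squnion>\<squnion> Y)) l')"
    using sum_list_additive[of "G k" sh "lower l", OF Cons.prems(2)]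
    by (simp add: omit_sum_Cons o_def sum_list_addf dl_sh l add.assoc)
  then show ?case
    by (simp add: omit_sum_Cons IH D)
qed

text \<open>A removed entry can no longer be singled out, so here only the second kind of term
  occurs.\<close>

lemma sum_list_omit_sum_remove_ones:
  assumes "is_index l" "\<And>k Y Y'. G k (Y + Y') = G k Y + G k Y'"
  shows "(\<Sum>l'\<leftarrow>remove_ones l. omit_sum G l') = omit_sum (\<lambda>k Y. G k (dl L1 Y)) l"
  using assms
proof (induction l arbitrary: G)
  case Nil
  then show ?case by (simp add: omit_sum_Nil)
next
  case (Cons k l)
  have G0: "G k' 0 = 0" for k' using Cons.prems(2)[of k' 0 0] by simp
  have l: "is_index l" "k > 0" using Cons.prems by (auto simp: is_index_def)
  have IH: "(\<Sum>l'\<leftarrow>remove_ones l. omit_sum (\<lambda>k' Y. G k' (y_gen k \<squnion>\<squnion> Y)) l') =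
      omit_sum (\<lambda>k' Y. G k' (y_gen k \<squnion>\<squnion> dl L1 Y)) l"
    using Cons.prems l by (intro Cons.IH) (simp_all add: shuffle_add_right)
  have D: "omit_sum (\<lambda>k' Y. G k' (dl L1 (y_gen k \<squnion>\<squnion> Y))) l =
      (if k = 1 then omit_sum G l else 0) + omit_sum (\<lambda>k' Y. G k' (y_gen k \<squnion>\<squnion> dl L1 Y)) l"
    using l by (simp add: dl_shuffle dl_y_gen Cons.prems(2) omit_sum_add shuffle_0 G0 omit_sum_0)
  have "(\<Sum>l'\<leftarrow>remove_ones (k # l). omit_sum G l') =
      (if k = 1 then omit_sum G l else 0) +
      G k (dl L1 (sh l)) + (\<Sum>l'\<leftarrow>remove_ones l. omit_sum (\<lambda>k' Y. G k' (y_gen k \<squnion>\<squnion> Y)) l')"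
    using sum_list_additive[of "G k" sh "remove_ones l", OF Cons.prems(2)]
    by (simp add: omit_sum_Cons o_def sum_list_addf dl_sh l add.assoc)
  then show ?case
    by (simp add: omit_sum_Cons IH D)
qed

text \<open>By the Leibniz rule each factor y_1 is removed in turn. \<open>U\<close> takes up the
  factors already passed in the induction.\<close>

lemma dl_L1_sh: 
  assumes "is_index l"
  shows "U \<squnion>\<squnion> dl L1 (sh l) = omit_sum (\<lambda>k Y. if k = 1 then U \<squnion>\<squnion> Y else 0) l"
  using assms
proof (induction l arbitrary: U)
  case Nil
  then show ?case by (simp add: omit_sum_Nil sh_simps dl_word shuffle_0)
next
  case (Cons k l)
  have "U \<squnion>\<squnion> dl L1 (sh (k # l)) = (if k = 1 then U \<squnion>\<squnion> sh l else 0) + ((U \<squnion>\<squnion> y_gen k) \<squnion>\<squnion> dl L1 (sh l))"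
    using Cons.prems by (simp add: sh_simps dl_shuffle dl_y_gen shuffle_add_right is_index_def shuffle_0 shuffle_assoc)
  also have "(U \<squnion>\<squnion> y_gen k) \<squnion>\<squnion> dl L1 (sh l) = omit_sum (\<lambda>k' Y. if k' = 1 then U \<squnion>\<squnion> (y_gen k \<squnion>\<squnion> Y) else 0) l"
    using Cons.prems by (subst Cons.IH) (simp_all add: is_index_def shuffle_assoc cong: if_cong)
  finally show ?case by (simp add: omit_sum_Cons)
qed

section \<open>Splitting a word at a letter \<open>x\<^sub>1\<close>\<close>

text \<open>
  \<open>split_word P w\<close> is the sum of \<open>(-1)\<^bsup>|u|\<^esup> (rev u \<cdot> P) \<squnion>\<squnion> v\<close> over all factorizations \<open>w = u x\<^sub>1 v\<close>.
\<close>

fun split_word :: "hoffman \<Rightarrow> letter list \<Rightarrow> hoffman" where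
  "split_word P [] = 0"
| "split_word P (a # w) = (if a = L1 then P \<squnion>\<squnion> word w else 0) - split_word (word [a] * P) w"

definition split :: "hoffman \<Rightarrow> hoffman \<Rightarrow> hoffman" where
  "split P = lin scale_h (split_word P)"

lemma split_linear:
  "split P (u + v) = split P u + split P v" "split P (scale_h c u) = scale_h c (split P u)"
  "split P (u - v) = split P u - split P v" "split P 0 = 0" "split P (word w) = split_word P w"
  by (simp_all add: split_def lin_h)

lemma split_sum_list: "split P (\<Sum>x\<leftarrow>xs. f x) = (\<Sum>x\<leftarrow>xs. split P (f x))"
  by (induction xs) (simp_all add: split_linear)

lemma split_mult:
  "split P (word [a] * u) = (if a = L1 then P \<squnion>\<squnion> u else 0) - split (word [a] * P) u"
  by (induction u rule: hoffman_induct)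
    (simp_all add: distrib_left scale_h_mult_right split_linear shuffle_add_right shuffle_scale_right
      scale_h.scale_right_diff_distrib flip: word_Cons)

lemma split_decomp:
  "split P u = (P \<squnion>\<squnion> dl L1 u) - split (x\<^sub>0 * P) (dl L0 u) - split (x\<^sub>1 * P) (dl L1 u)"
proof -
  obtain c where c: "u = scale_h c 1 + x\<^sub>0 * dl L0 u + x\<^sub>1 * dl L1 u"
    by (rule hoffman_decomp)
  have "split P 1 = 0" using split_linear(5)[of P "[]"] by (simp add: word_Nil)
  then have "split P (scale_h c 1 + x\<^sub>0 * dl L0 u + x\<^sub>1 * dl L1 u) =
      (P \<squnion>\<squnion> dl L1 u) - split (x\<^sub>0 * P) (dl L0 u) - split (x\<^sub>1 * P) (dl L1 u)"
    by (simp add: split_linear split_mult)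
  then show ?thesis by (simp flip: c)
qed

text \<open>A shuffle begins with the first letter of the left factor or with one of
  \<open>Y\<close>; the constant term of \<open>Y\<close> enters through the first summand
  only.\<close>

lemma shuffle_decomp:
  "(word [c] * P) \<squnion>\<squnion> Y = word [c] * (P \<squnion>\<squnion> Y) + x\<^sub>0 * ((word [c] * P) \<squnion>\<squnion> dl L0 Y) + x\<^sub>1 * ((word [c] * P) \<squnion>\<squnion> dl L1 Y)"
proof -
  obtain d where d: "Y = scale_h d 1 + x\<^sub>0 * dl L0 Y + x\<^sub>1 * dl L1 Y"
    by (rule hoffman_decomp)
  have "(word [c] * P) \<squnion>\<squnion> (scale_h d 1 + x\<^sub>0 * dl L0 Y + x\<^sub>1 * dl L1 Y) =
      word [c] * (P \<squnion>\<squnion> (scale_h d 1 + x\<^sub>0 * dl L0 Y + x\<^sub>1 * dl L1 Y)) +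
      x\<^sub>0 * ((word [c] * P) \<squnion>\<squnion> dl L0 Y) + x\<^sub>1 * ((word [c] * P) \<squnion>\<squnion> dl L1 Y)"
    by (simp add: shuffle_add_right shuffle_Cons_Cons shuffle_scale_right distrib_left scale_h_mult_right add_ac)
  then show ?thesis by (simp flip: d)
qed

text \<open>For \<open>Y = 1\<close> this is the single cut of y_k with prefix
  \<open>word [c] * P\<close>. In general the remaining product \<open>Y\<close> is shuffled into
  \<open>P\<close> only, behind the letter \<open>c\<close>: everything else telescopes.\<close>

definition split_term :: "letter \<Rightarrow> hoffman \<Rightarrow> nat \<Rightarrow> hoffman \<Rightarrow> hoffman" where
  "split_term c P k Y = scale_h ((-1) ^ (k - 1)) (x\<^sub>0 ^ (k - 1) * (word [c] * (P \<squnion>\<squnion> Y)))"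

lemma split_term_add: "split_term c P k (Y + Y') = split_term c P k Y + split_term c P k Y'"
  by (simp add: split_term_def shuffle_add_right distrib_left scale_h.scale_right_distrib)

text \<open>The first two terms together are the signed product of
  \<open>x\<^sub>0 ^ (k - 1)\<close> with the shuffle of \<open>word [c] * P\<close> and
  \<open>Y\<close>, the minus sign making up for the lowered exponent. \<open>shuffle_decomp\<close>
  expands this shuffle.\<close>

lemma split_term_rec:
  assumes "k > 0"
  shows "split_term c P k Y = (if k = 1 then (word [c] * P) \<squnion>\<squnion> Y else 0)
    - (if k \<ge> 2 then split_term L0 (word [c] * P) (k - 1) Y else 0)
    - split_term L0 (word [c] * P) k (dl L0 Y) - split_term L1 (word [c] * P) k (dl L1 Y)"
proof -
  let ?s = "\<lambda>u. scale_h ((-1) ^ (k - 1)) (x\<^sub>0 ^ (k - 1) * u)"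
  have "(if k = 1 then (word [c] * P) \<squnion>\<squnion> Y else 0) - (if k \<ge> 2 then split_term L0 (word [c] * P) (k - 1) Y else 0)
      = ?s ((word [c] * P) \<squnion>\<squnion> Y)"
  proof (cases "k = 1")
    case False
    then obtain j where "k = Suc (Suc j)"
      using assms by (metis One_nat_def not0_implies_Suc not_gr_zero)
    then show ?thesis
      by (simp add: split_term_def mult.assoc power_Suc2 del: power_Suc)
  qed simp
  also have "\<dots> = split_term c P k Y + split_term L0 (word [c] * P) k (dl L0 Y) + split_term L1 (word [c] * P) k (dl L1 Y)"
    by (subst shuffle_decomp) (simp add: split_term_def distrib_left scale_h.scale_right_distrib)
  finally show ?thesis by simp
qed

text \<open>
  Both sides satisfy the same recursion when \<open>sh l\<close> is decomposed according to its first letter.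
\<close>

lemma split_sh: "is_index l \<Longrightarrow> split (word [c] * P) (sh l) = omit_sum (split_term c P) l"
proof (induction "sum_list l" arbitrary: l c P rule: less_induct)
  case less
  let ?P = "word [c] * P"
  have "split ?P (sh l) = (?P \<squnion>\<squnion> dl L1 (sh l)) - (\<Sum>l'\<leftarrow>lower l. split (x\<^sub>0 * ?P) (sh l'))
      - (\<Sum>l'\<leftarrow>remove_ones l. split (x\<^sub>1 * ?P) (sh l'))"
    by (subst split_decomp) (simp add: dl_sh less.prems split_sum_list)
  \<comment> \<open>The weight drops while the prefix grows by a letter, hence the induction general
    in \<open>c\<close> and \<open>P\<close>.\<close>
  also have "(\<Sum>l'\<leftarrow>lower l. split (x\<^sub>0 * ?P) (sh l')) = (\<Sum>l'\<leftarrow>lower l. omit_sum (split_term L0 ?P) l')"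
    using lower_index[OF less.prems] by (intro arg_cong[of _ _ sum_list] map_cong refl less.hyps) auto
  also have "\<dots> = omit_sum (\<lambda>k Y. if k \<ge> 2 then split_term L0 ?P (k - 1) Y else 0) l +
      omit_sum (\<lambda>k Y. split_term L0 ?P k (dl L0 Y)) l"
    by (rule sum_list_omit_sum_lower[OF less.prems]) (rule split_term_add)
  also have "(\<Sum>l'\<leftarrow>remove_ones l. split (x\<^sub>1 * ?P) (sh l')) = (\<Sum>l'\<leftarrow>remove_ones l. omit_sum (split_term L1 ?P) l')"
    using remove_ones_index[OF less.prems] by (intro arg_cong[of _ _ sum_list] map_cong refl less.hyps) auto
  also have "\<dots> = omit_sum (\<lambda>k Y. split_term L1 ?P k (dl L1 Y)) l"
    by (rule sum_list_omit_sum_remove_ones[OF less.prems]) (rule split_term_add)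
  also have "?P \<squnion>\<squnion> dl L1 (sh l) = omit_sum (\<lambda>k Y. if k = 1 then ?P \<squnion>\<squnion> Y else 0) l"
    by (rule dl_L1_sh[OF less.prems])
  also have "omit_sum (\<lambda>k Y. if k = 1 then ?P \<squnion>\<squnion> Y else 0) l -
      (omit_sum (\<lambda>k Y. if k \<ge> 2 then split_term L0 ?P (k - 1) Y else 0) l +
      omit_sum (\<lambda>k Y. split_term L0 ?P k (dl L0 Y)) l) - omit_sum (\<lambda>k Y. split_term L1 ?P k (dl L1 Y)) l
    = omit_sum (\<lambda>k Y. (if k = 1 then ?P \<squnion>\<squnion> Y else 0) - (if k \<ge> 2 then split_term L0 ?P (k - 1) Y else 0)
        - split_term L0 ?P k (dl L0 Y) - split_term L1 ?P k (dl L1 Y)) l"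
    by (simp only: omit_sum_diff) simp
  also have "\<dots> = omit_sum (split_term c P) l"
    using less.prems by (intro omit_sum_cong split_term_rec[symmetric]) (simp add: is_index_def)
  finally show ?case .
qed

section \<open>Multiple polylogarithms as formal power series\<close>

text \<open>Iterated integration against dt/t and dt/(1-t), on coefficients. Division by zero makes
  the constant term of every nonempty word 0. The field is left open: truncated sums are taken over
  the rationals, limits over the reals.\<close>

fun Li_word :: "letter list \<Rightarrow> 'a::field_char_0 fps" where
  "Li_word [] = 1"
| "Li_word (L0 # w) = Abs_fps (\<lambda>n. fps_nth (Li_word w) n / of_nat n)"
| "Li_word (L1 # w) = Abs_fps (\<lambda>n. (\<Sum>j<n. fps_nth (Li_word w) j) / of_nat n)"

definition scale_fps :: "rat \<Rightarrow> 'a::field_char_0 fps \<Rightarrow> 'a fps" where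
  "scale_fps c F = fps_const (of_rat c) * F"

lemma vector_space_scale_fps: "vector_space scale_fps"
  by standard (simp_all add: scale_fps_def algebra_simps of_rat_add of_rat_mult
    flip: fps_const_add fps_const_mult)

definition Li :: "hoffman \<Rightarrow> 'a::field_char_0 fps" where
  "Li = lin scale_fps Li_word"

lemma Li_linear:
  "Li (u + v) = Li u + Li v" "Li (scale_h c u) = fps_const (of_rat c) * Li u" "Li (word w) = Li_word w"
  "Li 0 = 0"
  by (simp_all add: Li_def lin_add lin_scale lin_word lin_0 vector_space_scale_fps flip: scale_fps_def)

lemma Li_1: "Li 1 = 1"
  using Li_linear(3)[of "[]"] by (simp add: word_Nil)

lemma fps_nth_Li_x0: "fps_nth (Li (x\<^sub>0 * u)) n = fps_nth (Li u) n / of_nat n"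
  by (induction u rule: hoffman_induct)
    (simp_all add: distrib_left scale_h_mult_right Li_linear add_divide_distrib flip: word_Cons)

lemma fps_nth_Li_x1: "fps_nth (Li (x\<^sub>1 * u)) n = (\<Sum>j<n. fps_nth (Li u) j) / of_nat n"
  by (induction u rule: hoffman_induct)
    (simp_all add: distrib_left scale_h_mult_right Li_linear add_divide_distrib sum.distrib
      flip: word_Cons sum_distrib_left)

lemma fps_nth_Li_x0_power: "fps_nth (Li (x\<^sub>0 ^ k * u)) n = fps_nth (Li u) n / of_nat n ^ k"
  by (induction k) (simp_all add: fps_nth_Li_x0 mult.assoc)

lemma fps_nth_Li_word_0: "w \<noteq> [] \<Longrightarrow> fps_nth (Li_word w) 0 = 0"
  by (cases w rule: Li_word.cases) simp_all

text \<open>The Euler operator t d/dt. It is a derivation that determines a series up to its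
  constant term and undoes both integrations.\<close>

definition theta :: "'a::field_char_0 fps \<Rightarrow> 'a fps" where
  "theta F = fps_X * fps_deriv F"

lemma fps_nth_theta: "fps_nth (theta F) n = of_nat n * fps_nth F n"
  by (cases n) (simp_all add: theta_def)

lemma theta_mult: "theta (F * G) = theta F * G + F * theta G"
  by (simp add: theta_def algebra_simps)

lemma theta_inject: "theta F = theta G \<Longrightarrow> fps_nth F 0 = fps_nth G 0 \<Longrightarrow> F = G"
proof (rule fps_ext)
  fix n assume "theta F = theta G" "fps_nth F 0 = fps_nth G 0"
  moreover from this have "of_nat n * fps_nth F n = of_nat n * fps_nth G n"
    by (metis fps_nth_theta)
  ultimately show "fps_nth F n = fps_nth G n"
    by (cases "n = 0") auto
qed

text \<open>The two differential forms as multiples of dt/t: the second one is t/(1-t).\<close>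

fun Li_form :: "letter \<Rightarrow> 'a::field_char_0 fps" where
  "Li_form L0 = 1"
| "Li_form L1 = Abs_fps (\<lambda>n. if n = 0 then 0 else 1)"

text \<open>For x_0 the constant term of \<open>Li u\<close> is lost in the division by
  \<open>n\<close>, so it has to vanish.\<close>

lemma theta_Li:
  assumes "a = L0 \<Longrightarrow> fps_nth (Li u) 0 = (0::'a::field_char_0)"
  shows "theta (Li (word [a] * u)) = (Li_form a * Li u :: 'a fps)"
proof (cases a)
  case L0
  show ?thesis
  proof (rule fps_ext)
    fix n show "fps_nth (theta (Li (word [a] * u))) n = fps_nth (Li_form a * Li u :: 'a fps) n"
      using assms L0 by (cases "n = 0") (simp_all add: fps_nth_theta fps_nth_Li_x0)
  qed
next
  case L1
  show ?thesis
  proof (rule fps_ext)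
    fix n
    have "fps_nth (Li_form a * Li u :: 'a fps) n = (\<Sum>i=0..n. fps_nth (Li u) i * (if n - i = 0 then 0 else 1))"
      using L1 by (subst mult.commute) (simp add: fps_mult_nth)
    also have "\<dots> = (\<Sum>i<n. fps_nth (Li u) i)"
      by (intro sum.mono_neutral_cong_right) auto
    finally show "fps_nth (theta (Li (word [a] * u))) n = fps_nth (Li_form a * Li u :: 'a fps) n"
      using L1 by (cases "n = 0") (simp_all add: fps_nth_theta fps_nth_Li_x1)
  qed
qed

text \<open>The product rule for \<open>theta\<close> is the shuffle recursion on first letters;
  both sides have constant term 0, so \<open>theta\<close> may be cancelled.\<close>

lemma Li_shuffle_word:
  "word1 v \<Longrightarrow> word1 w \<Longrightarrow> Li (shuffle_word v w) = (Li_word v * Li_word w :: 'a::field_char_0 fps)"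
proof (induction v w rule: shuffle_word.induct)
  case (3 a v b w)
  have IH: "Li (shuffle_word v (b # w)) = (Li_word v * Li_word (b # w) :: 'a fps)"
    "Li (shuffle_word (a # v) w) = (Li_word (a # v) * Li_word w :: 'a fps)"
    using 3 by (auto dest: word1_ConsD)
  have zero: "fps_nth (Li_word (c # u)) 0 = (0 :: 'a)" for c u
    by (rule fps_nth_Li_word_0) simp
  have th: "theta (Li_word (c # u)) = (Li_form c * Li_word u :: 'a fps)" if "word1 (c # u)" for c u
  proof -
    have "fps_nth (Li_word u) 0 = (0 :: 'a)" if "c = L0"
      using that \<open>word1 (c # u)\<close> by (intro fps_nth_Li_word_0) (auto simp: word1_def)
    then have "theta (Li (word [c] * word u)) = (Li_form c * Li (word u) :: 'a fps)"
      by (intro theta_Li) (simp add: Li_linear)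
    then show ?thesis by (simp add: Li_linear flip: word_Cons)
  qed
  have "theta (Li (shuffle_word (a # v) (b # w))) = theta (Li (word [a] * shuffle_word v (b # w))) + theta (Li (word [b] * shuffle_word (a # v) w) :: 'a fps)"
    by (simp add: Li_linear theta_def distrib_left)
  also have "\<dots> = Li_form a * (Li_word v * Li_word (b # w)) + Li_form b * (Li_word (a # v) * Li_word w)"
    by (subst theta_Li, simp add: IH zero, subst theta_Li, simp add: IH zero, simp only: IH)
  also have "\<dots> = theta (Li_word (a # v) * Li_word (b # w))"
    using 3 by (simp add: theta_mult th algebra_simps)
  finally show ?case
  proof (rule theta_inject)
    have "fps_nth (Li (word [c] * u)) 0 = (0 :: 'a)" for c u
      by (cases c) (simp_all add: fps_nth_Li_x0 fps_nth_Li_x1)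
    then show "fps_nth (Li (shuffle_word (a # v) (b # w))) 0 = fps_nth (Li_word (a # v) * Li_word (b # w) :: 'a fps) 0"
      by (simp add: Li_linear zero)
  qed
qed (simp_all add: Li_linear)

lemma Li_shuffle:
  assumes "u \<in> hoffman1" "v \<in> hoffman1"
  shows "Li (u \<squnion>\<squnion> v) = (Li u * Li v :: 'a::field_char_0 fps)"
  using assms(1)
proof (induction u rule: hoffman1_induct)
  case (word c x)
  from assms(2) have "Li (word x \<squnion>\<squnion> v) = (Li_word x * Li v :: 'a fps)"
    by (induction v rule: hoffman1_induct)
      (simp_all add: word shuffle_scale_right shuffle_word_word Li_linear
        Li_shuffle_word shuffle_add_right algebra_simps)
  then show ?case by (simp add: shuffle_scale_left Li_linear mult.assoc)
qed (simp add: shuffle_add_left Li_linear distrib_right)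

definition li :: "nat \<Rightarrow> 'a::field_char_0 fps" where
  "li k = Abs_fps (\<lambda>n. 1 / of_nat n ^ k)"

lemma Li_y_gen: "k > 0 \<Longrightarrow> Li (y_gen k) = li k"
proof (rule fps_ext)
  fix n assume "k > 0"
  then have "y_gen k = x\<^sub>0 ^ (k - 1) * x\<^sub>1" "of_nat n ^ k = (of_nat n * of_nat n ^ (k - 1) :: 'a)"
    by (simp_all add: y_gen_def flip: power_Suc)
  moreover have "fps_nth (Li x\<^sub>1) n = (1 / of_nat n :: 'a)"
    using fps_nth_Li_x1[where 'a = 'a, of 1 n] by (cases "n = 0") (simp_all add: Li_1)
  ultimately show "fps_nth (Li (y_gen k)) n = fps_nth (li k :: 'a fps) n"
    by (simp add: fps_nth_Li_x0_power li_def)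
qed

lemma Li_sh: "is_index l \<Longrightarrow> Li (sh l) = prod_list (map li l)"
proof (induction l)
  case Nil
  then show ?case by (simp add: sh_simps Li_1)
next
  case (Cons k l)
  then show ?case
    by (simp add: sh_simps Li_shuffle y_gen_hoffman1 sh_hoffman1 Li_y_gen is_index_def)
qed

section \<open>Coefficients as sums over compositions and over decreasing tuples\<close>

lemma compositions_0: "compositions n 0 = (if n = 0 then {[]} else {})"
  by (auto simp: compositions_def)

lemma compositions_Suc: "compositions n (Suc r) = (\<Union>j\<in>{1..n}. (#) j ` compositions (n - j) r)"
  by (fastforce simp: compositions_def length_Suc_conv)

lemma finite_compositions: "finite (compositions n r)"
  by (induction r arbitrary: n) (simp_all add: compositions_0 compositions_Suc)

text \<open>Vanishing constant terms keep the parts in the iterated Cauchy product positive.\<close>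

lemma fps_nth_prod_list:
  fixes F :: "'b \<Rightarrow> 'a::comm_ring_1 fps"
  assumes "\<And>x. x \<in> set k \<Longrightarrow> fps_nth (F x) 0 = 0"
  shows "fps_nth (prod_list (map F k)) n =
    (\<Sum>m\<in>compositions n (length k). \<Prod>a<length k. fps_nth (F (k ! a)) (m ! a))"
  using assms
proof (induction k arbitrary: n)
  case Nil
  then show ?case by (simp add: compositions_0)
next
  case (Cons x k)
  let ?P = "\<lambda>m. \<Prod>a<length k. fps_nth (F (k ! a)) (m ! a)"
  have "fps_nth (prod_list (map F (x # k))) n = (\<Sum>j=0..n. fps_nth (F x) j * fps_nth (prod_list (map F k)) (n - j))"
    by (simp add: fps_mult_nth)
  also have "\<dots> = (\<Sum>j\<in>{1..n}. fps_nth (F x) j * (\<Sum>m\<in>compositions (n - j) (length k). ?P m))"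
    using Cons by (intro sum.mono_neutral_cong_right) (auto simp: not_le)
  also have "\<dots> = (\<Sum>j\<in>{1..n}. \<Sum>m\<in>(#) j ` compositions (n - j) (length k). \<Prod>a<Suc (length k). fps_nth (F ((x # k) ! a)) (m ! a))"
    by (intro sum.cong refl) (simp add: sum.reindex prod.lessThan_Suc_shift sum_distrib_left del: prod.lessThan_Suc)
  also have "\<dots> = (\<Sum>m\<in>compositions n (Suc (length k)). \<Prod>a<Suc (length k). fps_nth (F ((x # k) ! a)) (m ! a))"
    unfolding compositions_Suc
    by (subst sum.UNION_disjoint) (auto simp: finite_compositions)
  finally show ?case by simp
qed

lemma fps_nth_Li_word_replicate: "fps_nth (Li_word (replicate r L0 @ w)) n = fps_nth (Li_word w) n / of_nat n ^ r"
  by (induction r) simp_all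

lemma fps_nth_Li_y_word_Cons:
  assumes "k > 0"
  shows "fps_nth (Li_word (y_word (k # l))) n = (\<Sum>j<n. fps_nth (Li_word (y_word l)) j) / of_nat n ^ k"
  using assms by (cases k) (simp_all add: y_word_Cons fps_nth_Li_word_replicate)

definition tuples_below :: "nat \<Rightarrow> nat \<Rightarrow> nat list set" where
  "tuples_below n r = {m \<in> decreasing_tuples r. \<forall>a\<in>set m. a < n}"

lemma tuples_below_0: "tuples_below n 0 = {[]}"
  by (auto simp: tuples_below_def decreasing_tuples_def)

lemma tuples_below_Suc: "tuples_below n (Suc r) = (\<Union>j\<in>{1..<n}. (#) j ` tuples_below j r)"
  by (fastforce simp: tuples_below_def decreasing_tuples_def length_Suc_conv)

lemma finite_tuples_below: "finite (tuples_below n r)"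
  by (induction r arbitrary: n) (simp_all add: tuples_below_0 tuples_below_Suc)

text \<open>For a nonempty index the coefficient at \<open>j\<close> collects the tuples with
  largest entry \<open>j\<close>. The empty index has its coefficient at 0, while its only tuple
  lies below every bound; hence \<open>n > 0\<close>.\<close>

lemma sum_tuples_below:
  assumes "is_index k" "n > 0"
  shows "(\<Sum>m\<in>tuples_below n (length k). inv_powers k m) = (\<Sum>j<n. fps_nth (Li_word (y_word k) :: 'a::field_char_0 fps) j)"
  using assms
proof (induction k arbitrary: n)
  case Nil
  then show ?case by (simp add: tuples_below_0 inv_powers_def y_word_Nil)
next
  case (Cons a k)
  have inv: "inv_powers (a # k) (j # m) = (1 / of_nat j ^ a * inv_powers k m :: 'a)" for j m
    by (simp add: inv_powers_def prod.lessThan_Suc_shift del: prod.lessThan_Suc)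
  have "(\<Sum>m\<in>tuples_below n (Suc (length k)). inv_powers (a # k) m :: 'a) =
      (\<Sum>j\<in>{1..<n}. \<Sum>m\<in>(#) j ` tuples_below j (length k). inv_powers (a # k) m)"
    unfolding tuples_below_Suc by (subst sum.UNION_disjoint) (auto simp: finite_tuples_below)
  also have "\<dots> = (\<Sum>j\<in>{1..<n}. 1 / of_nat j ^ a * (\<Sum>m\<in>tuples_below j (length k). inv_powers k m))"
    by (intro sum.cong refl) (simp add: sum.reindex inv sum_distrib_left)
  also have "\<dots> = (\<Sum>j\<in>{1..<n}. fps_nth (Li_word (y_word (a # k))) j)"
    using Cons.prems by (intro sum.cong refl) (simp add: Cons.IH is_index_def fps_nth_Li_y_word_Cons)
  also have "\<dots> = (\<Sum>j<n. fps_nth (Li_word (y_word (a # k))) j)"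
    by (intro sum.mono_neutral_left) (auto simp: y_word_Cons not_le Suc_le_eq intro!: fps_nth_Li_word_0)
  finally show ?case by simp
qed

section \<open>The congruence in \<open>\<A>\<close>\<close>

lemma sh_pos:
  assumes "l \<noteq> []"
  shows "sh l \<in> hoffman1_pos"
proof -
  obtain k l' where l: "l = k # l'" using assms by (cases l) auto
  have "y_gen k \<squnion>\<squnion> u \<in> hoffman1_pos" if "u \<in> hoffman1" for u
    using that
  proof (induction u rule: hoffman1_induct)
    case (word c w)
    then have "shuffle_word (replicate (k - 1) L0 @ [L1]) w \<in> hoffman1_pos"
      by (intro shuffle_word_pos) (auto simp: word1_def)
    then show ?case
      by (simp add: y_gen_eq_word shuffle_scale_right shuffle_word_word hoffman1_pos_scale)
  qed (simp add: shuffle_add_right hoffman1_pos_add)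
  then show ?thesis unfolding l sh_simps by (simp add: sh_hoffman1)
qed

text \<open>\<open>rat_mod_add\<close> and \<open>rat_mod_mult\<close> concern fixed rationals and
  almost all primes. Here the rationals vary with \<open>p\<close>, so the rules for
  \<open>rat_mod\<close> are needed at each single prime, on the rationals where reduction makes
  sense.\<close>

definition p_integral :: "nat \<Rightarrow> rat \<Rightarrow> bool" where
  "p_integral p x \<longleftrightarrow> (\<exists>a b. \<not> int p dvd b \<and> x = of_int a / of_int b)"

lemma p_integral_of_int: "prime p \<Longrightarrow> p_integral p (of_int a)"
  unfolding p_integral_def by (intro exI[of _ a] exI[of _ 1]) (auto dest: prime_gt_1_nat)

lemma p_integral_arith:
  assumes "prime p" "p_integral p x" "p_integral p y"
  shows "p_integral p (x + y)" and "p_integral p (x * y)"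
    and rat_mod_add_p_integral: "[rat_mod p (x + y) = rat_mod p x + rat_mod p y] (mod int p)"
    and rat_mod_mult_p_integral: "[rat_mod p (x * y) = rat_mod p x * rat_mod p y] (mod int p)"
proof -
  obtain a b where ab: "\<not> int p dvd b" "x = of_int a / of_int b"
    using assms(2) by (auto simp: p_integral_def)
  obtain c d where cd: "\<not> int p dvd d" "y = of_int c / of_int d"
    using assms(3) by (auto simp: p_integral_def)
  have bd: "\<not> int p dvd b * d"
    using ab cd assms(1) by (simp add: prime_dvd_mult_iff)
  have nz: "b \<noteq> 0" "d \<noteq> 0" using ab cd by auto
  have sum: "x + y = of_int (a * d + c * b) / of_int (b * d)"
    and prod: "x * y = of_int (a * c) / of_int (b * d)"
    using ab cd nz by (simp_all add: field_simps)
  show "p_integral p (x + y)" "p_integral p (x * y)"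
    unfolding p_integral_def using sum prod bd by blast+
  have xb: "[b * rat_mod p x = a] (mod int p)" and yd: "[d * rat_mod p y = c] (mod int p)"
    using ab cd assms(1) by (auto intro: rat_mod_unique)
  have "[(b * rat_mod p x) * d + (d * rat_mod p y) * b = a * d + c * b] (mod int p)"
    using xb yd by (intro cong_add cong_scalar_right)
  then show "[rat_mod p (x + y) = rat_mod p x + rat_mod p y] (mod int p)"
    by (intro rat_mod_unique'[OF assms(1) bd sum]) (simp add: algebra_simps)
  have "[(b * rat_mod p x) * (d * rat_mod p y) = a * c] (mod int p)"
    using xb yd by (intro cong_mult)
  then show "[rat_mod p (x * y) = rat_mod p x * rat_mod p y] (mod int p)"
    by (intro rat_mod_unique'[OF assms(1) bd prod]) (simp add: algebra_simps)
qed

lemma rat_mod_of_int: "prime p \<Longrightarrow> [rat_mod p (of_int a) = a] (mod int p)"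
  by (rule rat_mod_unique'[of p 1 _ a]) (auto dest: prime_gt_1_nat)

lemma p_integral_sum:
  assumes "prime p" "\<And>i. i \<in> A \<Longrightarrow> p_integral p (f i)"
  shows "p_integral p (sum f A)"
  using assms(2)
  by (induction A rule: infinite_finite_induct)
    (use p_integral_of_int[OF assms(1), of 0] in \<open>simp_all add: p_integral_arith[OF assms(1)]\<close>)

lemma p_integral_inverse_power:
  assumes "prime p" "0 < n" "n < p"
  shows "p_integral p (1 / of_nat n ^ k)"
proof -
  have "\<not> p dvd n" using assms by (auto dest: dvd_imp_le)
  then have "\<not> int p dvd int n ^ k"
    using assms(1) prime_dvd_power[of "int p" "int n" k] by auto
  then show ?thesis
    unfolding p_integral_def by (intro exI[of _ 1] exI[of _ "int n ^ k"]) simp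
qed

lemma p_integral_Li_word:
  assumes "prime p" "n < p"
  shows "p_integral p (fps_nth (Li_word w) n)"
  using assms(2)
proof (induction w arbitrary: n rule: Li_word.induct)
  case 1
  then show ?case
    using p_integral_of_int[OF assms(1), of "if n = 0 then 1 else 0"] by (simp split: if_splits)
next
  case (2 w)
  then show ?case
    using p_integral_arith(2)[OF assms(1) "2.IH"[OF "2.prems"] p_integral_inverse_power[OF assms(1), of n 1]]
      p_integral_of_int[OF assms(1), of 0]
    by (cases "n = 0") simp_all
next
  case (3 w)
  have "p_integral p (\<Sum>j<n. fps_nth (Li_word w) j)"
    using 3 by (intro p_integral_sum[OF assms(1)]) auto
  then show ?case
    using p_integral_arith(2)[OF assms(1) _ p_integral_inverse_power[OF assms(1), of n 1]] 3
      p_integral_of_int[OF assms(1), of 0]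
    by (cases "n = 0") simp_all
qed

definition partial_sum :: "nat \<Rightarrow> hoffman \<Rightarrow> rat" where
  "partial_sum n u = (\<Sum>j<n. fps_nth (Li u) j)"

lemma partial_sum_linear:
  "partial_sum n (u + v) = partial_sum n u + partial_sum n v"
  "partial_sum n (scale_h c u) = c * partial_sum n u"
  by (simp_all add: partial_sum_def Li_linear sum.distrib sum_distrib_left of_rat_eq_id)

lemma p_integral_almost_all: "finite {p. prime p \<and> \<not> p_integral p c}"
proof -
  obtain a b where ab: "c = of_int a / of_int b" "b > 0"
    by (metis quotient_of_denom_pos quotient_of_div surj_pair)
  have "{p. prime p \<and> \<not> p_integral p c} \<subseteq> {p. int p dvd b}"
    using ab unfolding p_integral_def by blast
  then show ?thesis using finite_bad_primes[of b] ab finite_subset by blast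
qed

text \<open>The rational coefficients of \<open>u\<close> may have \<open>p\<close> in a denominator
  for finitely many \<open>p\<close>. Integrality at the other primes is carried through the
  induction, because additivity of \<open>rat_mod\<close> depends on it.\<close>

lemma zeta_A_eq_partial_sum:
  assumes "u \<in> hoffman1"
  shows "zeta_A u = abs_ring_A (\<lambda>p. rat_mod p (partial_sum p u))"
    and "finite {p. prime p \<and> \<not> p_integral p (partial_sum p u)}"
proof -
  have "zeta_A u = abs_ring_A (\<lambda>p. rat_mod p (partial_sum p u)) \<and> finite {p. prime p \<and> \<not> p_integral p (partial_sum p u)}"
    using assms
  proof (induction u rule: hoffman1_induct)
    case (word c w)
    obtain k where k: "is_index k" "w = y_word k" using word word1_obtain_index by metis
    have int: "p_integral p (partial_sum p (word w))" if "prime p" for p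
      unfolding partial_sum_def Li_linear
      by (intro p_integral_sum[OF that] p_integral_Li_word[OF that]) auto
    have mhs: "mhs p k = partial_sum p (word w)" if "prime p" for p
      using sum_tuples_below[OF k(1) prime_gt_0_nat[OF that], where 'a = rat]
      by (simp add: mhs_def tuples_below_def partial_sum_def Li_linear k)
    have "zeta_A (scale_h c (word w)) = scale_A c (zeta_A_index k)"
      using linear_extension_y_index[OF vector_space_scale_A k(1), of zeta_A_index]
      by (simp add: zeta_A_def linear_extension_eq_lin[OF vector_space_scale_A] lin_scale[OF vector_space_scale_A]
        y_index_eq_word k(2))
    also have "\<dots> = abs_ring_A (\<lambda>p. rat_mod p c * rat_mod p (mhs p k))"
      by (simp add: zeta_A_index_def scale_A.abs_eq)
    also have "\<dots> = abs_ring_A (\<lambda>p. rat_mod p (partial_sum p (scale_h c (word w))))"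
      unfolding ring_A.abs_eq_iff
      by (rule almost_all_congI[OF p_integral_almost_all[of c]])
        (auto simp: mhs partial_sum_linear intro!: cong_sym[OF rat_mod_mult_p_integral] int)
    finally show ?case
      using int p_integral_arith(2)
      by (auto simp: partial_sum_linear intro: finite_subset[OF _ p_integral_almost_all[of c]])
  next
    case (add u v)
    let ?B = "{p. prime p \<and> \<not> p_integral p (partial_sum p u)} \<union> {p. prime p \<and> \<not> p_integral p (partial_sum p v)}"
    have B: "finite ?B" using add by blast
    have "zeta_A (u + v) = zeta_A u + zeta_A v"
      by (simp add: zeta_A_def linear_extension_eq_lin[OF vector_space_scale_A] lin_add[OF vector_space_scale_A])
    also have "\<dots> = abs_ring_A (\<lambda>p. rat_mod p (partial_sum p u) + rat_mod p (partial_sum p v))"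
      using add by (simp add: plus_ring_A.abs_eq)
    also have "\<dots> = abs_ring_A (\<lambda>p. rat_mod p (partial_sum p (u + v)))"
      unfolding ring_A.abs_eq_iff
      by (rule almost_all_congI[OF B])
        (auto simp: partial_sum_linear intro!: cong_sym[OF rat_mod_add_p_integral])
    finally show ?case
      using p_integral_arith(1)
      by (auto simp: partial_sum_linear intro: finite_subset[OF _ B])
  qed
  then show "zeta_A u = abs_ring_A (\<lambda>p. rat_mod p (partial_sum p u))"
    and "finite {p. prime p \<and> \<not> p_integral p (partial_sum p u)}" by auto
qed

section \<open>The reflection of j to p - j modulo p\<close>

lemma fps_nth_li_0: "k > 0 \<Longrightarrow> fps_nth (li k) 0 = 0"
  by (simp add: li_def)

lemma minus_one_power_abs_ring_A: "(- 1) ^ n * abs_ring_A f = abs_ring_A (\<lambda>p. (- 1) ^ n * f p)"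
  by (induction n) (simp_all add: uminus_ring_A.abs_eq mult.assoc)

text \<open>The congruence is stated in the rationals with an explicit \<open>p\<close>-integral
  error factor, so that it can be multiplied by coefficients and summed before reduction.\<close>

lemma inverse_power_diff_mod:
  assumes "prime p" "0 < j" "j < p"
  obtains z where "p_integral p z" "1 / of_nat (p - j) ^ n = (- 1) ^ n * (1 / of_nat j ^ n) + of_nat p * z"
proof -
  have "[(int j - int p) ^ n = int j ^ n] (mod int p)"
    by (intro cong_pow) (simp add: cong_iff_dvd_diff)
  then have "[int j ^ n - (int j - int p) ^ n = 0] (mod int p)"
    by (metis cong_diff_iff_cong_0 cong_sym)
  then obtain a where a: "int j ^ n - (int j - int p) ^ n = int p * a"
    by (auto simp: cong_0_iff)
  have neg: "(int j - int p) ^ n = (- 1) ^ n * int (p - j) ^ n"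
    using assms by (simp add: of_nat_diff flip: power_mult_distrib)
  have a': "(of_nat j ^ n - (- 1) ^ n * of_nat (p - j) ^ n :: rat) = of_nat p * of_int a"
    using arg_cong[OF a, of "of_int :: int \<Rightarrow> rat"] unfolding neg by simp
  \<comment> \<open>Over the common denominator the difference of the inverse powers has numerator
    \<open>p * a\<close>.\<close>
  let ?z = "of_int a * (1 / of_nat j ^ n) * (1 / of_nat (p - j) ^ n) :: rat"
  have "p_integral p ?z"
    using assms by (intro p_integral_arith p_integral_of_int p_integral_inverse_power) auto
  moreover have "1 / of_nat (p - j) ^ n = (- 1) ^ n * (1 / of_nat j ^ n) + of_nat p * ?z"
  proof -
    have "of_nat p * ?z = (of_nat j ^ n - (- 1) ^ n * of_nat (p - j) ^ n) * ((1 / of_nat j ^ n) * (1 / of_nat (p - j) ^ n) :: rat)"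
      unfolding a' by simp
    also have "\<dots> = 1 / of_nat (p - j) ^ n - (- 1) ^ n * (1 / of_nat j ^ n)"
    proof -
      have "(X - s * Y) * (1 / X * (1 / Y)) = 1 / Y - s * (1 / X)" if "X \<noteq> 0" "Y \<noteq> 0" for X Y s :: rat
        using that by (simp add: field_simps)
      then show ?thesis using assms by simp
    qed
    finally show ?thesis by simp
  qed
  ultimately show ?thesis using that by blast
qed

lemma p_integral_Li:
  assumes "prime p" "is_index l" "n < p"
  shows "p_integral p (fps_nth (Li (sh l)) n)"
  using assms(2,3)
proof (induction l arbitrary: n)
  case Nil
  then show ?case using p_integral_Li_word[OF assms(1), of n "[]"] by (simp add: sh_simps Li_1)
next
  case (Cons k l)
  have li: "p_integral p (fps_nth (li k) j)" if "j < p" for j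
    using that Cons.prems p_integral_inverse_power[OF assms(1), of j k] p_integral_of_int[OF assms(1), of 0]
    by (cases "j = 0") (simp_all add: li_def is_index_def power_0_left)
  have "fps_nth (Li (sh (k # l))) n = (\<Sum>i=0..n. fps_nth (li k) i * fps_nth (Li (sh l)) (n - i) :: rat)"
    using Cons.prems by (simp add: sh_simps Li_shuffle y_gen_hoffman1 sh_hoffman1 Li_y_gen is_index_def fps_mult_nth)
  also have "p_integral p \<dots>"
    using Cons by (intro p_integral_sum[OF assms(1)] p_integral_arith(2)[OF assms(1)] li Cons.IH) (auto simp: is_index_def)
  finally show ?case .
qed

lemma fps_nth_Li_sh_0: "is_index l \<Longrightarrow> l \<noteq> [] \<Longrightarrow> fps_nth (Li (sh l)) 0 = 0"
  by (cases l) (simp_all add: Li_sh fps_nth_li_0 is_index_def)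

lemma omega_sum_eq:
  assumes "is_index (l @ [k])" 
  shows "omega_sum n (l @ [k]) = (\<Sum>j<n. fps_nth (Li (sh l)) j * (1 / of_nat (n - j) ^ k))"
proof -
  have "omega_sum n (l @ [k]) = fps_nth (prod_list (map li (l @ [k]))) n"
    using assms by (subst fps_nth_prod_list) (auto simp: fps_nth_li_0 is_index_def omega_sum_def inv_powers_def li_def)
  also have "\<dots> = (\<Sum>j=0..n. fps_nth (Li (sh l)) j * fps_nth (li k) (n - j))"
    using assms by (simp add: fps_mult_nth Li_sh is_index_def)
  also have "\<dots> = (\<Sum>j<n. fps_nth (Li (sh l)) j * (1 / of_nat (n - j) ^ k))"
    using assms by (intro sum.mono_neutral_cong_right) (auto simp: li_def is_index_def)
  finally show ?thesis .
qed

lemma omega_A_eq: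
  assumes "is_index (l @ [k])" "l \<noteq> []"
  shows "omega_A (l @ [k]) = (- 1) ^ k * zeta_A (x\<^sub>0 ^ k * sh l)"
proof -
  have idx: "is_index l" "k > 0" using assms by (auto simp: is_index_def)
  have mem: "x\<^sub>0 ^ k * sh l \<in> hoffman1"
    using sh_pos[OF assms(2)] by (intro hoffman1_pos_subset hoffman1_pos_mult)
  have "[rat_mod p (omega_sum p (l @ [k])) = (- 1) ^ k * rat_mod p (partial_sum p (x\<^sub>0 ^ k * sh l))] (mod int p)"
    if p: "prime p" for p
  proof -
    let ?g = "\<lambda>j. fps_nth (Li (sh l)) j :: rat"
    have "\<exists>z. \<forall>j\<in>{1..<p}. p_integral p (z j) \<and> 1 / of_nat (p - j) ^ k = (- 1) ^ k * (1 / of_nat j ^ k) + of_nat p * z j"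
      using inverse_power_diff_mod[OF p] by (intro bchoice) (metis atLeastLessThan_iff less_eq_Suc_le One_nat_def)
    then obtain z where z: "\<And>j. j \<in> {1..<p} \<Longrightarrow> p_integral p (z j)"
      "\<And>j. j \<in> {1..<p} \<Longrightarrow> 1 / of_nat (p - j) ^ k = (- 1) ^ k * (1 / of_nat j ^ k) + of_nat p * z j"
      by blast
    \<comment> \<open>The term \<open>j = 0\<close> must go before reflecting, as
      \<open>p - 0\<close> is not invertible modulo \<open>p\<close>; its coefficient is 0 because
      \<open>l\<close> is nonempty.\<close>
    have drop0: "(\<Sum>j<p. ?g j * h j) = (\<Sum>j\<in>{1..<p}. ?g j * h j)" for h
      using fps_nth_Li_sh_0[OF idx(1) assms(2), where 'a = rat]
      by (intro sum.mono_neutral_right) (auto simp: not_le Suc_le_eq)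
    let ?T = "\<Sum>j\<in>{1..<p}. ?g j * (1 / of_nat j ^ k)"
    let ?E = "\<Sum>j\<in>{1..<p}. ?g j * z j"
    have T: "partial_sum p (x\<^sub>0 ^ k * sh l) = ?T"
      using drop0[of "\<lambda>j. 1 / of_nat j ^ k"] by (simp add: partial_sum_def fps_nth_Li_x0_power)
    have eq: "omega_sum p (l @ [k]) = of_int ((- 1) ^ k) * ?T + of_int (int p) * ?E"
    proof -
      have "omega_sum p (l @ [k]) = (\<Sum>j\<in>{1..<p}. ?g j * ((- 1) ^ k * (1 / of_nat j ^ k) + of_nat p * z j))"
        unfolding omega_sum_eq[OF assms(1)] drop0 by (intro sum.cong refl) (simp only: z(2))
      then show ?thesis by (simp add: distrib_left sum.distrib sum_distrib_left mult_ac)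
    qed
    have int: "p_integral p ?T" "p_integral p ?E"
      by (intro p_integral_sum[OF p] p_integral_arith(2)[OF p] p_integral_Li[OF p]
        p_integral_inverse_power[OF p] idx z(1); simp)+
    have "[rat_mod p (omega_sum p (l @ [k])) = rat_mod p (of_int ((- 1) ^ k) * ?T) + rat_mod p (of_int (int p) * ?E)] (mod int p)"
      unfolding eq by (intro rat_mod_add_p_integral[OF p] p_integral_arith(2)[OF p] p_integral_of_int[OF p] int)
    also have "[rat_mod p (of_int ((- 1) ^ k) * ?T) + rat_mod p (of_int (int p) * ?E) =
        rat_mod p (of_int ((- 1) ^ k)) * rat_mod p ?T + rat_mod p (of_int (int p)) * rat_mod p ?E] (mod int p)"
      by (intro cong_add rat_mod_mult_p_integral[OF p] p_integral_of_int[OF p] int)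
    also have "[rat_mod p (of_int ((- 1) ^ k)) * rat_mod p ?T + rat_mod p (of_int (int p)) * rat_mod p ?E =
        (- 1) ^ k * rat_mod p ?T + int p * rat_mod p ?E] (mod int p)"
      by (intro cong_add cong_mult cong_refl rat_mod_of_int[OF p])
    also have "[(- 1) ^ k * rat_mod p ?T + int p * rat_mod p ?E = (- 1) ^ k * rat_mod p ?T] (mod int p)"
      by (simp add: cong_iff_dvd_diff)
    finally show ?thesis unfolding T .
  qed
  then have "almost_all_cong (\<lambda>p. rat_mod p (omega_sum p (l @ [k])))
      (\<lambda>p. (- 1) ^ k * rat_mod p (partial_sum p (x\<^sub>0 ^ k * sh l)))"
    by (intro almost_all_congI[of "{}"]) auto
  then show ?thesis
    by (simp add: omega_A_def zeta_A_eq_partial_sum(1)[OF mem] minus_one_power_abs_ring_A ring_A.abs_eq_iff)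
qed

section \<open>Multiple zeta values as values of series\<close>

lemma Li_word_nonneg: "0 \<le> fps_nth (Li_word w :: real fps) n"
  by (induction w arbitrary: n rule: Li_word.induct) (auto intro!: divide_nonneg_nonneg sum_nonneg)

lemma harm_ge_1: "n > 0 \<Longrightarrow> (harm n :: real) \<ge> 1"
  using harm_mono[of 1 n, where 'a = real] by (simp add: harm_def)

text \<open>Each x_1 costs at most a factor \<open>harm n\<close>; each x_0 divides by positive
  integers and costs nothing.\<close>

lemma sum_Li_word_le: "(\<Sum>j<n. fps_nth (Li_word w :: real fps) j) \<le> harm n ^ length w"
proof (induction w arbitrary: n rule: Li_word.induct)
  case 1
  then show ?case by simp
next
  case (2 w)
  have "(\<Sum>j<n. fps_nth (Li_word (L0 # w) :: real fps) j) \<le> (\<Sum>j<n. fps_nth (Li_word w :: real fps) j)"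
  proof (rule sum_mono)
    fix j
    show "fps_nth (Li_word (L0 # w)) j \<le> fps_nth (Li_word w :: real fps) j"
      using Li_word_nonneg[of w j] by (cases "j = 0") (auto simp: field_simps mult_le_cancel_right1)
  qed
  also have "\<dots> \<le> harm n ^ length w" by (rule 2)
  finally have "(\<Sum>j<n. fps_nth (Li_word (L0 # w) :: real fps) j) \<le> harm n ^ length w" .
  moreover have "harm n ^ length w \<le> (harm n ^ Suc (length w) :: real)" if "n > 0"
    using harm_ge_1[OF that] by (intro power_increasing) auto
  ultimately show ?case by (cases "n = 0") (auto simp: harm_def)
next
  case (3 w)
  have "(\<Sum>j<n. fps_nth (Li_word (L1 # w) :: real fps) j) \<le> (\<Sum>j<n. harm n ^ length w * (1 / real j))"
  proof (rule sum_mono)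
    fix j assume j: "j \<in> {..<n}"
    have "(\<Sum>i<j. fps_nth (Li_word w :: real fps) i) \<le> harm j ^ length w"
      by (rule 3) (rule lessThan_iff[THEN iffD2], rule zero_less_one)
    also have "\<dots> \<le> harm n ^ length w"
      using j by (intro power_mono harm_mono harm_nonneg) auto
    finally show "fps_nth (Li_word (L1 # w)) j \<le> harm n ^ length w * (1 / real j)"
      by (auto intro: divide_right_mono)
  qed
  also have "\<dots> = harm n ^ length w * (\<Sum>j<n. 1 / real j)"
    by (simp add: sum_distrib_left)
  also have "\<dots> \<le> harm n ^ length w * harm n"
  proof (rule mult_left_mono)
    have "(\<Sum>j<n. 1 / real j) = (\<Sum>j\<in>{1..<n}. 1 / real j)"
      by (intro sum.mono_neutral_right) (auto simp: not_le Suc_le_eq)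
    also have "\<dots> \<le> (\<Sum>j\<in>{1..n}. 1 / real j)" by (intro sum_mono2) auto
    finally show "(\<Sum>j<n. 1 / real j) \<le> harm n" by (simp add: harm_def inverse_eq_divide)
  qed (simp add: harm_nonneg)
  finally show ?case by (simp add: mult.commute)
qed

text \<open>The division belonging to the first x_1 is kept and those of the x_0 before it are given
  away. One more x_0 in front then yields a summable bound.\<close>

lemma Li_word_le:
  assumes "word1 w" "w \<noteq> []" "n > 0"
  shows "fps_nth (Li_word w :: real fps) n \<le> harm n ^ length w / real n"
  using assms(1,2)
proof (induction w rule: Li_word.induct)
  case (2 w)
  then have w: "w \<noteq> []" "word1 w" by (auto simp: word1_def split: if_splits)
  have "fps_nth (Li_word (L0 # w)) n \<le> fps_nth (Li_word w :: real fps) n"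
    using Li_word_nonneg[of w n] assms(3) by (auto simp: field_simps mult_le_cancel_right1)
  also have "\<dots> \<le> harm n ^ length w / real n" by (rule 2) (use w in auto)
  also have "\<dots> \<le> harm n ^ length (L0 # w) / real n"
    using harm_ge_1[OF assms(3)] by (intro divide_right_mono power_increasing) auto
  finally show ?case .
next
  case (3 w)
  have "fps_nth (Li_word (L1 # w)) n \<le> harm n ^ length w / real n"
    by (auto intro: divide_right_mono sum_Li_word_le)
  also have "\<dots> \<le> harm n ^ length (L1 # w) / real n"
    using harm_ge_1[OF assms(3)] by (intro divide_right_mono power_increasing) auto
  finally show ?case .
qed simp

lemma harm_le_ln: "n > 0 \<Longrightarrow> harm n \<le> 1 + ln (real n)"
  using euler_mascheroni_sequence_decreasing[of 1 n] by (simp add: harm_def)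

lemma summable_harm_power: "summable (\<lambda>n. harm n ^ d / real n ^ 2)"
proof -
  have ln: "summable (\<lambda>n. (1 + ln (real n)) ^ d / real n ^ 2)"
  proof (rule summable_comparison_test_bigo)
    \<comment> \<open>Any exponent strictly between -2 and -1 is summable and leaves room for the
      logarithms.\<close>
    show "summable (\<lambda>n. norm (real n powr (-3/2)))"
      by (simp add: summable_real_powr_iff)
    show "(\<lambda>n. (1 + ln (real n)) ^ d / real n ^ 2) \<in> O(\<lambda>n. real n powr (-3/2))"
      by real_asymp
  qed
  show ?thesis
  proof (rule summable_comparison_test'[OF ln, of 1])
    fix n :: nat assume n: "n \<ge> 1"
    have "harm n ^ d \<le> (1 + ln (real n)) ^ d"
      using n by (intro power_mono harm_le_ln harm_nonneg) auto
    then show "norm (harm n ^ d / real n ^ 2) \<le> (1 + ln (real n)) ^ d / real n ^ 2"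
      using n by (simp add: harm_nonneg divide_right_mono)
  qed
qed

lemma harm_power_over_tendsto_0: "(\<lambda>n. harm n ^ d / real n) \<longlonglongrightarrow> 0"
proof (rule Lim_null_comparison)
  show "\<forall>\<^sub>F n in sequentially. norm (harm n ^ d / real n) \<le> (1 + ln (real n)) ^ d / real n"
    using eventually_gt_at_top[of 0]
  proof eventually_elim
    case (elim n)
    have "harm n ^ d \<le> (1 + ln (real n)) ^ d"
      using elim by (intro power_mono harm_le_ln harm_nonneg) auto
    then show ?case using elim by (simp add: harm_nonneg divide_right_mono)
  qed
  show "(\<lambda>n. (1 + ln (real n)) ^ d / real n) \<longlonglongrightarrow> 0"
    by real_asymp
qed

lemma summable_Li_x0:
  assumes "u \<in> hoffman1_pos"
  shows "summable (fps_nth (Li (x\<^sub>0 * u) :: real fps))"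
proof -
  obtain v where v: "u = v * x\<^sub>1" using assms by (auto simp: hoffman1_pos_def)
  show ?thesis unfolding v
  proof (induction v rule: hoffman_induct)
    case (word c w)
    have "summable (fps_nth (Li_word (L0 # w @ [L1]) :: real fps))"
    proof (rule summable_comparison_test'[OF summable_harm_power, of 1])
      fix n :: nat assume "n \<ge> 1"
      then have "fps_nth (Li_word (w @ [L1])) n \<le> harm n ^ length (w @ [L1]) / real n"
        by (intro Li_word_le) (auto simp: word1_def)
      then have "fps_nth (Li_word (w @ [L1])) n / real n \<le> harm n ^ length (w @ [L1]) / real n / real n"
        by (rule divide_right_mono) simp
      then show "norm (fps_nth (Li_word (L0 # w @ [L1]) :: real fps) n) \<le> harm n ^ length (w @ [L1]) / real n ^ 2"
        using Li_word_nonneg[of "w @ [L1]" n] by (simp add: power2_eq_square)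
    qed
    then have "summable (\<lambda>n. of_rat c * fps_nth (Li_word (L0 # w @ [L1]) :: real fps) n)"
      by (rule summable_mult)
    then show ?case
      by (simp add: scale_h_mult_left scale_h_mult_right Li_linear flip: word_append)
  next
    case (add u v)
    then show ?case
      by (simp add: distrib_left distrib_right Li_linear summable_add)
  qed
qed

text \<open>Meaningful on \<open>\<hh>\<^sup>0\<close>, where the series converges absolutely.\<close>

definition zeta0 :: "hoffman \<Rightarrow> real" where
  "zeta0 u = suminf (fps_nth (Li u))"

text \<open>h^0 as the kernel of a derivation, so that membership of \<open>reg u\<close> is
  \<open>dl_reg\<close>.\<close>

definition hoffman0 :: "hoffman set" where
  "hoffman0 = {u \<in> hoffman1. dl L1 u = 0}"

lemma hoffman0_abs_summable: "u \<in> hoffman0 \<Longrightarrow> summable (\<lambda>n. norm (fps_nth (Li u :: real fps) n))"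
proof -
  assume "u \<in> hoffman0"
  then have "u \<in> hoffman1" "dl L1 u = 0" by (auto simp: hoffman0_def)
  then show ?thesis
  proof (induction u rule: hoffman0_induct)
    case (word c w)
    have "summable (fps_nth (Li_word w :: real fps))"
    proof (cases w)
      case Nil
      then show ?thesis by (intro summable_finite[of "{0}"]) auto
    next
      case (Cons a v)
      then have "a = L0" "v \<noteq> []" "last v = L1"
        using word by (auto simp: word0_def word1_def split: if_splits)
      then show ?thesis
        using summable_Li_x0[OF hoffman1_pos_word[of v]] Cons by (simp add: Li_linear flip: word_Cons)
    qed
    then have "summable (\<lambda>n. \<bar>of_rat c\<bar> * fps_nth (Li_word w :: real fps) n)"
      by (rule summable_mult)
    then show ?case by (simp add: Li_linear abs_mult Li_word_nonneg)
  next
    case (add u v)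
    then show ?case
      by (intro summable_comparison_test'[OF summable_add[OF add(5,6)]]) (simp add: Li_linear abs_triangle_ineq)
  qed
qed

lemma hoffman0_summable: "u \<in> hoffman0 \<Longrightarrow> summable (fps_nth (Li u :: real fps))"
  using hoffman0_abs_summable summable_norm_cancel by blast

lemma zeta0_add: "u \<in> hoffman0 \<Longrightarrow> v \<in> hoffman0 \<Longrightarrow> zeta0 (u + v) = zeta0 u + zeta0 v"
proof -
  assume "u \<in> hoffman0" "v \<in> hoffman0"
  moreover have "fps_nth (Li u + Li v) = (\<lambda>n. fps_nth (Li u :: real fps) n + fps_nth (Li v) n)" by auto
  ultimately show ?thesis by (simp add: zeta0_def Li_linear hoffman0_summable suminf_add)
qed

lemma zeta0_scale: "u \<in> hoffman0 \<Longrightarrow> zeta0 (scale_h c u) = of_rat c * zeta0 u"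
proof -
  assume "u \<in> hoffman0"
  moreover have "fps_nth (fps_const (of_rat c) * Li u) = (\<lambda>n. of_rat c * fps_nth (Li u :: real fps) n)" by auto
  ultimately show ?thesis by (simp add: zeta0_def Li_linear hoffman0_summable suminf_mult)
qed

lemma zeta0_shuffle: "u \<in> hoffman0 \<Longrightarrow> v \<in> hoffman0 \<Longrightarrow> zeta0 (u \<squnion>\<squnion> v) = zeta0 u * zeta0 v"
proof -
  assume uv: "u \<in> hoffman0" "v \<in> hoffman0"
  then have "Li (u \<squnion>\<squnion> v) = (Li u * Li v :: real fps)"
    by (simp add: Li_shuffle hoffman0_def)
  moreover have "fps_nth (Li u * Li v) = (\<lambda>n. \<Sum>i\<le>n. fps_nth (Li u :: real fps) i * fps_nth (Li v) (n - i))"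
    by (auto simp: fps_mult_nth atLeast0AtMost)
  ultimately show ?thesis
    using Cauchy_product[OF hoffman0_abs_summable[OF uv(1)] hoffman0_abs_summable[OF uv(2)]] by (simp add: zeta0_def)
qed

lemma zeta0_1: "zeta0 1 = 1"
  unfolding zeta0_def by (subst suminf_finite[of "{0}"]) (auto simp: Li_1)

lemma admissible_hoffman0:
  assumes "admissible k"
  shows "y_index k \<in> hoffman0"
proof (cases k)
  case Nil
  then show ?thesis by (simp add: hoffman0_def y_index_def hoffman1_one dl_word)
next
  case (Cons a l)
  then obtain b where "a = Suc (Suc b)"
    using assms by (auto simp: admissible_def numeral_2_eq_2 Suc_le_eq dest: less_imp_Suc_add)
  then have "dl L1 (y_index k) = 0"
    using Cons by (simp add: y_index_eq_word y_word_Cons dl_word)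
  then show ?thesis by (simp add: hoffman0_def y_index_hoffman1)
qed

text \<open>\<open>mzv\<close> is an unordered sum, \<open>zeta0\<close> one ordered by the largest
  entry. The summands are nonnegative and the sets \<open>tuples_below\<close> exhaust all finite
  sets of tuples, so the two limits agree.\<close>

lemma mzv_eq_zeta0:
  assumes "admissible k"
  shows "mzv k = zeta0 (y_index k)"
proof -
  let ?A = "decreasing_tuples (length k)"
  let ?f = "inv_powers k :: nat list \<Rightarrow> real"
  let ?g = "fps_nth (Li_word (y_word k) :: real fps)"
  have idx: "is_index k" using assms by (simp add: admissible_def)
  have summ: "summable ?g"
    using hoffman0_summable[OF admissible_hoffman0[OF assms]] by (simp add: y_index_eq_word Li_linear)
  have nonneg: "?f m \<ge> 0" for m
    by (simp add: inv_powers_def prod_nonneg)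
  have part: "sum ?f (tuples_below (Suc n) (length k)) = sum ?g {..<Suc n}" for n
    by (rule sum_tuples_below[OF idx]) simp
  have cover: "\<exists>n. F \<subseteq> tuples_below (Suc n) (length k)" if "finite F" "F \<subseteq> ?A" for F
  proof -
    have fin: "finite (\<Union>m\<in>F. set m)" using that by simp
    from finite_nat_set_iff_bounded_le[THEN iffD1, OF this]
    obtain n where "\<And>m a. m \<in> F \<Longrightarrow> a \<in> set m \<Longrightarrow> a \<le> n" by auto
    then have "F \<subseteq> tuples_below (Suc n) (length k)"
      using that by (force simp: tuples_below_def less_Suc_eq_le)
    then show ?thesis ..
  qed
  have mono: "tuples_below a r \<subseteq> tuples_below b r" if "a \<le> b" for a b r
    using that by (force simp: tuples_below_def)
  have "?f summable_on ?A"
  proof (rule nonneg_bdd_above_summable_on)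
    show "bdd_above (sum ?f ` {F. F \<subseteq> ?A \<and> finite F})"
    proof (rule bdd_aboveI2)
      fix F assume "F \<in> {F. F \<subseteq> ?A \<and> finite F}"
      then obtain n where "F \<subseteq> tuples_below (Suc n) (length k)" using cover by blast
      then have "sum ?f F \<le> sum ?f (tuples_below (Suc n) (length k))"
        by (intro sum_mono2 finite_tuples_below nonneg)
      also have "\<dots> \<le> suminf ?g"
        unfolding part by (intro sum_le_suminf summ) (auto simp: Li_word_nonneg)
      finally show "sum ?f F \<le> suminf ?g" .
    qed
  qed (rule nonneg)
  then have "(?f has_sum mzv k) ?A"
    unfolding mzv_def by (rule has_sum_infsum)
  then have lim: "(sum ?f \<longlongrightarrow> mzv k) (finite_subsets_at_top ?A)"
    by (simp add: has_sum_def)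
  have "filterlim (\<lambda>n. tuples_below (Suc n) (length k)) (finite_subsets_at_top ?A) sequentially"
  proof (rule filterlim_finite_subsets_at_top[THEN iffD2], intro allI impI)
    fix F assume "finite F \<and> F \<subseteq> ?A"
    then obtain n where n: "F \<subseteq> tuples_below (Suc n) (length k)" using cover by blast
    show "\<forall>\<^sub>F n in sequentially. finite (tuples_below (Suc n) (length k)) \<and>
        F \<subseteq> tuples_below (Suc n) (length k) \<and> tuples_below (Suc n) (length k) \<subseteq> ?A"
      using eventually_ge_at_top[of n]
    proof eventually_elim
      case (elim m)
      then show ?case
        using n mono[of "Suc n" "Suc m" "length k"] by (auto simp: finite_tuples_below) (auto simp: tuples_below_def)
    qed
  qed
  from filterlim_compose[OF lim this] have "(\<lambda>n. sum ?g {..<Suc n}) \<longlonglongrightarrow> mzv k"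
    unfolding part .
  moreover have "(\<lambda>n. sum ?g {..<Suc n}) \<longlonglongrightarrow> suminf ?g"
    using summable_LIMSEQ[OF summ] by (rule LIMSEQ_Suc)
  ultimately show ?thesis
    unfolding zeta0_def y_index_eq_word Li_linear using LIMSEQ_unique by blast
qed

section \<open>The shuffle regularized multiple zeta values\<close>

lemma reg_hoffman0: "u \<in> hoffman1 \<Longrightarrow> reg u \<in> hoffman0"
  by (simp add: hoffman0_def reg_hoffman1 dl_reg)

lemma hoffman0_subset: "u \<in> hoffman0 \<Longrightarrow> u \<in> hoffman1"
  by (simp add: hoffman0_def)

lemma reg_eq_self_hoffman0: "u \<in> hoffman0 \<Longrightarrow> reg u = u"
  by (simp add: hoffman0_def reg_eq_self)

lemma x1_hoffman1: "x\<^sub>1 \<in> hoffman1"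
  by (simp add: hoffman1_word word1_def)

lemma is_shuffle_regularization_reg: "is_shuffle_regularization (restrict (\<lambda>u. zeta0 (reg u)) hoffman1)"
  unfolding is_shuffle_regularization_def
proof (intro conjI ballI allI impI)
  have "1 \<in> hoffman0" by (simp add: hoffman0_def hoffman1_one dl_word)
  then show "restrict (\<lambda>u. zeta0 (reg u)) hoffman1 1 = 1"
    by (simp add: hoffman1_one reg_eq_self_hoffman0 zeta0_1)
  fix k assume "admissible k"
  then show "restrict (\<lambda>u. zeta0 (reg u)) hoffman1 (y_index k) = mzv k"
    by (simp add: mzv_eq_zeta0 y_index_hoffman1 reg_eq_self_hoffman0 admissible_hoffman0)
next
  show "restrict (\<lambda>u. zeta0 (reg u)) hoffman1 x\<^sub>1 = 0"
    using zeta0_scale[of 1 0] by (simp add: x1_hoffman1 reg_x1 hoffman0_def hoffman1_one dl_word)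
qed (simp_all add: hoffman1_add hoffman1_scale hoffman1_shuffle reg_linear reg_shuffle zeta0_add zeta0_scale
  zeta0_shuffle reg_hoffman0)

text \<open>A positive divided power of x_1 is a multiple of a shuffle product with x_1, hence
  killed by \<open>Z\<close>. All terms of \<open>reg u\<close> but the first contain such a factor,
  so \<open>Z\<close> agrees on \<open>u\<close> and \<open>reg u\<close>; on h^0 it is
  prescribed.\<close>

lemma shuffle_regularization_unique:
  assumes "is_shuffle_regularization Z"
  shows "Z = restrict (\<lambda>u. zeta0 (reg u)) hoffman1"
proof (rule extensionalityI[of Z hoffman1])
  show "Z \<in> extensional hoffman1"
    using assms by (simp add: is_shuffle_regularization_def)
  have add: "Z (u + v) = Z u + Z v" if "u \<in> hoffman1" "v \<in> hoffman1" for u v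
    using assms that by (simp add: is_shuffle_regularization_def)
  have scale: "Z (scale_h c u) = of_rat c * Z u" if "u \<in> hoffman1" for c u
    using assms that by (simp add: is_shuffle_regularization_def)
  have mult: "Z (u \<squnion>\<squnion> v) = Z u * Z v" if "u \<in> hoffman1" "v \<in> hoffman1" for u v
    using assms that by (simp add: is_shuffle_regularization_def)
  have one: "Z 1 = 1" and x1: "Z x\<^sub>1 = 0" and adm: "admissible k \<Longrightarrow> Z (y_index k) = mzv k" for k
    using assms by (simp_all add: is_shuffle_regularization_def)
  have zero: "Z 0 = 0" using scale[OF hoffman1_one, of 0] by simp
  have sum: "Z (sum f A) = (\<Sum>a\<in>A. Z (f a))" if "\<And>a. a \<in> A \<Longrightarrow> f a \<in> hoffman1" for f and A :: "nat set"
    using that by (induction A rule: infinite_finite_induct) (simp_all add: zero add hoffman1_sum)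
  have pow: "Z (x1_pow (Suc n)) = 0" for n
  proof -
    have "x1_pow 1 \<squnion>\<squnion> x1_pow n = scale_h (of_nat (Suc n)) (x1_pow (Suc n))"
      by (subst x1_pow_shuffle) simp
    then have "of_rat (of_nat (Suc n)) * Z (x1_pow (Suc n)) = Z (x1_pow 1) * Z (x1_pow n)"
      by (metis mult scale x1_pow_hoffman1)
    also have "\<dots> = 0" using x1 by simp
    finally show ?thesis by (simp del: of_nat_Suc replicate.simps)
  qed
  have Z0: "Z u = zeta0 u" if "u \<in> hoffman0" for u
  proof -
    from that have "u \<in> hoffman1" "dl L1 u = 0" by (auto simp: hoffman0_def)
    then show ?thesis
    proof (induction u rule: hoffman0_induct)
      case (word c w)
      then obtain k where k: "admissible k" "w = y_word k" using word0_obtain_index by metis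
      then show ?case
        using adm[OF k(1)] mzv_eq_zeta0[OF k(1)] scale[OF y_index_hoffman1[of k]]
          zeta0_scale[OF admissible_hoffman0[OF k(1)]]
        by (simp add: y_index_eq_word)
    next
      case (add u v)
      then show ?case
        using assms zeta0_add[of u v] by (simp add: is_shuffle_regularization_def hoffman0_def)
    qed
  qed
  fix u assume u: "u \<in> hoffman1"
  obtain N where N: "reg u = (\<Sum>n\<le>N. reg_part n u)"
    by (rule reg_eq_sum[of u]) blast
  have part: "reg_part n u \<in> hoffman1" for n
    using u by (simp add: reg_part_def hoffman1_scale hoffman1_shuffle x1_pow_hoffman1 dl1_pow_hoffman1)
  have "Z (reg_part n u) = (if n = 0 then Z u else 0)" for n
  proof (cases n)
    case 0
    then show ?thesis using u by (simp add: reg_part_def word_Nil)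
  next
    case (Suc m)
    have "Z (reg_part (Suc m) u) = of_rat ((- 1) ^ Suc m) * (Z (x1_pow (Suc m)) * Z (dl1_pow (Suc m) u))"
      unfolding reg_part_def
      by (simp only: scale mult hoffman1_shuffle x1_pow_hoffman1 dl1_pow_hoffman1 u)
    then show ?thesis by (simp only: Suc pow) simp
  qed
  then have "Z (reg u) = Z u"
    unfolding N by (subst sum) (simp_all add: part)
  then show "Z u = restrict (\<lambda>u. zeta0 (reg u)) hoffman1 u"
    using u by (simp add: Z0 reg_hoffman0)
qed simp

lemma zeta_sh_is_regularization: "is_shuffle_regularization zeta_sh"
  unfolding zeta_sh_def
  by (rule theI[of is_shuffle_regularization, OF is_shuffle_regularization_reg shuffle_regularization_unique])

lemma zeta_sh_eq: "u \<in> hoffman1 \<Longrightarrow> zeta_sh u = zeta0 (reg u)"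
  by (subst shuffle_regularization_unique[OF zeta_sh_is_regularization]) simp

lemma zeta_sh_hoffman0: "u \<in> hoffman0 \<Longrightarrow> zeta_sh u = zeta0 u"
  by (simp add: zeta_sh_eq hoffman0_subset reg_eq_self_hoffman0)

lemma zeta_sh_hom:
  "u \<in> hoffman1 \<Longrightarrow> v \<in> hoffman1 \<Longrightarrow> zeta_sh (u + v) = zeta_sh u + zeta_sh v"
  "u \<in> hoffman1 \<Longrightarrow> zeta_sh (scale_h c u) = of_rat c * zeta_sh u"
  "u \<in> hoffman1 \<Longrightarrow> v \<in> hoffman1 \<Longrightarrow> zeta_sh (u \<squnion>\<squnion> v) = zeta_sh u * zeta_sh v"
  using zeta_sh_is_regularization by (simp_all add: is_shuffle_regularization_def)

lemma zeta_sh_0: "zeta_sh 0 = 0"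
  using zeta_sh_hom(2)[OF hoffman1_one, of 0] by simp

lemma zeta_sh_diff:
  assumes "u \<in> hoffman1" "v \<in> hoffman1"
  shows "zeta_sh (u - v) = zeta_sh u - zeta_sh v"
  using zeta_sh_hom(1)[of "u - v" v] assms by (simp add: hoffman1_diff)

lemma zeta_sh_sum: "(\<And>a. a \<in> A \<Longrightarrow> f a \<in> hoffman1) \<Longrightarrow> zeta_sh (sum f A) = (\<Sum>a\<in>A. zeta_sh (f a))"
  by (induction A rule: infinite_finite_induct) (simp_all add: zeta_sh_0 zeta_sh_hom hoffman1_sum)

section \<open>Symmetric multiple zeta values\<close>

lemma split_word_hoffman1: "P \<in> hoffman1_pos \<Longrightarrow> word1 w \<Longrightarrow> split_word P w \<in> hoffman1"
proof (induction P w rule: split_word.induct)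
  case (2 P a w)
  then have "split_word (word [a] * P) w \<in> hoffman1" "P \<squnion>\<squnion> word w \<in> hoffman1"
    by (auto dest: word1_ConsD intro: hoffman1_pos_mult hoffman1_shuffle hoffman1_word hoffman1_pos_subset)
  then show ?case by (cases a) (simp_all add: hoffman1_diff hoffman1_uminus)
qed (simp add: hoffman1_0)

lemma split_hoffman1:
  assumes "P \<in> hoffman1_pos" "u \<in> hoffman1"
  shows "split P u \<in> hoffman1"
  using assms(2)
  by (induction u rule: hoffman1_induct)
    (simp_all add: split_linear hoffman1_add hoffman1_scale split_word_hoffman1 assms(1))

text \<open>There is no cut inside a block of x_0; its letters only move to the prefix.\<close>

lemma split_x0_power: "split P (x\<^sub>0 ^ j * u) = scale_h ((- 1) ^ j) (split (x\<^sub>0 ^ j * P) u)"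
proof (induction j arbitrary: P)
  case (Suc j)
  have "split P (x\<^sub>0 ^ Suc j * u) = - split (x\<^sub>0 * P) (x\<^sub>0 ^ j * u)"
    by (simp add: mult.assoc split_mult)
  also have "\<dots> = scale_h ((- 1) ^ Suc j) (split (x\<^sub>0 ^ Suc j * P) u)"
    by (simp add: Suc mult.assoc power_Suc2 del: power_Suc)
  finally show ?case .
qed simp

lemma y_index_Cons: "y_index (k # l) = x\<^sub>0 ^ (k - 1) * (x\<^sub>1 * y_index l)"
  by (simp add: y_index_def y_gen_def mult.assoc)

lemma x1_y_index_pos: "x\<^sub>1 * y_index p \<in> hoffman1_pos"
proof -
  have "x\<^sub>1 * y_index p = word (L1 # y_word p)"
    by (simp add: y_index_eq_word flip: word_Cons)
  then show ?thesis
    using word1_y_word[of p] by (auto intro!: hoffman1_pos_word simp: word1_def)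
qed

text \<open>Cutting at the \<open>a\<close>-th x_1 leaves the first \<open>a\<close> blocks without
  their last letter. Reversed, they lack exactly the x_1 supplied by the prefix, which makes them
  the word of the reversed index. The missing letter also shifts the sign exponent by one, hence the
  overall minus.\<close>

lemma zeta_sh_split_y_index:
  assumes "is_index l"
  shows "zeta_sh (split (x\<^sub>1 * y_index p) (y_index l)) =
    - (\<Sum>a<length l. (- 1) ^ sum_list (take (Suc a) l) * zeta_sh (y_index (rev (take (Suc a) l) @ p)) * zeta_sh (y_index (drop (Suc a) l)))"
  using assms
proof (induction l arbitrary: p)
  case Nil
  have "split P (y_index []) = 0" for P
    by (simp add: y_index_eq_word y_word_Nil split_linear)
  then show ?case by (simp add: zeta_sh_0)
next
  case (Cons k l)
  then have k: "k > 0" "is_index l" by (auto simp: is_index_def)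
  have "split (x\<^sub>1 * y_index p) (y_index (k # l)) =
      scale_h ((- 1) ^ (k - 1)) ((y_index (k # p) \<squnion>\<squnion> y_index l) - split (x\<^sub>1 * y_index (k # p)) (y_index l))"
    by (simp add: y_index_Cons split_x0_power split_mult)
  then have "zeta_sh (split (x\<^sub>1 * y_index p) (y_index (k # l))) =
      (- 1) ^ (k - 1) * (zeta_sh (y_index (k # p)) * zeta_sh (y_index l) - zeta_sh (split (x\<^sub>1 * y_index (k # p)) (y_index l)))"
    by (simp add: zeta_sh_hom zeta_sh_diff hoffman1_diff hoffman1_shuffle split_hoffman1 y_index_hoffman1 x1_y_index_pos of_rat_power)
  moreover have "(- 1) ^ (k - 1) = - ((- 1 :: real) ^ k)"
    using k by (cases k) simp_all
  ultimately show ?case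
    using Cons.IH[OF k(2), of "k # p"]
    by (simp add: sum.lessThan_Suc_shift power_add mult.assoc sum_distrib_left sum_negf algebra_simps del: sum.lessThan_Suc)
qed

lemma zeta_S_sh_eq:
  assumes "is_index l"
  shows "zeta_S_sh l = zeta_sh (y_index l) - zeta_sh (split x\<^sub>1 (y_index l))"
proof -
  have "y_index [] = 1" by (simp add: y_index_def)
  moreover have "zeta_sh 1 = 1"
    using zeta_sh_is_regularization by (simp add: is_shuffle_regularization_def)
  ultimately show ?thesis
    using zeta_sh_split_y_index[OF assms, of "[]"]
    by (simp add: zeta_S_sh_def sum.atMost_shift)
qed

lemma complex_of_real_of_rat: "complex_of_real (of_rat c) = of_rat c"
  by (cases c) (simp add: of_rat_rat)

lemma zeta_S_eq:
  assumes "u \<in> hoffman1"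
  shows "zeta_S u = abs_quot_S (complex_of_real (zeta_sh u - zeta_sh (split x\<^sub>1 u)))"
  using assms
proof (induction u rule: hoffman1_induct)
  case (word c w)
  obtain k where k: "is_index k" "w = y_word k" using word word1_obtain_index by metis
  have x1: "x\<^sub>1 \<in> hoffman1_pos" by (simp add: hoffman1_pos_word)
  have "zeta_S (scale_h c (word w)) = scale_S c (zeta_S_index k)"
    using linear_extension_y_index[OF vector_space_scale_S k(1), of zeta_S_index]
    by (simp add: zeta_S_def linear_extension_eq_lin[OF vector_space_scale_S] lin_scale[OF vector_space_scale_S]
      y_index_eq_word k(2))
  also have "\<dots> = abs_quot_S (complex_of_real (zeta_sh (scale_h c (word w)) - zeta_sh (split x\<^sub>1 (scale_h c (word w)))))"
    using word x1 by (simp add: zeta_S_index_def scale_S.abs_eq zeta_S_sh_eq[OF k(1)] split_linear zeta_sh_hom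
      hoffman1_word split_word_hoffman1 y_index_eq_word flip: k(2) right_diff_distrib complex_of_real_of_rat)
  finally show ?case .
next
  case (add u v)
  have x1: "x\<^sub>1 \<in> hoffman1_pos" by (simp add: hoffman1_pos_word)
  have "zeta_S (u + v) = zeta_S u + zeta_S v"
    by (simp add: zeta_S_def linear_extension_eq_lin[OF vector_space_scale_S] lin_add[OF vector_space_scale_S])
  then show ?case
    using add x1 by (simp add: plus_quot_S.abs_eq split_linear zeta_sh_hom split_hoffman1 add_diff_add)
qed

text \<open>
  A signed sum of Mordell-Tornheim zeta values, which turns out to be \<open>\<Omega>(k)\<close>.
\<close>

definition omega_value :: "nat list \<Rightarrow> real" where
  "omega_value k = (\<Sum>a<length k. (- 1) ^ (k ! a) * zeta0 (x\<^sub>0 ^ (k ! a) * sh (omit a k)))"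

lemma sh_snoc: "sh (l @ [k]) = y_gen k \<squnion>\<squnion> sh l"
  by (induction l) (simp_all add: sh_simps shuffle.left_commute)

lemma x0_power_hoffman0:
  assumes "k > 0" "u \<in> hoffman1_pos"
  shows "x\<^sub>0 ^ k * u \<in> hoffman0"
  using assms by (cases k) (auto simp: hoffman0_def mult.assoc dl_mult intro!: hoffman1_pos_subset hoffman1_pos_mult)

text \<open>Moving \<open>x\<^sub>0 ^ k\<close> to the prefix makes y_k one of the shuffled factors
  in every term of \<open>split_sh\<close>, so the last entry loses its special role. All terms lie
  in h^0, where regularization has no effect.\<close>

lemma zeta_S_x0_power_sh:
  assumes "is_index (l @ [k])" "l \<noteq> []"
  shows "scale_S ((- 1) ^ k) (zeta_S (x\<^sub>0 ^ k * sh l)) = abs_quot_S (complex_of_real (omega_value (l @ [k])))"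
proof -
  have k: "k > 0" "is_index l" using assms by (auto simp: is_index_def)
  let ?u = "x\<^sub>0 ^ k * sh l"
  let ?s = "\<lambda>a. x\<^sub>0 ^ (l ! a) * (y_gen k \<squnion>\<squnion> sh (omit a l))"
  have u: "?u \<in> hoffman0" by (rule x0_power_hoffman0[OF k(1) sh_pos[OF assms(2)]])
  have s: "?s a \<in> hoffman0" if "a < length l" for a
    using that k sh_pos[of "omit a l @ [k]"]
    by (intro x0_power_hoffman0) (auto simp: is_index_def sh_snoc)
  have split_term: "split_term L0 (y_gen k) (l ! a) (sh (omit a l)) = scale_h (- ((- 1) ^ (l ! a))) (?s a)" if "a < length l" for a
  proof -
    have "l ! a > 0" using that k by (simp add: is_index_def)
    then obtain j where "l ! a = Suc j" using gr0_conv_Suc by blast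
    then show ?thesis by (simp add: split_term_def mult.assoc power_Suc2 del: power_Suc)
  qed
  have "split x\<^sub>1 ?u = scale_h ((- 1) ^ k) (split (x\<^sub>0 ^ k * x\<^sub>1) (sh l))"
    by (rule split_x0_power)
  also have "x\<^sub>0 ^ k * x\<^sub>1 = x\<^sub>0 * y_gen k"
    using k by (cases k) (simp_all add: y_gen_def mult.assoc)
  also have "split (x\<^sub>0 * y_gen k) (sh l) = omit_sum (split_term L0 (y_gen k)) l"
    by (rule split_sh[OF k(2)])
  also have "\<dots> = (\<Sum>a<length l. scale_h (- ((- 1) ^ (l ! a))) (?s a))"
    unfolding omit_sum_def by (intro sum.cong refl split_term) simp
  finally have "zeta_sh (split x\<^sub>1 ?u) = of_rat ((- 1) ^ k) * zeta_sh (\<Sum>a<length l. scale_h (- ((- 1) ^ (l ! a))) (?s a))"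
    by (simp only:) (rule zeta_sh_hom(2), intro hoffman1_sum hoffman1_scale hoffman0_subset s, simp)
  also have "zeta_sh (\<Sum>a<length l. scale_h (- ((- 1) ^ (l ! a))) (?s a)) = (\<Sum>a<length l. of_rat (- ((- 1) ^ (l ! a))) * zeta_sh (?s a))"
    by (subst zeta_sh_sum, intro hoffman1_scale hoffman0_subset s, simp,
      intro sum.cong refl zeta_sh_hom(2) hoffman0_subset s, simp)
  also have "\<dots> = (\<Sum>a<length l. - ((- 1) ^ (l ! a) * zeta0 (?s a)))"
    using s by (intro sum.cong refl) (simp add: zeta_sh_hoffman0 of_rat_power of_rat_minus)
  finally have "zeta_sh (split x\<^sub>1 ?u) = - ((- 1) ^ k * (\<Sum>a<length l. (- 1) ^ (l ! a) * zeta0 (?s a)))"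
    by (simp add: of_rat_power of_rat_minus sum_negf)
  then have "(- 1) ^ k * (zeta_sh ?u - zeta_sh (split x\<^sub>1 ?u)) = (- 1) ^ k * zeta0 ?u + (\<Sum>a<length l. (- 1) ^ (l ! a) * zeta0 (?s a))"
    using u by (simp add: zeta_sh_hoffman0 distrib_left flip: mult.assoc power_mult_distrib)
  \<comment> \<open>\<open>?u\<close> is the summand that singles out the last entry; the cuts give
    the others.\<close>
  also have "\<dots> = omega_value (l @ [k])"
    by (simp add: omega_value_def omit_def nth_append sh_snoc Suc_diff_le flip: append_assoc)
  finally have "omega_value (l @ [k]) = (- 1) ^ k * (zeta_sh ?u - zeta_sh (split x\<^sub>1 ?u))" ..
  then show ?thesis
    using u by (simp add: zeta_S_eq hoffman0_subset scale_S.abs_eq of_rat_power)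
qed

section \<open>Coefficients of products of power series\<close>

definition eq_upto :: "nat \<Rightarrow> 'a::comm_ring_1 fps \<Rightarrow> 'a fps \<Rightarrow> bool" where
  "eq_upto n F G \<longleftrightarrow> (\<forall>i\<le>n. fps_nth F i = fps_nth G i)"

lemma eq_upto_mult: "eq_upto n F F' \<Longrightarrow> eq_upto n G G' \<Longrightarrow> eq_upto n (F * G) (F' * G')"
  unfolding eq_upto_def fps_mult_nth by (auto intro!: sum.cong)

text \<open>At most one part of a composition of \<open>n\<close> exceeds \<open>n / 2\<close>.\<close>

lemma prod_list_small_large:
  fixes g h :: "nat \<Rightarrow> 'a::comm_ring_1 fps"
  assumes h: "\<And>x m. 2 * m \<le> n \<Longrightarrow> fps_nth (h x) m = 0"
  shows "eq_upto n (prod_list (map (\<lambda>x. g x + h x) k))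
    (prod_list (map g k) + (\<Sum>a<length k. h (k ! a) * prod_list (map g (omit a k))))"
proof (induction k)
  case Nil
  then show ?case by (simp add: eq_upto_def)
next
  case (Cons x k)
  let ?S = "\<Sum>a<length k. h (k ! a) * prod_list (map g (omit a k))"
  have "fps_nth (h x * (h y * F)) i = 0" if "i \<le> n" for y F i
  proof -
    \<comment> \<open>Two indices with sum at most \<open>n\<close> cannot both exceed
      \<open>n / 2\<close>.\<close>
    have "fps_nth (h x * h y) j = 0" if "j \<le> n" for j
      unfolding fps_mult_nth
    proof (rule sum.neutral, intro ballI)
      fix m assume "m \<in> {0..j}"
      then have "2 * m \<le> n \<or> 2 * (j - m) \<le> n" using that by auto
      then show "fps_nth (h x) m * fps_nth (h y) (j - m) = 0" using h by auto
    qed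
    then show ?thesis
      using that by (simp add: mult.assoc[symmetric] fps_mult_nth[of "h x * h y"])
  qed
  then have zero: "eq_upto n (h x * ?S) 0"
    by (auto simp: eq_upto_def sum_distrib_left fps_sum_nth intro!: sum.neutral)
  have "eq_upto n (prod_list (map (\<lambda>x. g x + h x) (x # k))) ((g x + h x) * (prod_list (map g k) + ?S))"
    using eq_upto_mult[OF _ Cons.IH, of "g x + h x" "g x + h x"] by (simp add: eq_upto_def)
  moreover have "(g x + h x) * (prod_list (map g k) + ?S) =
      prod_list (map g (x # k)) + (\<Sum>a<length (x # k). h ((x # k) ! a) * prod_list (map g (omit a (x # k)))) + h x * ?S"
    by (simp add: sum.lessThan_Suc_shift omit_def sum_distrib_left sum.distrib algebra_simps del: sum.lessThan_Suc)
  ultimately show ?case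
    using zero by (simp add: eq_upto_def)
qed

lemma norm_prod_list_le:
  fixes F :: "nat \<Rightarrow> complex fps" and G :: "nat \<Rightarrow> real fps"
  assumes "\<And>x m. x \<in> set k \<Longrightarrow> m \<le> N \<Longrightarrow> norm (fps_nth (F x) m) \<le> fps_nth (G x) m" "m \<le> N"
  shows "norm (fps_nth (prod_list (map F k)) m) \<le> fps_nth (prod_list (map G k)) m"
  using assms
proof (induction k arbitrary: m)
  case Nil
  then show ?case by simp
next
  case (Cons x k)
  have "norm (fps_nth (F x) i) * norm (fps_nth (prod_list (map F k)) (m - i)) \<le>
      fps_nth (G x) i * fps_nth (prod_list (map G k)) (m - i)" if "i \<le> m" for i
    using Cons.prems that by (intro mult_mono Cons.IH) (auto intro: order_trans[OF norm_ge_zero Cons.prems(1)])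
  then show ?case
    by (simp add: fps_mult_nth) (auto intro!: sum_norm_le simp: norm_mult)
qed

lemma tendsto_prod_list:
  fixes F :: "nat \<Rightarrow> nat \<Rightarrow> complex fps"
  assumes "\<And>x m. x \<in> set k \<Longrightarrow> (\<lambda>n. fps_nth (F n x) m) \<longlonglongrightarrow> fps_nth (G x) m"
  shows "(\<lambda>n. fps_nth (prod_list (map (F n) k)) m) \<longlonglongrightarrow> fps_nth (prod_list (map G k)) m"
  using assms
  by (induction k arbitrary: m) (auto simp: fps_mult_nth intro!: tendsto_sum tendsto_mult)

section \<open>Roots of unity\<close>

definition unit_root :: "nat \<Rightarrow> complex" where
  "unit_root n = exp (2 * of_real pi * \<i> / of_nat n)"

lemma unit_root_power: "unit_root n ^ m = exp (\<i> * of_real (2 * pi * real m / real n))"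
  by (simp add: unit_root_def algebra_simps flip: exp_of_nat_mult)

lemma unit_root_power_n: "n > 0 \<Longrightarrow> unit_root n ^ n = 1"
  by (simp add: unit_root_power algebra_simps exp_eq_1)

lemma norm_unit_root: "norm (unit_root n ^ m) = 1"
  unfolding unit_root_power by simp

lemma norm_1_minus_unit_root: "norm (1 - unit_root n ^ m) = 2 * \<bar>sin (pi * real m / real n)\<bar>"
  using dist_exp_i_1[of "2 * pi * real m / real n"] by (simp add: unit_root_power norm_minus_commute)

text \<open>Any linear lower bound would do. With \<open>y = x / 2\<close> it follows from
  \<open>y * cos y \<le> sin y\<close> and the double angle formula, since
  \<open>cos x \<ge> 0\<close> gives \<open>(cos y)\<^sup>2 \<ge> 1 / 2\<close>.\<close>

lemma sin_ge_half:
  assumes "0 \<le> x" "x \<le> pi / 2"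
  shows "x / 2 \<le> sin (x :: real)"
proof -
  define y where "y = x / 2"
  have y: "0 \<le> y" "y \<le> pi / 4" using assms by (auto simp: y_def)
  have "sin 0 - 0 * cos 0 \<le> sin y - y * cos y"
  proof (rule DERIV_nonneg_imp_nondecreasing[OF y(1)])
    fix t assume t: "0 \<le> t" "t \<le> y"
    have "((\<lambda>t. sin t - t * cos t) has_real_derivative t * sin t) (at t)"
      by (auto intro!: derivative_eq_intros)
    moreover have "0 \<le> t * sin t" using t y pi_gt_zero by (intro mult_nonneg_nonneg sin_ge_zero) auto
    ultimately show "\<exists>d. ((\<lambda>t. sin t - t * cos t) has_real_derivative d) (at t) \<and> 0 \<le> d" by blast
  qed
  then have 1: "y * cos y \<le> sin y" by simp
  have c: "0 \<le> cos y" using y by (intro cos_ge_zero) auto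
  have "0 \<le> cos x" using assms by (intro cos_ge_zero) auto
  then have 2: "1 / 2 \<le> (cos y)\<^sup>2"
    using cos_double_cos[of y] by (simp add: y_def)
  have "x / 2 = 2 * y * (1 / 2)" by (simp add: y_def)
  also have "\<dots> \<le> 2 * y * (cos y)\<^sup>2" using 2 y by (intro mult_left_mono) auto
  also have "\<dots> = 2 * (y * cos y) * cos y" by (simp add: power2_eq_square)
  also have "\<dots> \<le> 2 * sin y * cos y" using 1 c by (intro mult_right_mono) auto
  also have "\<dots> = sin x" using sin_double[of y] by (simp add: y_def)
  finally show ?thesis .
qed

text \<open>The norm is a quotient of sines at \<open>pi * m / n\<close> and \<open>pi / n\<close>.
  The restriction to \<open>2 * m \<le> n\<close> keeps the first angle within
  \<open>pi / 2\<close>; this bound is what the domination rests on.\<close>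

lemma norm_q_int_ge:
  assumes "0 < m" "2 * m \<le> n"
  shows "real m / 2 \<le> norm (q_int (unit_root n) m)"
proof -
  have n: "n \<ge> 2" using assms by auto
  have pos: "0 < sin (pi / real n)"
    using n pi_gt_zero by (intro sin_gt_zero) (auto simp: field_simps)
  have "sin (pi / real n) \<le> pi / real n"
    by (intro sin_x_le_x) auto
  then have "real m / 2 * sin (pi / real n) \<le> real m / 2 * (pi / real n)"
    by (intro mult_left_mono) auto
  also have "\<dots> = (pi * real m / real n) / 2" by (simp add: field_simps)
  also have "\<dots> \<le> sin (pi * real m / real n)"
    using assms n by (intro sin_ge_half) (auto simp: field_simps)
  also have "\<dots> \<le> \<bar>sin (pi * real m / real n)\<bar>" by simp
  finally have "real m / 2 \<le> \<bar>sin (pi * real m / real n)\<bar> / sin (pi / real n)"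
    using pos by (simp add: field_simps)
  also have "\<dots> = norm (q_int (unit_root n) m)"
    using norm_1_minus_unit_root[of n m] norm_1_minus_unit_root[of n 1] pos by (simp add: q_int_def norm_divide)
  finally show ?thesis .
qed

lemma unit_root_tendsto_1: "unit_root \<longlonglongrightarrow> 1"
proof -
  have "(\<lambda>n. (2 * of_real pi * \<i>) / of_nat n :: complex) \<longlonglongrightarrow> 0"
    by (rule lim_const_over_n)
  from tendsto_exp[OF this] show ?thesis by (simp add: unit_root_def[abs_def])
qed

lemma unit_root_neq_1: "n \<ge> 2 \<Longrightarrow> unit_root n \<noteq> 1"
  using norm_q_int_ge[of 1 n] by (auto simp: q_int_def)

lemma q_int_tendsto: "(\<lambda>n. q_int (unit_root n) m) \<longlonglongrightarrow> of_nat m"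
proof -
  have "(\<lambda>n. \<Sum>j<m. unit_root n ^ j) \<longlonglongrightarrow> (\<Sum>j<m. 1 ^ j)"
    by (intro tendsto_intros unit_root_tendsto_1)
  then have "(\<lambda>n. \<Sum>j<m. unit_root n ^ j) \<longlonglongrightarrow> of_nat m" by simp
  moreover have "\<forall>\<^sub>F n in sequentially. (\<Sum>j<m. unit_root n ^ j) = q_int (unit_root n) m"
    using eventually_ge_at_top[of 2]
  proof eventually_elim
    case (elim n)
    then show ?case by (simp add: q_int_def sum_gp_strict unit_root_neq_1)
  qed
  ultimately show ?thesis by (rule Lim_transform_eventually)
qed

section \<open>The limit \<open>\<Omega>\<close>\<close>

definition qli :: "nat \<Rightarrow> nat \<Rightarrow> complex fps" where
  "qli n k = Abs_fps (\<lambda>m. unit_root n ^ ((k - 1) * m) / q_int (unit_root n) m ^ k)"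

lemma qli_0: "k > 0 \<Longrightarrow> fps_nth (qli n k) 0 = 0"
  by (simp add: qli_def q_int_def)

lemma omega_q_eq: "is_index k \<Longrightarrow> omega_q n k (unit_root n) = fps_nth (prod_list (map (qli n) k)) n"
  by (subst fps_nth_prod_list, simp add: qli_0 is_index_def, simp add: omega_q_def qli_def)

lemma inverse_q_int_power_le:
  assumes "2 * m \<le> n" "k > 0"
  shows "norm (1 / q_int (unit_root n) m ^ k) \<le> 2 ^ k / real m"
proof (cases "m = 0")
  case True
  then show ?thesis using assms by (simp add: q_int_def power_0_left)
next
  case False
  have "norm (1 / q_int (unit_root n) m ^ k) \<le> 1 / (real m / 2) ^ k"
    using norm_q_int_ge[of m n] False assms by (auto simp: norm_divide norm_power intro!: divide_left_mono power_mono mult_pos_pos zero_less_power)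
  also have "\<dots> = 2 ^ k / real m ^ k" by (simp add: power_divide)
  also have "\<dots> \<le> 2 ^ k / real m ^ 1"
    using False assms by (intro divide_left_mono power_increasing) auto
  finally show ?thesis by simp
qed

lemma norm_qli_le:
  assumes "2 * m \<le> n" "k > 0"
  shows "norm (fps_nth (qli n k) m) \<le> fps_nth (fps_const (2 ^ k) * li 1) m"
  using inverse_q_int_power_le[OF assms] by (simp add: qli_def li_def norm_divide norm_unit_root)

lemma qli_tendsto:
  assumes "k > 0"
  shows "(\<lambda>n. fps_nth (qli n k) m) \<longlonglongrightarrow> fps_nth (li k) m"
proof (cases "m = 0")
  case True
  then show ?thesis using assms by (simp add: qli_0 fps_nth_li_0)
next
  case False
  then have "(\<lambda>n. unit_root n ^ ((k - 1) * m) / q_int (unit_root n) m ^ k) \<longlonglongrightarrow> 1 ^ ((k - 1) * m) / of_nat m ^ k"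
    by (intro tendsto_intros unit_root_tendsto_1 q_int_tendsto) auto
  then show ?thesis by (simp add: qli_def li_def)
qed

text \<open>From \<open>q ^ n = 1\<close> one gets \<open>q ^ m\<close> times the q-integer of
  \<open>n - m\<close> equal to minus that of \<open>m\<close>. Raising to the power
  \<open>k\<close> gives \<open>q ^ (m * k)\<close>, of which the numerator cancels all but
  \<open>q ^ m\<close>.\<close>

lemma qli_reflect:
  assumes "m < n" "k > 0"
  shows "fps_nth (qli n k) (n - m) = (- 1) ^ k * (unit_root n ^ m / q_int (unit_root n) m ^ k)"
proof -
  let ?q = "unit_root n"
  have n: "n > 0" using assms by simp
  have q0: "?q \<noteq> 0" by (simp add: unit_root_def)
  have qn: "?q ^ (n - m) * ?q ^ m = 1"
    using unit_root_power_n[OF n] assms by (simp flip: power_add)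
  have "?q ^ m * (1 - ?q ^ (n - m)) = - (1 - ?q ^ m)"
    using qn by (simp add: algebra_simps)
  then have "?q ^ m * q_int ?q (n - m) = - q_int ?q m"
    by (simp add: q_int_def minus_divide_left)
  then have "(?q ^ m * q_int ?q (n - m)) ^ k = (- 1) ^ k * q_int ?q m ^ k"
    by (simp add: power_minus[of "q_int ?q m"])
  then have pw: "q_int ?q m ^ k = (- 1) ^ k * (?q ^ (m * k) * q_int ?q (n - m) ^ k)"
    by (simp add: power_mult_distrib power_mult flip: mult.assoc power_mult_distrib)
  have "?q ^ ((k - 1) * (n - m)) * ?q ^ ((k - 1) * m) = 1"
    using qn by (metis mult.commute power_mult power_mult_distrib power_one)
  moreover have "?q ^ (m * k) = ?q ^ ((k - 1) * m) * ?q ^ m"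
    using assms(2) by (cases k) (simp_all add: algebra_simps flip: power_add)
  ultimately have "?q ^ ((k - 1) * (n - m)) * ?q ^ (m * k) = ?q ^ m"
    by (simp add: mult.assoc[symmetric])
  moreover have "(- 1) ^ k * (- 1) ^ k = (1 :: complex)" by (simp flip: power_mult_distrib)
  moreover have "C = s * A * (s * B)" if "A * B = C" "s * s = 1" for A B C s :: complex
  proof -
    have "s * A * (s * B) = (s * s) * (A * B)" by (simp only: mult_ac)
    then show ?thesis using that by simp
  qed
  ultimately have "?q ^ m / q_int ?q m ^ k = (- 1) ^ k * (?q ^ ((k - 1) * (n - m)) / q_int ?q (n - m) ^ k)"
    unfolding pw using q0 by (auto simp: divide_simps)
  then show ?thesis
    by (simp add: qli_def flip: mult.assoc power_mult_distrib)
qed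

text \<open>The common majorant: with only one factor \<open>1 / m\<close> kept per part, all
  exponents become 1.\<close>

lemma prod_list_scaled_li:
  "prod_list (map (\<lambda>x. fps_const (2 ^ x) * li 1) k) = fps_const (2 ^ sum_list k) * (Li (sh (replicate (length k) 1)) :: real fps)"
proof -
  have "prod_list (map (\<lambda>x. fps_const (2 ^ x) * li 1) k) = fps_const (2 ^ sum_list k) * (li 1 ^ length k :: real fps)"
    by (induction k) (simp_all add: power_add mult_ac flip: fps_const_mult)
  then show ?thesis by (simp add: Li_sh is_index_def)
qed

lemma Li_pos_tendsto_0:
  assumes "u \<in> hoffman1_pos"
  shows "fps_nth (Li u :: real fps) \<longlonglongrightarrow> 0"
proof -
  obtain v where v: "u = v * x\<^sub>1" using assms by (auto simp: hoffman1_pos_def)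
  show ?thesis unfolding v
  proof (induction v rule: hoffman_induct)
    case (word c w)
    have "fps_nth (Li_word (w @ [L1]) :: real fps) \<longlonglongrightarrow> 0"
    proof (rule Lim_null_comparison[OF _ harm_power_over_tendsto_0])
      show "\<forall>\<^sub>F n in sequentially. norm (fps_nth (Li_word (w @ [L1]) :: real fps) n) \<le> harm n ^ length (w @ [L1]) / real n"
        using eventually_gt_at_top[of 0]
      proof eventually_elim
        case (elim n)
        then show ?case
          using Li_word_nonneg[of "w @ [L1]" n] Li_word_le[of "w @ [L1]" n] by (simp add: word1_def)
      qed
    qed
    from tendsto_mult_right_zero[OF this, of "of_rat c"] show ?case
      by (simp add: scale_h_mult_left Li_linear flip: word_append)
  next
    case (add u v)
    from tendsto_add[OF this] show ?case by (simp add: distrib_right Li_linear)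
  qed
qed

lemma omega_q_tendsto:
  assumes k: "is_index k" and r: "length k \<ge> 2"
  shows "(\<lambda>n. omega_q n k (unit_root n)) \<longlonglongrightarrow> complex_of_real (omega_value k)"
proof -
  let ?g = "\<lambda>n x. Abs_fps (\<lambda>m. if 2 * m \<le> n then fps_nth (qli n x) m else 0)"
  let ?h = "\<lambda>n x. Abs_fps (\<lambda>m. if 2 * m \<le> n then 0 else fps_nth (qli n x) m)"
  \<comment> \<open>\<open>M\<close> is the sum of the parts other than the large one, which is
    \<open>n - M\<close>; the factor in front is its reflected value.\<close>
  define t where "t a M n = (if 2 * M < n then (- 1) ^ (k ! a) * (unit_root n ^ M / q_int (unit_root n) M ^ (k ! a))
    * fps_nth (prod_list (map (qli n) (omit a k))) M else 0)" for a M n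
  have omit_index: "is_index (omit a k)" for a
    using k set_take_subset[of a k] set_drop_subset[of "Suc a" k] by (auto simp: is_index_def omit_def)
  have split: "omega_q n k (unit_root n) = fps_nth (prod_list (map (?g n) k)) n + (\<Sum>a<length k. suminf (\<lambda>M. t a M n))" for n
  proof -
    have "qli n = (\<lambda>x. ?g n x + ?h n x)"
      by (auto simp: fps_eq_iff)
    then have "omega_q n k (unit_root n) = fps_nth (prod_list (map (\<lambda>x. ?g n x + ?h n x) k)) n"
      using omega_q_eq[OF k, of n] by simp
    also have "\<dots> = fps_nth (prod_list (map (?g n) k) + (\<Sum>a<length k. ?h n (k ! a) * prod_list (map (?g n) (omit a k)))) n"
      using prod_list_small_large[of n "?h n" "?g n" k] by (simp add: eq_upto_def)
    also have "\<dots> = fps_nth (prod_list (map (?g n) k)) n + (\<Sum>a<length k. fps_nth (prod_list (map (?g n) (omit a k)) * ?h n (k ! a)) n)"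
      by (simp add: fps_sum_nth mult.commute)
    also have "(\<Sum>a<length k. fps_nth (prod_list (map (?g n) (omit a k)) * ?h n (k ! a)) n) = (\<Sum>a<length k. suminf (\<lambda>M. t a M n))"
    proof (rule sum.cong[OF refl])
      fix a assume a: "a \<in> {..<length k}"
      then have ka: "k ! a > 0" using k by (simp add: is_index_def)
      have "fps_nth (prod_list (map (?g n) (omit a k)) * ?h n (k ! a)) n =
          (\<Sum>M=0..n. fps_nth (prod_list (map (?g n) (omit a k))) M * fps_nth (?h n (k ! a)) (n - M))"
        by (rule fps_mult_nth)
      also have "\<dots> = (\<Sum>M=0..n. t a M n)"
      proof (rule sum.cong[OF refl])
        fix M assume M: "M \<in> {0..n}"
        show "fps_nth (prod_list (map (?g n) (omit a k))) M * fps_nth (?h n (k ! a)) (n - M) = t a M n"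
        proof (cases "2 * M < n")
          case True
          \<comment> \<open>The parts of a composition of \<open>M\<close> are at most
            \<open>M\<close>, so the cutoff at \<open>n / 2\<close> does not touch them.\<close>
          have "fps_nth (?g n x) m = fps_nth (qli n x) m" if "m \<le> M" for x m
            using that True by simp
          then have "eq_upto M (prod_list (map (?g n) l)) (prod_list (map (qli n) l))" for l
            by (induction l) (auto intro!: eq_upto_mult, auto simp: eq_upto_def)
          then have "fps_nth (prod_list (map (?g n) (omit a k))) M = fps_nth (prod_list (map (qli n) (omit a k))) M"
            by (simp add: eq_upto_def)
          moreover have "fps_nth (?h n (k ! a)) (n - M) = (- 1) ^ (k ! a) * (unit_root n ^ M / q_int (unit_root n) M ^ (k ! a))"
            using True ka by (simp add: qli_reflect)
          ultimately show ?thesis using True by (simp add: t_def)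
        next
          case False
          then show ?thesis by (simp add: t_def)
        qed
      qed
      also have "\<dots> = (suminf (\<lambda>M. t a M n))"
        by (rule suminf_finite[symmetric]) (auto simp: t_def)
      finally show "fps_nth (prod_list (map (?g n) (omit a k)) * ?h n (k ! a)) n = (suminf (\<lambda>M. t a M n))" .
    qed
    finally show ?thesis .
  qed
  \<comment> \<open>Without a large part every factor obeys the bound of \<open>norm_qli_le\<close>,
    and the majorant is a single coefficient at \<open>n\<close> of a series whose coefficients tend
    to 0.\<close>
  have small: "(\<lambda>n. fps_nth (prod_list (map (?g n) k)) n) \<longlonglongrightarrow> 0"
  proof (rule Lim_null_comparison)
    show "\<forall>\<^sub>F n in sequentially. norm (fps_nth (prod_list (map (?g n) k)) n) \<le>
        2 ^ sum_list k * fps_nth (Li (sh (replicate (length k) 1))) n"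
    proof (rule always_eventually, rule allI)
      fix n
      have "norm (fps_nth (?g n x) m) \<le> fps_nth (fps_const (2 ^ x) * li 1) m" if "x \<in> set k" for x m
        using norm_qli_le[of m n x] that k by (auto simp: is_index_def li_def)
      then have "norm (fps_nth (prod_list (map (?g n) k)) n) \<le> fps_nth (prod_list (map (\<lambda>x. fps_const (2 ^ x) * li 1) k)) n"
        by (intro norm_prod_list_le[where N = n]) auto
      then show "norm (fps_nth (prod_list (map (?g n) k)) n) \<le> 2 ^ sum_list k * fps_nth (Li (sh (replicate (length k) 1))) n"
        unfolding prod_list_scaled_li by simp
    qed
    have "sh (replicate (length k) 1) \<in> hoffman1_pos"
      using r by (intro sh_pos) auto
    from tendsto_mult_right_zero[OF Li_pos_tendsto_0[OF this], of "2 ^ sum_list k"]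
    show "(\<lambda>n. 2 ^ sum_list k * fps_nth (Li (sh (replicate (length k) 1))) n :: real) \<longlonglongrightarrow> 0" .
  qed
  have large: "(\<lambda>n. suminf (\<lambda>M. t a M n)) \<longlonglongrightarrow> complex_of_real ((- 1) ^ (k ! a) * zeta0 (x\<^sub>0 ^ (k ! a) * sh (omit a k)))"
    if a: "a < length k" for a
  proof -
    let ?l = "omit a k"
    have ka: "k ! a > 0" using k a by (simp add: is_index_def)
    have len: "?l \<noteq> []" using a r by (auto simp: omit_def)
    define b where "b M = (- 1) ^ (k ! a) * fps_nth (Li (x\<^sub>0 ^ (k ! a) * sh ?l) :: real fps) M" for M
    \<comment> \<open>The powers of 2 come from the bounds on q-integers. The reflected part
      contributes \<open>1 / M\<close>, hence the x_0, which makes the majorant summable because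
      \<open>length k \<ge> 2\<close> leaves at least one other part.\<close>
    define B where "B M = 2 ^ (k ! a) * 2 ^ sum_list ?l * fps_nth (Li (x\<^sub>0 * sh (replicate (length ?l) 1)) :: real fps) M" for M
    have "(\<lambda>n. suminf (\<lambda>M. t a M n)) \<longlonglongrightarrow> suminf (\<lambda>M. complex_of_real (b M))"
    proof (rule tannerys_theorem[THEN conjunct2, THEN conjunct2])
      fix M
      have "(\<lambda>n. fps_nth (prod_list (map (qli n) ?l)) M) \<longlonglongrightarrow> fps_nth (prod_list (map li ?l)) M"
        using omit_index[of a] by (intro tendsto_prod_list qli_tendsto) (auto simp: is_index_def)
      moreover have "(\<lambda>n. unit_root n ^ M / q_int (unit_root n) M ^ (k ! a)) \<longlonglongrightarrow> 1 / of_nat M ^ (k ! a)"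
      proof (cases "M = 0")
        case True
        then show ?thesis using ka by (simp add: q_int_def power_0_left)
      next
        case False
        then have "(\<lambda>n. unit_root n ^ M / q_int (unit_root n) M ^ (k ! a)) \<longlonglongrightarrow> 1 ^ M / of_nat M ^ (k ! a)"
          by (intro tendsto_intros unit_root_tendsto_1 q_int_tendsto) auto
        then show ?thesis by simp
      qed
      ultimately have "(\<lambda>n. (- 1) ^ (k ! a) * (unit_root n ^ M / q_int (unit_root n) M ^ (k ! a)) * fps_nth (prod_list (map (qli n) ?l)) M)
          \<longlonglongrightarrow> (- 1) ^ (k ! a) * (1 / of_nat M ^ (k ! a)) * fps_nth (prod_list (map li ?l)) M"
        by (intro tendsto_mult tendsto_const)
      moreover have "(- 1) ^ (k ! a) * (1 / of_nat M ^ (k ! a)) * fps_nth (prod_list (map li ?l)) M = complex_of_real (b M)"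
      proof -
        have "fps_nth (prod_list (map li l)) M = complex_of_real (fps_nth (prod_list (map li l)) M)" for l M
          by (induction l arbitrary: M) (simp_all add: fps_mult_nth li_def)
        then show ?thesis by (simp add: b_def fps_nth_Li_x0_power Li_sh omit_index)
      qed
      ultimately have "(\<lambda>n. (- 1) ^ (k ! a) * (unit_root n ^ M / q_int (unit_root n) M ^ (k ! a)) * fps_nth (prod_list (map (qli n) ?l)) M)
          \<longlonglongrightarrow> complex_of_real (b M)" by simp
      then show "(\<lambda>n. t a M n) \<longlonglongrightarrow> complex_of_real (b M)"
        by (rule Lim_transform_eventually) (use eventually_gt_at_top[of "2 * M"] in eventually_elim, simp add: t_def)
    next
      have "norm (t a M n) \<le> B M" for M n
      proof (cases "2 * M < n")
        case True
        have "norm (fps_nth (prod_list (map (qli n) ?l)) M) \<le> fps_nth (prod_list (map (\<lambda>x. fps_const (2 ^ x) * li 1) ?l)) M"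
          using True omit_index[of a] by (intro norm_prod_list_le[where N = M] norm_qli_le) (auto simp: is_index_def)
        moreover have "norm (unit_root n ^ M / q_int (unit_root n) M ^ (k ! a)) \<le> 2 ^ (k ! a) / real M"
          using inverse_q_int_power_le[of M n "k ! a"] True ka by (simp add: norm_divide norm_unit_root)
        ultimately have "norm (unit_root n ^ M / q_int (unit_root n) M ^ (k ! a)) * norm (fps_nth (prod_list (map (qli n) ?l)) M)
            \<le> 2 ^ (k ! a) / real M * fps_nth (prod_list (map (\<lambda>x. fps_const (2 ^ x) * li 1) ?l)) M"
          by (intro mult_mono) auto
        also have "\<dots> = B M"
          unfolding prod_list_scaled_li by (simp add: B_def fps_nth_Li_x0)
        finally show ?thesis using True by (simp add: t_def norm_mult norm_power norm_divide)
      next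
        case False
        have "0 \<le> fps_nth (Li (sh (replicate j 1)) :: real fps) M" for j
          by (induction j arbitrary: M) (simp_all add: sh_simps Li_1 Li_shuffle y_gen_hoffman1 sh_hoffman1 Li_y_gen
            fps_mult_nth li_def sum_nonneg)
        then show ?thesis using False by (simp add: t_def B_def fps_nth_Li_x0)
      qed
      then show "\<forall>\<^sub>F (M, n) in at_top \<times>\<^sub>F sequentially. norm (t a M n) \<le> B M"
        by (intro always_eventually) auto
      show "summable B"
        unfolding B_def using len by (intro summable_mult summable_Li_x0 sh_pos) auto
    qed simp
    moreover have "suminf (\<lambda>M. complex_of_real (b M)) = complex_of_real ((- 1) ^ (k ! a) * zeta0 (x\<^sub>0 ^ (k ! a) * sh ?l))"
    proof -
      have "summable (fps_nth (Li (x\<^sub>0 ^ (k ! a) * sh ?l) :: real fps))"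
        by (rule hoffman0_summable[OF x0_power_hoffman0[OF ka sh_pos[OF len]]])
      then have "b sums ((- 1) ^ (k ! a) * zeta0 (x\<^sub>0 ^ (k ! a) * sh ?l))"
        unfolding b_def zeta0_def by (intro sums_mult summable_sums)
      then show ?thesis by (intro sums_unique[symmetric] sums_of_real)
    qed
    ultimately show ?thesis by simp
  qed
  have "(\<lambda>n. fps_nth (prod_list (map (?g n) k)) n + (\<Sum>a<length k. suminf (\<lambda>M. t a M n))) \<longlonglongrightarrow>
      0 + (\<Sum>a<length k. complex_of_real ((- 1) ^ (k ! a) * zeta0 (x\<^sub>0 ^ (k ! a) * sh (omit a k))))"
    by (intro tendsto_add tendsto_sum small large) simp
  then show ?thesis unfolding split by (simp add: omega_value_def)
qed

theorem theorem1p6: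
  fixes k :: "nat list"
  assumes "is_index k" and "length k \<ge> 2"
  shows "omega_A k =
           (- 1) ^ last k * zeta_A (x\<^sub>0 ^ last k * shuffle_list (map y_gen (butlast k))) \<and>
         omega_S k =
           scale_S ((- 1) ^ last k) (zeta_S (x\<^sub>0 ^ last k * shuffle_list (map y_gen (butlast k))))"
proof -
  have ne: "k \<noteq> []" "butlast k \<noteq> []"
    using assms(2) by (cases k; cases "tl k"; auto)+
  then have k: "butlast k @ [last k] = k" by simp
  have idx: "is_index (butlast k @ [last k])" using assms(1) unfolding k .
  have "Omega k = complex_of_real (omega_value k)"
    unfolding Omega_def using omega_q_tendsto[OF assms] by (intro limI) (simp add: unit_root_def)
  then have "omega_S k = abs_quot_S (complex_of_real (omega_value (butlast k @ [last k])))"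
    unfolding k by (simp add: omega_S_def)
  also have "\<dots> = scale_S ((- 1) ^ last k) (zeta_S (x\<^sub>0 ^ last k * sh (butlast k)))"
    by (rule zeta_S_x0_power_sh[OF idx ne(2), symmetric])
  finally show ?thesis
    using omega_A_eq[OF idx ne(2)] unfolding k sh_def by simp
qed

end
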